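(* For every $m\ge 0$ the morphism $\rho_m:\mathcal A_\infty\to\mathcal A_m$ is onto.
   Context: Indices $j\in\{1,2,3\}$ are taken mod $3$. $M_3(\mathbb C)$ has matrix units $e_{ij}$; $e_{22}^*$ is the state $m\mapsto m_{22}$ on $M_3(\mathbb C)$. $\mathrm{UHF}(3^\infty)$ is the $C^*$-inductive limit of $M_3(\mathbb C)^{\otimes n}$ under $x\mapsto x\otimes I_3$; each $M_3(\mathbb C)^{\otimes n}$ is regarded as a unital subalgebra of it. For $n\ge0$ put $\alpha^n_j=e_{jj}\otimes e_{22}^{\otimes n}\in M_3(\mathbb C)^{\otimes(n+1)}$, and for $k\ge1$ put $\beta^k_j=(e_{jj}\otimes e_{11}+e_{j+2,j+2}\otimes e_{33})\otimes e_{22}^{\otimes(k-1)}\in M_3(\mathbb C)^{\otimes(k+1)}$. The finite-dimensional $*$-algebra $\mathcal A_n\subset M_3(\mathbb C)^{\otimes(n+1)}$ is the linear span of the $\alpha^n_j$ and of the $x\otimes\beta^k_j$ with $j=1,2,3$, $k=1,\dots,n$, $x\in M_3(\mathbb C)^{\otimes(n-k)}$. $\mathcal A_\infty$ is the $C^*$-subalgebra of $\mathrm{UHF}(3^\infty)$ of all norm limits $\lim_n a_n$ with $a_n\in\mathcal A_n$. The slice map $\rho_m=id_{m+1}\otimes(e_{22}^* )^{\otimes[m+2,\infty)}:\mathrm{UHF}(3^\infty)\to M_3(\mathbb C)^{\otimes(m+1)}$ is the identity on the first $m+1$ tensor factors and applies $e_{22}^*$ to each of the others; it restricts to a $C^*$-algebra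 morphism $\mathcal A_\infty\to\mathcal A_m$. *)

theory Defs
  imports
    "Jordan_Normal_Form.Schur_Decomposition"
    "Jordan_Normal_Form.VS_Connect"
    "HOL-Analysis.L2_Norm"
begin

subsection \<open>Kronecker products\<close>

text \<open>Basis tensors are ordered lexicographically, so the last tensor factor is the least
  significant digit of an index.\<close>

definition kron :: "complex mat \<Rightarrow> complex mat \<Rightarrow> complex mat"  (infixl \<open>\<otimes>\<^sub>k\<close> 72) where
  "A \<otimes>\<^sub>k B = mat (dim_row A * dim_row B) (dim_col A * dim_col B)
     (\<lambda>(i, j). A $$ (i div dim_row B, j div dim_col B) * B $$ (i mod dim_row B, j mod dim_col B))"

lemma dim_kron [simp]:
  "dim_row (A \<otimes>\<^sub>k B) = dim_row A * dim_row B" "dim_col (A \<otimes>\<^sub>k B) = dim_col A * dim_col B"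
  by (simp_all add: kron_def)

lemma kron_carrier [intro]:
  "A \<in> carrier_mat a b \<Longrightarrow> B \<in> carrier_mat c d \<Longrightarrow> A \<otimes>\<^sub>k B \<in> carrier_mat (a * c) (b * d)"
  by (auto intro!: carrier_matI)

lemma div_mod_less_mult:
  fixes i a b :: nat
  assumes "i < a * b"
  shows "i div b < a" "i mod b < b" "0 < b"
proof -
  show "0 < b" using assms by (cases b) auto
  then show "i mod b < b" by simp
  show "i div b < a" using assms by (simp add: less_mult_imp_div_less)
qed

lemma index_kron [simp]:
  "i < dim_row A * dim_row B \<Longrightarrow> j < dim_col A * dim_col B \<Longrightarrow>
   (A \<otimes>\<^sub>k B) $$ (i, j) = A $$ (i div dim_row B, j div dim_col B) * B $$ (i mod dim_row B, j mod dim_col B)"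
  by (simp add: kron_def)

lemma kron_assoc: "A \<otimes>\<^sub>k B \<otimes>\<^sub>k C = A \<otimes>\<^sub>k (B \<otimes>\<^sub>k C)"
proof (rule eq_matI, goal_cases)
  case (1 i j)
  then have i: "i < dim_row A * dim_row B * dim_row C" and j: "j < dim_col A * dim_col B * dim_col C"
    by (simp_all add: mult.assoc)
  have i': "i div dim_row C < dim_row A * dim_row B" "i mod (dim_row B * dim_row C) < dim_row B * dim_row C"
    using div_mod_less_mult[OF i] div_mod_less_mult[of i "dim_row A" "dim_row B * dim_row C"] i
    by (simp_all add: mult.assoc)
  have j': "j div dim_col C < dim_col A * dim_col B" "j mod (dim_col B * dim_col C) < dim_col B * dim_col C"
    using div_mod_less_mult[OF j] div_mod_less_mult[of j "dim_col A" "dim_col B * dim_col C"] j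
    by (simp_all add: mult.assoc)
  have aux: "k div (r * s) = k div s div r" "k mod (r * s) div s = k div s mod r" "k mod (r * s) mod s = k mod s"
    if "k < x * r * s" for k r s x :: nat
  proof -
    have "0 < s" using div_mod_less_mult(3)[OF that] .
    have "k mod (r * s) = s * (k div s mod r) + k mod s"
      using mod_mult2_eq[of k s r] by (simp add: mult.commute)
    then show "k mod (r * s) div s = k div s mod r" using \<open>0 < s\<close> by simp
    show "k div (r * s) = k div s div r" using div_mult2_eq[of k s r] by (simp add: mult.commute)
    show "k mod (r * s) mod s = k mod s" using mod_mult2_eq[of k s r] by (simp add: mult.commute)
  qed
  show ?case using i j i' j' by (simp add: aux[OF i] aux[OF j] mult.assoc)
qed (simp_all add: mult.assoc)

lemma kron_add_left:
  assumes "A \<in> carrier_mat a b" "A' \<in> carrier_mat a b"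
  shows "(A + A') \<otimes>\<^sub>k B = A \<otimes>\<^sub>k B + A' \<otimes>\<^sub>k B"
  using assms by (intro eq_matI) (auto simp: div_mod_less_mult algebra_simps)

lemma kron_minus_left:
  assumes "A \<in> carrier_mat a b" "A' \<in> carrier_mat a b"
  shows "(A - A') \<otimes>\<^sub>k B = A \<otimes>\<^sub>k B - A' \<otimes>\<^sub>k B"
  using assms by (intro eq_matI) (auto simp: div_mod_less_mult algebra_simps)

lemma kron_smult_left: "(c \<cdot>\<^sub>m A) \<otimes>\<^sub>k B = c \<cdot>\<^sub>m (A \<otimes>\<^sub>k B)"
  by (intro eq_matI) (auto simp: div_mod_less_mult)

lemma kron_zero_left [simp]: "0\<^sub>m a b \<otimes>\<^sub>k B = 0\<^sub>m (a * dim_row B) (b * dim_col B)"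
  by (intro eq_matI) (auto simp: div_mod_less_mult)

lemma kron_one_one [simp]: "1\<^sub>m a \<otimes>\<^sub>k 1\<^sub>m b = 1\<^sub>m (a * b)"
proof (rule eq_matI, goal_cases)
  case (1 i j)
  then have ij: "i < a * b" "j < a * b" by auto
  note d = div_mod_less_mult[OF ij(1)] div_mod_less_mult[OF ij(2)]
  have "i = j \<longleftrightarrow> i div b = j div b \<and> i mod b = j mod b"
    by (metis div_mult_mod_eq)
  with ij d show ?case by auto
qed auto

lemma kron_one_right [simp]: "A \<otimes>\<^sub>k 1\<^sub>m 1 = A" "A \<otimes>\<^sub>k 1\<^sub>m (Suc 0) = A"
  by (intro eq_matI; auto)+

lemma sum_div_mod:
  fixes f :: "nat \<Rightarrow> nat \<Rightarrow> 'b::comm_monoid_add"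
  shows "(\<Sum>k<a * b. f (k div b) (k mod b)) = (\<Sum>i<a. \<Sum>j<b. f i j)"
proof -
  have "(\<Sum>i<a. \<Sum>j<b. f i j) = (\<Sum>i<a. sum (\<lambda>k. f (k div b) (k mod b)) {i * b..<i * b + b})"
  proof (rule sum.cong[OF refl])
    fix i
    have "sum (\<lambda>k. f (k div b) (k mod b)) {i * b..<i * b + b} = sum (\<lambda>k. f ((k + i * b) div b) ((k + i * b) mod b)) {0..<b}"
      using sum.shift_bounds_nat_ivl[of "\<lambda>k. f (k div b) (k mod b)" 0 "i * b" b]
      by (simp add: add.commute)
    also have "\<dots> = (\<Sum>j<b. f i j)"
      by (rule sum.cong) auto
    finally show "(\<Sum>j<b. f i j) = sum (\<lambda>k. f (k div b) (k mod b)) {i * b..<i * b + b}" by simp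
  qed
  also have "\<dots> = (\<Sum>k<a * b. f (k div b) (k mod b))"
    by (rule sum.nat_group)
  finally show ?thesis by simp
qed

lemma kron_mult:
  assumes "A \<in> carrier_mat a b" "B \<in> carrier_mat c d" "C \<in> carrier_mat b e" "D \<in> carrier_mat d g"
  shows "(A \<otimes>\<^sub>k B) * (C \<otimes>\<^sub>k D) = (A * C) \<otimes>\<^sub>k (B * D)"
proof (rule eq_matI, goal_cases)
  case (1 i j)
  with assms have ij: "i < a * c" "j < e * g" by auto
  note di = div_mod_less_mult[OF ij(1)] and dj = div_mod_less_mult[OF ij(2)]
  have "((A \<otimes>\<^sub>k B) * (C \<otimes>\<^sub>k D)) $$ (i, j) = (\<Sum>k<b * d. (A \<otimes>\<^sub>k B) $$ (i, k) * (C \<otimes>\<^sub>k D) $$ (k, j))"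
    using ij assms by (auto simp: scalar_prod_def atLeast0LessThan)
  also have "\<dots> = (\<Sum>k<b * d. (\<lambda>p q. (A $$ (i div c, p) * B $$ (i mod c, q)) * (C $$ (p, j div g) * D $$ (q, j mod g)))
      (k div d) (k mod d))"
    using ij assms by (intro sum.cong) auto
  also have "\<dots> = (\<Sum>p<b. \<Sum>q<d. (A $$ (i div c, p) * C $$ (p, j div g)) * (B $$ (i mod c, q) * D $$ (q, j mod g)))"
    by (subst sum_div_mod) (simp add: mult_ac)
  also have "\<dots> = (\<Sum>p<b. A $$ (i div c, p) * C $$ (p, j div g)) * (\<Sum>q<d. B $$ (i mod c, q) * D $$ (q, j mod g))"
    by (simp add: sum_product)
  also have "\<dots> = ((A * C) \<otimes>\<^sub>k (B * D)) $$ (i, j)"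
    using ij di dj assms by (auto simp: scalar_prod_def atLeast0LessThan)
  finally show ?case .
qed (use assms in auto)

lemma dim_mat_adjoint [simp]: "dim_row (mat_adjoint A) = dim_col A" "dim_col (mat_adjoint A) = dim_row A"
  by (simp_all add: mat_adjoint_def)

lemma mat_adjoint_carrier [intro]:
  "A \<in> carrier_mat a b \<Longrightarrow> mat_adjoint A \<in> carrier_mat b a"
  by (auto intro!: carrier_matI)

lemma index_mat_adjoint [simp]:
  "i < dim_col A \<Longrightarrow> j < dim_row A \<Longrightarrow> mat_adjoint A $$ (i, j) = conjugate (A $$ (j, i))"
  by (simp add: mat_adjoint_def mat_of_rows_index)

lemma mat_adjoint_adjoint [simp]: "mat_adjoint (mat_adjoint (A :: complex mat)) = A"
  by (intro eq_matI) auto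

lemma kron_adjoint: "mat_adjoint (A \<otimes>\<^sub>k B) = mat_adjoint A \<otimes>\<^sub>k mat_adjoint B"
  by (intro eq_matI) (auto simp: div_mod_less_mult)

lemma mat_adjoint_one [simp]: "mat_adjoint (1\<^sub>m n :: complex mat) = 1\<^sub>m n"
  by (intro eq_matI) auto

lemma mat_adjoint_zero [simp]: "mat_adjoint (0\<^sub>m a b :: complex mat) = 0\<^sub>m b a"
  by (intro eq_matI) auto

lemma mat_adjoint_add:
  "A \<in> carrier_mat a b \<Longrightarrow> B \<in> carrier_mat a b \<Longrightarrow>
   mat_adjoint (A + B :: complex mat) = mat_adjoint A + mat_adjoint B"
  by (intro eq_matI) auto

lemma mat_adjoint_minus:
  "A \<in> carrier_mat a b \<Longrightarrow> B \<in> carrier_mat a b \<Longrightarrow>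
   mat_adjoint (A - B :: complex mat) = mat_adjoint A - mat_adjoint B"
  by (intro eq_matI) auto

lemma mat_adjoint_smult: "mat_adjoint (c \<cdot>\<^sub>m A :: complex mat) = cnj c \<cdot>\<^sub>m mat_adjoint A"
  by (intro eq_matI) auto

lemma mat_adjoint_mult:
  assumes "A \<in> carrier_mat a b" "B \<in> carrier_mat b c"
  shows "mat_adjoint (A * B :: complex mat) = mat_adjoint B * mat_adjoint A"
  using assms by (intro eq_matI) (auto simp: scalar_prod_def mult.commute)

subsection \<open>The operator norm\<close>

definition vec_norm :: "complex vec \<Rightarrow> real" where
  "vec_norm v = L2_set (\<lambda>i. cmod (v $ i)) {..<dim_vec v}"

definition op_norm :: "complex mat \<Rightarrow> real" where
  "op_norm A = (SUP v\<in>{v \<in> carrier_vec (dim_col A). vec_norm v \<le> 1}. vec_norm (A *\<^sub>v v))"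

lemma vec_norm_nonneg [simp]: "0 \<le> vec_norm v"
  by (simp add: vec_norm_def)

lemma vec_norm_zero [simp]: "vec_norm (0\<^sub>v n) = 0"
  by (simp add: vec_norm_def L2_set_def)

lemma vec_norm_eq_0: "vec_norm v = 0 \<Longrightarrow> v \<in> carrier_vec n \<Longrightarrow> v = 0\<^sub>v n"
  by (auto simp: vec_norm_def L2_set_eq_0_iff)

lemma vec_norm_smult: "vec_norm (c \<cdot>\<^sub>v v) = cmod c * vec_norm v"
  by (auto simp: vec_norm_def norm_mult L2_set_right_distrib intro!: L2_set_cong)

lemma vec_norm_triangle:
  assumes "v \<in> carrier_vec n" "w \<in> carrier_vec n"
  shows "vec_norm (v + w) \<le> vec_norm v + vec_norm w"
proof -
  have "vec_norm (v + w) \<le> L2_set (\<lambda>i. cmod (v $ i) + cmod (w $ i)) {..<n}"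
    using assms unfolding vec_norm_def by (auto intro!: L2_set_mono norm_triangle_ineq)
  also have "\<dots> \<le> vec_norm v + vec_norm w"
    using assms unfolding vec_norm_def by (auto intro!: order.trans[OF L2_set_triangle_ineq])
  finally show ?thesis .
qed

lemma norm_index_le_vec_norm: "i < dim_vec v \<Longrightarrow> cmod (v $ i) \<le> vec_norm v"
  unfolding vec_norm_def by (rule member_le_L2_set) auto

lemma vec_norm_power2: "(vec_norm v)\<^sup>2 = (\<Sum>i<dim_vec v. (cmod (v $ i))\<^sup>2)"
  by (simp add: vec_norm_def L2_set_def sum_nonneg)

lemma vec_norm_cscalar: "complex_of_real ((vec_norm v)\<^sup>2) = v \<bullet>c v"
  by (simp add: vec_norm_power2 scalar_prod_def atLeast0LessThan complex_norm_square del: of_real_power)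

lemma cscalar_le_vec_norm:
  assumes "v \<in> carrier_vec n" "w \<in> carrier_vec n"
  shows "cmod (v \<bullet>c w) \<le> vec_norm v * vec_norm w"
proof -
  have "cmod (v \<bullet>c w) \<le> (\<Sum>i<n. \<bar>cmod (v $ i)\<bar> * \<bar>cmod (w $ i)\<bar>)"
    using assms by (auto simp: scalar_prod_def atLeast0LessThan norm_mult intro!: order.trans[OF norm_sum])
  also have "\<dots> \<le> vec_norm v * vec_norm w"
    using assms L2_set_mult_ineq[of "\<lambda>i. cmod (v $ i)" "\<lambda>i. cmod (w $ i)" "{..<n}"]
    by (auto simp: vec_norm_def)
  finally show ?thesis .
qed

lemma vec_norm_unit [simp]: "i < n \<Longrightarrow> vec_norm (unit_vec n i) = 1"
proof -
  assume i: "i < n"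
  have "(vec_norm (unit_vec n i))\<^sup>2 = (\<Sum>k<n. if k = i then 1 else 0)"
    unfolding vec_norm_power2 by (rule sum.cong) (use i in auto)
  also have "\<dots> = 1" using i by simp
  finally show ?thesis
    using vec_norm_nonneg[of "unit_vec n i"] by (simp add: power2_eq_1_iff)
qed

lemma vec_norm_mult_mat_bounded:
  assumes A: "A \<in> carrier_mat n m" and v: "v \<in> carrier_vec m"
  shows "vec_norm (A *\<^sub>v v) \<le> (\<Sum>i<n. \<Sum>j<m. cmod (A $$ (i, j))) * vec_norm v"
proof -
  have "vec_norm (A *\<^sub>v v) \<le> (\<Sum>i<n. cmod ((A *\<^sub>v v) $ i))"
    using A by (auto simp: vec_norm_def intro!: order.trans[OF L2_set_le_sum])
  also have "\<dots> \<le> (\<Sum>i<n. \<Sum>j<m. cmod (A $$ (i, j)) * vec_norm v)"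
  proof (rule sum_mono)
    fix i assume "i \<in> {..<n}"
    then have "(A *\<^sub>v v) $ i = (\<Sum>j<m. A $$ (i, j) * v $ j)"
      using A v by (auto simp: scalar_prod_def atLeast0LessThan)
    also have "cmod \<dots> \<le> (\<Sum>j<m. cmod (A $$ (i, j)) * vec_norm v)"
      using v by (intro order.trans[OF norm_sum] sum_mono)
        (auto simp: norm_mult intro!: mult_left_mono norm_index_le_vec_norm)
    finally show "cmod ((A *\<^sub>v v) $ i) \<le> (\<Sum>j<m. cmod (A $$ (i, j)) * vec_norm v)" .
  qed
  finally show ?thesis by (simp add: sum_distrib_right)
qed

lemma op_norm_bdd:
  assumes A: "A \<in> carrier_mat n m"
  shows "bdd_above ((\<lambda>v. vec_norm (A *\<^sub>v v)) ` {v \<in> carrier_vec (dim_col A). vec_norm v \<le> 1})"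
proof (rule bdd_aboveI2)
  fix v assume v: "v \<in> {v \<in> carrier_vec (dim_col A). vec_norm v \<le> 1}"
  have "vec_norm (A *\<^sub>v v) \<le> (\<Sum>i<n. \<Sum>j<m. cmod (A $$ (i, j))) * vec_norm v"
    using v A by (intro vec_norm_mult_mat_bounded) auto
  also have "\<dots> \<le> (\<Sum>i<n. \<Sum>j<m. cmod (A $$ (i, j))) * 1"
    using v by (intro mult_left_mono) (auto intro!: sum_nonneg)
  finally show "vec_norm (A *\<^sub>v v) \<le> (\<Sum>i<n. \<Sum>j<m. cmod (A $$ (i, j)))" by simp
qed

lemma op_norm_nonneg [simp]: "0 \<le> op_norm A"
proof -
  have A: "A \<in> carrier_mat (dim_row A) (dim_col A)" by auto
  have "vec_norm (A *\<^sub>v 0\<^sub>v (dim_col A)) \<le> op_norm A"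
    unfolding op_norm_def by (rule cSUP_upper[OF _ op_norm_bdd[OF A]]) auto
  then show ?thesis using vec_norm_nonneg order.trans by blast
qed

lemma vec_norm_le_op_norm:
  assumes A: "A \<in> carrier_mat n m" and v: "v \<in> carrier_vec m"
  shows "vec_norm (A *\<^sub>v v) \<le> op_norm A * vec_norm v"
proof (cases "vec_norm v = 0")
  case True
  then have "v = 0\<^sub>v m" using v by (rule vec_norm_eq_0)
  then have "A *\<^sub>v v = 0\<^sub>v n" using A by auto
  then show ?thesis using True by simp
next
  case False
  define c where "c = complex_of_real (inverse (vec_norm v))"
  have c: "cmod c = inverse (vec_norm v)" by (simp add: c_def norm_inverse)
  have "vec_norm (A *\<^sub>v (c \<cdot>\<^sub>v v)) \<le> op_norm A"
    unfolding op_norm_def using A v False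
    by (intro cSUP_upper[OF _ op_norm_bdd[OF A]]) (auto simp: vec_norm_smult c)
  also have "A *\<^sub>v (c \<cdot>\<^sub>v v) = c \<cdot>\<^sub>v (A *\<^sub>v v)"
    using A v by (rule mult_mat_vec)
  finally have "inverse (vec_norm v) * vec_norm (A *\<^sub>v v) \<le> op_norm A"
    by (simp add: vec_norm_smult c)
  moreover have "0 < vec_norm v" using False vec_norm_nonneg[of v] by linarith
  ultimately show ?thesis by (simp add: field_simps)
qed

lemma op_norm_leI:
  assumes A: "A \<in> carrier_mat n m" and C: "0 \<le> C"
    and le: "\<And>v. v \<in> carrier_vec m \<Longrightarrow> vec_norm (A *\<^sub>v v) \<le> C * vec_norm v"
  shows "op_norm A \<le> C"
  unfolding op_norm_def
proof (rule cSUP_least)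
  have "0\<^sub>v (dim_col A) \<in> {v \<in> carrier_vec (dim_col A). vec_norm v \<le> 1}" by simp
  then show "{v \<in> carrier_vec (dim_col A). vec_norm v \<le> 1} \<noteq> {}" by blast
next
  fix v assume v: "v \<in> {v \<in> carrier_vec (dim_col A). vec_norm v \<le> 1}"
  then have "vec_norm (A *\<^sub>v v) \<le> C * vec_norm v" using A by (intro le) auto
  also have "\<dots> \<le> C * 1" using v C by (intro mult_left_mono) auto
  finally show "vec_norm (A *\<^sub>v v) \<le> C" by simp
qed

lemma op_norm_zero [simp]: "op_norm (0\<^sub>m n m) = 0"
proof -
  have "op_norm (0\<^sub>m n m) \<le> 0"
  proof (rule op_norm_leI[where n = n and m = m])
    fix v :: "complex vec" assume "v \<in> carrier_vec m"
    then have "0\<^sub>m n m *\<^sub>v v = 0\<^sub>v n" by (intro eq_vecI) (auto simp: scalar_prod_def)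
    then show "vec_norm (0\<^sub>m n m *\<^sub>v v) \<le> 0 * vec_norm v" by simp
  qed auto
  then show ?thesis using op_norm_nonneg[of "0\<^sub>m n m"] by linarith
qed

lemma op_norm_triangle:
  assumes A: "A \<in> carrier_mat n m" and B: "B \<in> carrier_mat n m"
  shows "op_norm (A + B) \<le> op_norm A + op_norm B"
proof (rule op_norm_leI[where n = n and m = m])
  fix v :: "complex vec" assume v: "v \<in> carrier_vec m"
  have "vec_norm ((A + B) *\<^sub>v v) = vec_norm (A *\<^sub>v v + B *\<^sub>v v)"
    using A B v by (simp add: add_mult_distrib_mat_vec)
  also have "\<dots> \<le> vec_norm (A *\<^sub>v v) + vec_norm (B *\<^sub>v v)"
    using A B v by (intro vec_norm_triangle[where n = n]) auto
  also have "\<dots> \<le> op_norm A * vec_norm v + op_norm B * vec_norm v"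
    using A B v by (intro add_mono vec_norm_le_op_norm) auto
  finally show "vec_norm ((A + B) *\<^sub>v v) \<le> (op_norm A + op_norm B) * vec_norm v"
    by (simp add: algebra_simps)
qed (use A B in auto)

lemma op_norm_smult_le:
  assumes A: "A \<in> carrier_mat n m"
  shows "op_norm (c \<cdot>\<^sub>m A) \<le> cmod c * op_norm A"
proof (rule op_norm_leI[where n = n and m = m])
  fix v :: "complex vec" assume v: "v \<in> carrier_vec m"
  have "(c \<cdot>\<^sub>m A) *\<^sub>v v = c \<cdot>\<^sub>v (A *\<^sub>v v)"
    using A v by (intro eq_vecI) (auto simp: scalar_prod_def sum_distrib_left mult_ac)
  then show "vec_norm ((c \<cdot>\<^sub>m A) *\<^sub>v v) \<le> cmod c * op_norm A * vec_norm v"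
    using vec_norm_le_op_norm[OF A v] by (simp add: vec_norm_smult mult.assoc mult_left_mono)
qed (use A in auto)

lemma op_norm_smult:
  assumes A: "A \<in> carrier_mat n m"
  shows "op_norm (c \<cdot>\<^sub>m A) = cmod c * op_norm A"
proof (cases "c = 0")
  case True
  then have "c \<cdot>\<^sub>m A = 0\<^sub>m n m" using A by (intro eq_matI) auto
  then show ?thesis using True by simp
next
  case False
  have "inverse c \<cdot>\<^sub>m (c \<cdot>\<^sub>m A) = A" using A False by (intro eq_matI) auto
  then have "op_norm A \<le> cmod (inverse c) * op_norm (c \<cdot>\<^sub>m A)"
    using op_norm_smult_le[of "c \<cdot>\<^sub>m A" n m "inverse c"] A by simp
  then have "cmod c * op_norm A \<le> op_norm (c \<cdot>\<^sub>m A)"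
    using False by (simp add: norm_divide inverse_eq_divide field_simps)
  then show ?thesis using op_norm_smult_le[OF A, of c] by linarith
qed

lemma op_norm_minus_commute:
  assumes A: "A \<in> carrier_mat n m" and B: "B \<in> carrier_mat n m"
  shows "op_norm (A - B) = op_norm (B - A)"
proof -
  have "B - A = (-1) \<cdot>\<^sub>m (A - B)" using A B by (intro eq_matI) auto
  then show ?thesis using op_norm_smult[of "A - B" n m "-1"] A B by (simp add: minus_carrier_mat)
qed

lemma op_norm_triangle_minus:
  assumes A: "A \<in> carrier_mat n m" and B: "B \<in> carrier_mat n m" and C: "C \<in> carrier_mat n m"
  shows "op_norm (A - C) \<le> op_norm (A - B) + op_norm (B - C)"
proof -
  have "A - C = (A - B) + (B - C)" using A B C by (intro eq_matI) auto
  then show ?thesis using op_norm_triangle[of "A - B" n m "B - C"] A B C by (simp add: minus_carrier_mat)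
qed

lemma op_norm_diff_le:
  assumes A: "A \<in> carrier_mat n m" and B: "B \<in> carrier_mat n m"
  shows "\<bar>op_norm A - op_norm B\<bar> \<le> op_norm (A - B)"
proof -
  have "A - 0\<^sub>m n m = A" "B - 0\<^sub>m n m = B" using A B by (auto intro!: eq_matI)
  then show ?thesis
    using op_norm_triangle_minus[OF A B, of "0\<^sub>m n m"] op_norm_triangle_minus[OF B A, of "0\<^sub>m n m"]
      op_norm_minus_commute[OF A B] by auto
qed

lemma op_norm_mult:
  assumes A: "A \<in> carrier_mat n m" and B: "B \<in> carrier_mat m k"
  shows "op_norm (A * B) \<le> op_norm A * op_norm B"
proof (rule op_norm_leI[where n = n and m = k])
  fix v :: "complex vec" assume v: "v \<in> carrier_vec k"
  have "vec_norm ((A * B) *\<^sub>v v) = vec_norm (A *\<^sub>v (B *\<^sub>v v))"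
    using A B v by (simp add: assoc_mult_mat_vec)
  also have "\<dots> \<le> op_norm A * vec_norm (B *\<^sub>v v)"
    using A B v by (intro vec_norm_le_op_norm) auto
  also have "\<dots> \<le> op_norm A * (op_norm B * vec_norm v)"
    using B v by (intro mult_left_mono vec_norm_le_op_norm) auto
  finally show "vec_norm ((A * B) *\<^sub>v v) \<le> op_norm A * op_norm B * vec_norm v"
    by (simp add: mult.assoc)
qed (use A B in auto)

lemma op_norm_one [simp]: "0 < n \<Longrightarrow> op_norm (1\<^sub>m n) = 1"
proof (rule antisym)
  show "op_norm (1\<^sub>m n) \<le> 1" by (rule op_norm_leI[where n = n and m = n]) auto
  assume "0 < n"
  then show "1 \<le> op_norm (1\<^sub>m n)"
    using vec_norm_le_op_norm[of "1\<^sub>m n" n n "unit_vec n 0"] by simp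
qed

lemma index_le_op_norm:
  assumes A: "A \<in> carrier_mat n m" and "i < n" "j < m"
  shows "cmod (A $$ (i, j)) \<le> op_norm A"
proof -
  have "cmod (A $$ (i, j)) = cmod ((A *\<^sub>v unit_vec m j) $ i)" using assms by auto
  also have "\<dots> \<le> vec_norm (A *\<^sub>v unit_vec m j)" using assms by (intro norm_index_le_vec_norm) auto
  also have "\<dots> \<le> op_norm A" using vec_norm_le_op_norm[OF A, of "unit_vec m j"] assms by simp
  finally show ?thesis .
qed

lemma cscalar_adjoint:
  fixes A :: "complex mat"
  assumes A: "A \<in> carrier_mat n m" and v: "v \<in> carrier_vec m" and w: "w \<in> carrier_vec n"
  shows "(A *\<^sub>v v) \<bullet>c w = v \<bullet>c (mat_adjoint A *\<^sub>v w)"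
proof -
  have "(A *\<^sub>v v) \<bullet>c w = (\<Sum>i<n. \<Sum>j<m. A $$ (i, j) * v $ j * cnj (w $ i))"
    using A v w by (auto simp: scalar_prod_def atLeast0LessThan sum_distrib_right)
  also have "\<dots> = (\<Sum>j<m. \<Sum>i<n. A $$ (i, j) * v $ j * cnj (w $ i))" by (rule sum.swap)
  also have "\<dots> = v \<bullet>c (mat_adjoint A *\<^sub>v w)"
    using A v w by (auto simp: scalar_prod_def atLeast0LessThan sum_distrib_left mult_ac intro!: sum.cong)
  finally show ?thesis .
qed

lemma op_norm_sq_le:
  assumes A: "A \<in> carrier_mat n m"
  shows "(op_norm A)\<^sup>2 \<le> op_norm (mat_adjoint A * A)"
proof -
  let ?B = "mat_adjoint A * A"
  have B: "?B \<in> carrier_mat m m" using A by auto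
  have "op_norm A \<le> sqrt (op_norm ?B)"
  proof (rule op_norm_leI[OF A])
    fix v :: "complex vec" assume v: "v \<in> carrier_vec m"
    have "(vec_norm (A *\<^sub>v v))\<^sup>2 = cmod ((A *\<^sub>v v) \<bullet>c (A *\<^sub>v v))"
      unfolding vec_norm_cscalar[symmetric] by (simp add: norm_power)
    also have "(A *\<^sub>v v) \<bullet>c (A *\<^sub>v v) = v \<bullet>c (?B *\<^sub>v v)"
      using A v by (simp add: cscalar_adjoint[OF A v] assoc_mult_mat_vec[OF mat_adjoint_carrier[OF A] A v])
    also have "cmod \<dots> \<le> vec_norm v * vec_norm (?B *\<^sub>v v)"
      using B v by (intro cscalar_le_vec_norm[where n = m]) auto
    also have "\<dots> \<le> vec_norm v * (op_norm ?B * vec_norm v)"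
      using B v by (intro mult_left_mono vec_norm_le_op_norm) auto
    also have "\<dots> = (sqrt (op_norm ?B) * vec_norm v)\<^sup>2"
      by (simp add: power_mult_distrib power2_eq_square)
    finally show "vec_norm (A *\<^sub>v v) \<le> sqrt (op_norm ?B) * vec_norm v"
      by (rule power2_le_imp_le) simp
  qed simp
  then have "(op_norm A)\<^sup>2 \<le> (sqrt (op_norm ?B))\<^sup>2" by (intro power_mono) auto
  then show ?thesis by simp
qed

lemma op_norm_adjoint_le:
  assumes A: "A \<in> carrier_mat n m"
  shows "op_norm A \<le> op_norm (mat_adjoint A)"
proof (cases "op_norm A = 0")
  case False
  then have pos: "0 < op_norm A" using op_norm_nonneg[of A] by linarith
  have "op_norm A * op_norm A \<le> op_norm (mat_adjoint A) * op_norm A"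
    using op_norm_sq_le[OF A] op_norm_mult[OF mat_adjoint_carrier[OF A] A]
    by (simp add: power2_eq_square)
  then show ?thesis using pos by simp
qed simp

lemma op_norm_adjoint [simp]: "op_norm (mat_adjoint A) = op_norm A"
proof (rule antisym)
  have A: "A \<in> carrier_mat (dim_row A) (dim_col A)" by auto
  show "op_norm A \<le> op_norm (mat_adjoint A)" by (rule op_norm_adjoint_le[OF A])
  show "op_norm (mat_adjoint A) \<le> op_norm A"
    using op_norm_adjoint_le[OF mat_adjoint_carrier[OF A]] by simp
qed

lemma op_norm_cstar: "op_norm (mat_adjoint A * A) = (op_norm A)\<^sup>2"
proof (rule antisym)
  have A: "A \<in> carrier_mat (dim_row A) (dim_col A)" by auto
  show "op_norm (mat_adjoint A * A) \<le> (op_norm A)\<^sup>2"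
    using op_norm_mult[OF mat_adjoint_carrier[OF A] A] by (simp add: power2_eq_square)
  show "(op_norm A)\<^sup>2 \<le> op_norm (mat_adjoint A * A)" by (rule op_norm_sq_le[OF A])
qed

lemma op_norm_kron_one_le:
  assumes A: "A \<in> carrier_mat n m"
  shows "op_norm (A \<otimes>\<^sub>k 1\<^sub>m r) \<le> op_norm A"
proof (rule op_norm_leI)
  show "A \<otimes>\<^sub>k 1\<^sub>m r \<in> carrier_mat (n * r) (m * r)" using A by auto
  fix v :: "complex vec" assume v: "v \<in> carrier_vec (m * r)"
  define w where "w q = vec m (\<lambda>i. v $ (i * r + q))" for q
  have w: "w q \<in> carrier_vec m" for q by (simp add: w_def)
  have lt: "i * r + q < k * r" if "i < k" "q < r" for i q k :: nat
  proof -
    have "i * r + q < Suc i * r" using that by simp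
    also have "\<dots> \<le> k * r" using that by (intro mult_right_mono) auto
    finally show ?thesis .
  qed
  have comp: "((A \<otimes>\<^sub>k 1\<^sub>m r) *\<^sub>v v) $ (i * r + q) = (A *\<^sub>v w q) $ i" if "i < n" "q < r" for i q
  proof -
    have iq: "i * r + q < n * r" using lt that by simp
    have "((A \<otimes>\<^sub>k 1\<^sub>m r) *\<^sub>v v) $ (i * r + q) = (\<Sum>k<m * r. (A \<otimes>\<^sub>k 1\<^sub>m r) $$ (i * r + q, k) * v $ k)"
      using iq A v by (auto simp: scalar_prod_def atLeast0LessThan)
    also have "\<dots> = (\<Sum>k<m * r. (\<lambda>j p. A $$ (i, j) * (if q = p then 1 else 0) * v $ (j * r + p)) (k div r) (k mod r))"
      using iq A v that div_mod_less_mult[of _ m r] by (intro sum.cong) auto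
    also have "\<dots> = (\<Sum>j<m. \<Sum>p<r. A $$ (i, j) * (if q = p then 1 else 0) * v $ (j * r + p))"
      by (rule sum_div_mod)
    also have "\<dots> = (\<Sum>j<m. A $$ (i, j) * v $ (j * r + q))"
    proof (rule sum.cong[OF refl])
      fix j
      have "(\<Sum>p<r. A $$ (i, j) * (if q = p then 1 else 0) * v $ (j * r + p))
        = (\<Sum>p<r. if p = q then A $$ (i, j) * v $ (j * r + p) else 0)"
        by (rule sum.cong) auto
      also have "\<dots> = A $$ (i, j) * v $ (j * r + q)" using that by simp
      finally show "(\<Sum>p<r. A $$ (i, j) * (if q = p then 1 else 0) * v $ (j * r + p)) = A $$ (i, j) * v $ (j * r + q)" .
    qed
    also have "\<dots> = (A *\<^sub>v w q) $ i"
      using A that by (auto simp: scalar_prod_def atLeast0LessThan w_def)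
    finally show ?thesis .
  qed
  have split: "(vec_norm u)\<^sup>2 = (\<Sum>q<r. \<Sum>i<k. (cmod (u $ (i * r + q)))\<^sup>2)" if "u \<in> carrier_vec (k * r)" for u k
  proof -
    have "(vec_norm u)\<^sup>2 = (\<Sum>l<k * r. (\<lambda>i q. (cmod (u $ (i * r + q)))\<^sup>2) (l div r) (l mod r))"
      unfolding vec_norm_power2 using that by (auto intro!: sum.cong)
    also have "\<dots> = (\<Sum>i<k. \<Sum>q<r. (cmod (u $ (i * r + q)))\<^sup>2)" by (rule sum_div_mod)
    also have "\<dots> = (\<Sum>q<r. \<Sum>i<k. (cmod (u $ (i * r + q)))\<^sup>2)" by (rule sum.swap)
    finally show ?thesis .
  qed
  have "(vec_norm ((A \<otimes>\<^sub>k 1\<^sub>m r) *\<^sub>v v))\<^sup>2 = (\<Sum>q<r. \<Sum>i<n. (cmod (((A \<otimes>\<^sub>k 1\<^sub>m r) *\<^sub>v v) $ (i * r + q)))\<^sup>2)"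
    using A by (intro split carrier_vecI) auto
  also have "\<dots> = (\<Sum>q<r. (vec_norm (A *\<^sub>v w q))\<^sup>2)"
    using A comp by (auto simp: vec_norm_power2 intro!: sum.cong)
  also have "\<dots> \<le> (\<Sum>q<r. (op_norm A * vec_norm (w q))\<^sup>2)"
    using vec_norm_le_op_norm[OF A w] by (intro sum_mono power_mono) auto
  also have "\<dots> = (op_norm A)\<^sup>2 * (\<Sum>q<r. (vec_norm (w q))\<^sup>2)"
    by (simp add: power_mult_distrib sum_distrib_left)
  also have "(\<Sum>q<r. (vec_norm (w q))\<^sup>2) = (vec_norm v)\<^sup>2"
    unfolding split[OF v] by (auto simp: vec_norm_power2 w_def intro!: sum.cong)
  finally have "(vec_norm ((A \<otimes>\<^sub>k 1\<^sub>m r) *\<^sub>v v))\<^sup>2 \<le> (op_norm A * vec_norm v)\<^sup>2"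
    by (simp add: power_mult_distrib)
  then show "vec_norm ((A \<otimes>\<^sub>k 1\<^sub>m r) *\<^sub>v v) \<le> op_norm A * vec_norm v"
    by (rule power2_le_imp_le) simp
qed simp

lemma op_norm_submat_le:
  assumes X: "X \<in> carrier_mat N M" and f: "\<And>i. i < n \<Longrightarrow> f i < N" "inj_on f {..<n}"
    and g: "\<And>j. j < m \<Longrightarrow> g j < M" "inj_on g {..<m}"
  shows "op_norm (mat n m (\<lambda>(i, j). X $$ (f i, g j))) \<le> op_norm X"
proof (rule op_norm_leI)
  fix v :: "complex vec" assume v: "v \<in> carrier_vec m"
  define w where "w = vec M (\<lambda>k. \<Sum>j<m. if k = g j then v $ j else 0)"
  have w: "w \<in> carrier_vec M" by (simp add: w_def)
  have wg: "w $ g j = v $ j" if "j < m" for j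
  proof -
    have "w $ g j = (\<Sum>l<m. if g j = g l then v $ l else 0)"
      using that g by (simp add: w_def)
    also have "\<dots> = (\<Sum>l<m. if l = j then v $ l else 0)"
      using that g by (intro sum.cong) (auto dest: inj_onD)
    finally show ?thesis using that by simp
  qed
  have w0: "w $ k = 0" if "k < M" "k \<notin> g ` {..<m}" for k
    using that by (auto simp: w_def intro!: sum.neutral)
  have sumg: "(\<Sum>k<M. h k) = (\<Sum>j<m. h (g j))" if "\<And>k. k < M \<Longrightarrow> k \<notin> g ` {..<m} \<Longrightarrow> h k = 0"
    for h :: "nat \<Rightarrow> 'b::comm_monoid_add"
  proof -
    have "(\<Sum>j<m. h (g j)) = sum h (g ` {..<m})" using g(2) by (simp add: sum.reindex)
    also have "\<dots> = sum h {..<M}" using g(1) that by (intro sum.mono_neutral_left) auto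
    finally show ?thesis by simp
  qed
  have "(vec_norm w)\<^sup>2 = (vec_norm v)\<^sup>2"
    unfolding vec_norm_power2 using v w wg by (simp, subst sumg) (auto simp: w0)
  then have nw: "vec_norm w = vec_norm v" by (simp add: power2_eq_iff_nonneg)
  let ?Y = "mat n m (\<lambda>(i, j). X $$ (f i, g j))"
  have Y: "(?Y *\<^sub>v v) $ i = (X *\<^sub>v w) $ f i" if "i < n" for i
  proof -
    have "(X *\<^sub>v w) $ f i = (\<Sum>k<M. X $$ (f i, k) * w $ k)"
      using X w f that by (auto simp: scalar_prod_def atLeast0LessThan)
    also have "\<dots> = (\<Sum>j<m. X $$ (f i, g j) * w $ g j)" by (subst sumg) (auto simp: w0)
    also have "\<dots> = (?Y *\<^sub>v v) $ i" using v wg that by (auto simp: scalar_prod_def atLeast0LessThan)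
    finally show ?thesis by simp
  qed
  have "(vec_norm (?Y *\<^sub>v v))\<^sup>2 = (\<Sum>i<n. (cmod ((X *\<^sub>v w) $ f i))\<^sup>2)"
    unfolding vec_norm_power2 by (rule sum.cong) (auto simp: Y simp del: index_mult_mat_vec)
  also have "\<dots> = (\<Sum>k\<in>f ` {..<n}. (cmod ((X *\<^sub>v w) $ k))\<^sup>2)" using f(2) by (simp add: sum.reindex)
  also have "\<dots> \<le> (vec_norm (X *\<^sub>v w))\<^sup>2"
    unfolding vec_norm_power2 using X f(1) by (intro sum_mono2) auto
  finally have "vec_norm (?Y *\<^sub>v v) \<le> vec_norm (X *\<^sub>v w)" by (rule power2_le_imp_le) simp
  also have "\<dots> \<le> op_norm X * vec_norm v" using vec_norm_le_op_norm[OF X w] nw by simp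
  finally show "vec_norm (?Y *\<^sub>v v) \<le> op_norm X * vec_norm v" .
qed auto

lemma op_norm_kron_one:
  assumes r: "0 < r"
  shows "op_norm (A \<otimes>\<^sub>k 1\<^sub>m r) = op_norm A"
proof (rule antisym)
  have A: "A \<in> carrier_mat (dim_row A) (dim_col A)" by auto
  show "op_norm (A \<otimes>\<^sub>k 1\<^sub>m r) \<le> op_norm A" by (rule op_norm_kron_one_le[OF A])
  have "A = mat (dim_row A) (dim_col A) (\<lambda>(i, j). (A \<otimes>\<^sub>k 1\<^sub>m r) $$ (i * r, j * r))"
    using r by (intro eq_matI) auto
  also have "op_norm \<dots> \<le> op_norm (A \<otimes>\<^sub>k 1\<^sub>m r)"
    using r by (intro op_norm_submat_le[where N = "dim_row A * r" and M = "dim_col A * r"])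
      (auto simp: inj_on_def)
  finally show "op_norm A \<le> op_norm (A \<otimes>\<^sub>k 1\<^sub>m r)" .
qed

subsection \<open>Slicing off the last tensor factor\<close>

text \<open>The map \<open>id \<otimes> \<phi>\<close>, for a functional \<open>\<phi>\<close> on the 3 by 3 matrices acting on the last
  tensor factor: \<open>\<phi>\<close> is applied to each 3 by 3 block (see \<open>slice_last_kron\<close>).\<close>

definition slice_last :: "(complex mat \<Rightarrow> complex) \<Rightarrow> complex mat \<Rightarrow> complex mat" where
  "slice_last \<phi> A = mat (dim_row A div 3) (dim_col A div 3)
     (\<lambda>(i, j). \<phi> (mat 3 3 (\<lambda>(p, q). A $$ (3 * i + p, 3 * j + q))))"

text \<open>Matrix positions are counted from 0, so position (1, 1) is the mathematical index (2, 2).\<close>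

definition e22_state :: "complex mat \<Rightarrow> complex" where
  "e22_state M = M $$ (1, 1)"

lemma slice_last_e22:
  "slice_last e22_state A = mat (dim_row A div 3) (dim_col A div 3) (\<lambda>(i, j). A $$ (3 * i + 1, 3 * j + 1))"
  by (simp add: slice_last_def e22_state_def)

lemma dim_slice_last [simp]:
  "dim_row (slice_last \<phi> A) = dim_row A div 3" "dim_col (slice_last \<phi> A) = dim_col A div 3"
  by (simp_all add: slice_last_def)

lemma slice_last_carrier [intro]:
  "A \<in> carrier_mat (3 ^ Suc n) (3 ^ Suc m) \<Longrightarrow> slice_last \<phi> A \<in> carrier_mat (3 ^ n) (3 ^ m)"
  by (auto intro!: carrier_matI)

lemma slice_last_kron:
  assumes B: "B \<in> carrier_mat 3 3" and \<phi>: "\<And>c M. M \<in> carrier_mat 3 3 \<Longrightarrow> \<phi> (c \<cdot>\<^sub>m M) = c * \<phi> M"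
  shows "slice_last \<phi> (A \<otimes>\<^sub>k B) = \<phi> B \<cdot>\<^sub>m A"
proof (rule eq_matI, goal_cases)
  case (1 i j)
  then have ij: "i < dim_row A" "j < dim_col A" by auto
  have "mat 3 3 (\<lambda>(p, q). (A \<otimes>\<^sub>k B) $$ (3 * i + p, 3 * j + q)) = A $$ (i, j) \<cdot>\<^sub>m B"
    using B ij by (intro eq_matI) auto
  then show ?case using ij B by (simp add: slice_last_def \<phi> mult.commute)
qed (use B in auto)

lemma slice_last_e22_kron:
  "B \<in> carrier_mat 3 3 \<Longrightarrow> slice_last e22_state (A \<otimes>\<^sub>k B) = e22_state B \<cdot>\<^sub>m A"
  by (rule slice_last_kron) (auto simp: e22_state_def)

lemma slice_last_e22_minus:
  assumes "A \<in> carrier_mat (3 ^ Suc n) (3 ^ Suc n)" "B \<in> carrier_mat (3 ^ Suc n) (3 ^ Suc n)"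
  shows "slice_last e22_state (A - B) = slice_last e22_state A - slice_last e22_state B"
  using assms unfolding slice_last_e22 by (intro eq_matI) auto

lemma slice_last_e22_add:
  assumes "A \<in> carrier_mat (3 ^ Suc n) (3 ^ Suc n)" "B \<in> carrier_mat (3 ^ Suc n) (3 ^ Suc n)"
  shows "slice_last e22_state (A + B) = slice_last e22_state A + slice_last e22_state B"
  using assms unfolding slice_last_e22 by (intro eq_matI) auto

lemma slice_last_e22_smult:
  assumes "A \<in> carrier_mat (3 ^ Suc n) (3 ^ Suc n)"
  shows "slice_last e22_state (c \<cdot>\<^sub>m A) = c \<cdot>\<^sub>m slice_last e22_state A"
  using assms unfolding slice_last_e22 by (intro eq_matI) auto

lemma op_norm_slice_last_e22:
  assumes "A \<in> carrier_mat (3 ^ Suc n) (3 ^ Suc n)"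
  shows "op_norm (slice_last e22_state A) \<le> op_norm A"
  using assms unfolding slice_last_e22
  by (intro op_norm_submat_le[where N = "3 ^ Suc n" and M = "3 ^ Suc n"]) (auto simp: inj_on_def)

abbreviation slices :: "nat \<Rightarrow> complex mat \<Rightarrow> complex mat" where
  "slices k \<equiv> slice_last e22_state ^^ k"

lemma slices_carrier [intro]:
  "A \<in> carrier_mat (3 ^ (n + k)) (3 ^ (n + k)) \<Longrightarrow> slices k A \<in> carrier_mat (3 ^ n) (3 ^ n)"
proof (induction k arbitrary: A)
  case (Suc k)
  then have "slice_last e22_state A \<in> carrier_mat (3 ^ (n + k)) (3 ^ (n + k))" by auto
  then show ?case by (simp only: funpow_Suc_right o_def) (rule Suc.IH)
qed simp

lemma slices_minus:
  assumes "A \<in> carrier_mat (3 ^ (n + k)) (3 ^ (n + k))" "B \<in> carrier_mat (3 ^ (n + k)) (3 ^ (n + k))"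
  shows "slices k (A - B) = slices k A - slices k B"
  using assms
proof (induction k arbitrary: A B)
  case (Suc k)
  then have "slice_last e22_state (A - B) = slice_last e22_state A - slice_last e22_state B"
    by (intro slice_last_e22_minus[where n = "n + k"]) auto
  moreover have "slice_last e22_state A \<in> carrier_mat (3 ^ (n + k)) (3 ^ (n + k))"
    "slice_last e22_state B \<in> carrier_mat (3 ^ (n + k)) (3 ^ (n + k))" using Suc.prems by auto
  ultimately show ?case using Suc.IH by (simp only: funpow_Suc_right o_def)
qed simp

lemma slices_add:
  assumes "A \<in> carrier_mat (3 ^ (n + k)) (3 ^ (n + k))" "B \<in> carrier_mat (3 ^ (n + k)) (3 ^ (n + k))"
  shows "slices k (A + B) = slices k A + slices k B"
  using assms
proof (induction k arbitrary: A B)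
  case (Suc k)
  then have "slice_last e22_state (A + B) = slice_last e22_state A + slice_last e22_state B"
    by (intro slice_last_e22_add[where n = "n + k"]) auto
  moreover have "slice_last e22_state A \<in> carrier_mat (3 ^ (n + k)) (3 ^ (n + k))"
    "slice_last e22_state B \<in> carrier_mat (3 ^ (n + k)) (3 ^ (n + k))" using Suc.prems by auto
  ultimately show ?case using Suc.IH by (simp only: funpow_Suc_right o_def)
qed simp

lemma slices_smult:
  assumes "A \<in> carrier_mat (3 ^ (n + k)) (3 ^ (n + k))"
  shows "slices k (c \<cdot>\<^sub>m A) = c \<cdot>\<^sub>m slices k A"
  using assms
proof (induction k arbitrary: A)
  case (Suc k)
  then have "slice_last e22_state (c \<cdot>\<^sub>m A) = c \<cdot>\<^sub>m slice_last e22_state A"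
    by (intro slice_last_e22_smult[where n = "n + k"]) auto
  moreover have "slice_last e22_state A \<in> carrier_mat (3 ^ (n + k)) (3 ^ (n + k))"
    using Suc.prems by auto
  ultimately show ?case using Suc.IH by (simp only: funpow_Suc_right o_def)
qed simp

lemma op_norm_slices:
  assumes "A \<in> carrier_mat (3 ^ (n + k)) (3 ^ (n + k))"
  shows "op_norm (slices k A) \<le> op_norm A"
  using assms
proof (induction k arbitrary: A)
  case (Suc k)
  have "op_norm (slices k (slice_last e22_state A)) \<le> op_norm (slice_last e22_state A)"
    using Suc.prems by (intro Suc.IH) auto
  also have "\<dots> \<le> op_norm A"
    using Suc.prems by (intro op_norm_slice_last_e22[where n = "n + k"]) auto
  finally show ?case by (simp only: funpow_Suc_right o_def)
qed simp

lemma slices_kron_one: "slices k (A \<otimes>\<^sub>k 1\<^sub>m (3 ^ k)) = A"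
proof (induction k)
  case (Suc k)
  have "A \<otimes>\<^sub>k 1\<^sub>m (3 ^ Suc k) = A \<otimes>\<^sub>k 1\<^sub>m (3 ^ k) \<otimes>\<^sub>k 1\<^sub>m 3"
    by (simp add: kron_assoc mult.commute)
  then have "slice_last e22_state (A \<otimes>\<^sub>k 1\<^sub>m (3 ^ Suc k)) = A \<otimes>\<^sub>k 1\<^sub>m (3 ^ k)"
    by (simp add: slice_last_e22_kron) (auto simp: e22_state_def intro!: eq_matI)
  then show ?case using Suc.IH by (simp only: funpow_Suc_right o_def)
qed simp

subsection \<open>Unital C*-algebras\<close>

class cstar_algebra_1 = real_normed_algebra_1 + banach +
  fixes scaleC :: "complex \<Rightarrow> 'a \<Rightarrow> 'a"  (infixr \<open>*\<^sub>C\<close> 75)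
    and star :: "'a \<Rightarrow> 'a"
  assumes scaleC_add_right: "a *\<^sub>C (x + y) = a *\<^sub>C x + a *\<^sub>C y"
    and scaleC_add_left: "(a + b) *\<^sub>C x = a *\<^sub>C x + b *\<^sub>C x"
    and scaleC_scaleC: "a *\<^sub>C b *\<^sub>C x = (a * b) *\<^sub>C x"
    and scaleR_scaleC: "scaleR r x = complex_of_real r *\<^sub>C x"
    and mult_scaleC_left: "(a *\<^sub>C x) * y = a *\<^sub>C (x * y)"
    and mult_scaleC_right: "x * (a *\<^sub>C y) = a *\<^sub>C (x * y)"
    and norm_scaleC: "norm (a *\<^sub>C x) = cmod a * norm x"
    and star_star: "star (star x) = x"
    and star_add: "star (x + y) = star x + star y"
    and star_scaleC: "star (a *\<^sub>C x) = cnj a *\<^sub>C star x"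
    and star_mult: "star (x * y) = star y * star x"
    and norm_star_mult: "norm (star x * x) = (norm x)\<^sup>2"

subsection \<open>The UHF algebra of type 3 to the infinity\<close>

text \<open>\<open>M3 n\<close> is the n-fold tensor power of the algebra of 3 by 3 matrices, and \<open>amp k\<close> the connecting map
  to the (n + k)-fold power. The C*-inductive limit is the completion of the algebraic inductive
  limit. Its elements are represented by sequences with n-th term in \<open>M3 n\<close> that are Cauchy
  along the connecting maps, modulo sequences whose operator norms tend to 0. Operations act termwise
  and the norm is the limit of the operator norms.\<close>

abbreviation M3 :: "nat \<Rightarrow> complex mat set" where
  "M3 n \<equiv> carrier_mat (3 ^ n) (3 ^ n)"

abbreviation amp :: "nat \<Rightarrow> complex mat \<Rightarrow> complex mat" where
  "amp k A \<equiv> A \<otimes>\<^sub>k 1\<^sub>m (3 ^ k)"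

lemma amp_M3 [intro]: "A \<in> M3 n \<Longrightarrow> amp k A \<in> M3 (n + k)"
  by (auto simp: power_add)

lemma amp_amp: "amp l (amp k A) = amp (k + l) A"
  by (simp add: kron_assoc power_add)

lemma amp_mult:
  assumes "A \<in> M3 n" "B \<in> M3 n"
  shows "amp k (A * B) = amp k A * amp k B"
  using kron_mult[OF assms(1) one_carrier_mat assms(2) one_carrier_mat, of "3 ^ k"] by simp

lemma M3_minus [intro]: "A \<in> M3 n \<Longrightarrow> B \<in> M3 n \<Longrightarrow> A - B \<in> M3 n"
  by (rule minus_carrier_mat)

lemma op_norm_minus_self [simp]: "op_norm (A - A) = 0"
proof -
  have *: "A - A = 0\<^sub>m (dim_row A) (dim_col A)" by (intro eq_matI) auto
  show ?thesis unfolding * by simp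
qed

lemma op_norm_amp [simp]: "op_norm (amp k A) = op_norm A"
  by (rule op_norm_kron_one) simp

lemma op_norm_mult_diff:
  assumes "A \<in> carrier_mat n n" "B \<in> carrier_mat n n" "C \<in> carrier_mat n n" "D \<in> carrier_mat n n"
  shows "op_norm (A * B - C * D) \<le> op_norm (A - C) * op_norm B + op_norm C * op_norm (B - D)"
proof -
  note m = minus_carrier_mat
  have "A * B - C * D = (A - C) * B + C * (B - D)"
    using assms by (simp add: minus_mult_distrib_mat[of _ n n] mult_minus_distrib_mat[of _ n n])
      (intro eq_matI, auto)
  also have "op_norm \<dots> \<le> op_norm ((A - C) * B) + op_norm (C * (B - D))"
    using assms m by (intro op_norm_triangle[where n = n and m = n]) auto
  also have "\<dots> \<le> op_norm (A - C) * op_norm B + op_norm C * op_norm (B - D)"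
    using assms m by (intro add_mono op_norm_mult) auto
  finally show ?thesis .
qed

definition uhf_cauchy :: "(nat \<Rightarrow> complex mat) \<Rightarrow> bool" where
  "uhf_cauchy x \<longleftrightarrow> (\<forall>n. x n \<in> M3 n) \<and>
     (\<forall>e>0. \<exists>N. \<forall>n\<ge>N. \<forall>k. op_norm (x (n + k) - amp k (x n)) < e)"

definition uhf_rel :: "(nat \<Rightarrow> complex mat) \<Rightarrow> (nat \<Rightarrow> complex mat) \<Rightarrow> bool" where
  "uhf_rel x y \<longleftrightarrow> uhf_cauchy x \<and> uhf_cauchy y \<and> (\<lambda>n. op_norm (x n - y n)) \<longlonglongrightarrow> 0"

lemma uhf_cauchy_M3: "uhf_cauchy x \<Longrightarrow> x n \<in> M3 n"
  by (simp add: uhf_cauchy_def)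

lemma uhf_cauchyD: "uhf_cauchy x \<Longrightarrow> 0 < e \<Longrightarrow> \<exists>N. \<forall>n\<ge>N. \<forall>k. op_norm (x (n + k) - amp k (x n)) < e"
  by (simp add: uhf_cauchy_def)

lemma uhf_cauchy_dominated:
  assumes x: "uhf_cauchy x" and y: "uhf_cauchy y" and z: "\<And>n. z n \<in> M3 n" and C: "0 \<le> C"
    and le: "\<And>n k. op_norm (z (n + k) - amp k (z n)) \<le>
      C * (op_norm (x (n + k) - amp k (x n)) + op_norm (y (n + k) - amp k (y n)))"
  shows "uhf_cauchy z"
  unfolding uhf_cauchy_def
proof (intro conjI allI impI)
  fix e :: real assume e: "0 < e"
  define d where "d = e / (2 * (C + 1))"
  have d: "0 < d" using e C by (simp add: d_def)
  obtain N1 where N1: "\<And>n k. n \<ge> N1 \<Longrightarrow> op_norm (x (n + k) - amp k (x n)) < d"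
    using uhf_cauchyD[OF x d] by blast
  obtain N2 where N2: "\<And>n k. n \<ge> N2 \<Longrightarrow> op_norm (y (n + k) - amp k (y n)) < d"
    using uhf_cauchyD[OF y d] by blast
  have "op_norm (z (n + k) - amp k (z n)) < e" if "n \<ge> max N1 N2" for n k
  proof -
    have "op_norm (z (n + k) - amp k (z n)) \<le> C * (d + d)"
      using N1[of n k] N2[of n k] that C by (intro order.trans[OF le] mult_left_mono) auto
    also have "\<dots> < (C + 1) * (d + d)" using d by (intro mult_strict_right_mono) auto
    also have "\<dots> = e"
    proof -
      have "C + 1 \<noteq> 0" using C by simp
      then show ?thesis unfolding d_def by (simp add: divide_simps) (simp add: algebra_simps)?
    qed
    finally show ?thesis .
  qed
  then show "\<exists>N. \<forall>n\<ge>N. \<forall>k. op_norm (z (n + k) - amp k (z n)) < e" by blast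
qed (rule z)

lemma uhf_rel_dominated:
  assumes x: "uhf_rel x x'" and y: "uhf_rel y y'" and z: "uhf_cauchy z" "uhf_cauchy z'"
    and le: "\<And>n. op_norm (z n - z' n) \<le> C * (op_norm (x n - x' n) + op_norm (y n - y' n))"
  shows "uhf_rel z z'"
  unfolding uhf_rel_def
proof (intro conjI z)
  have "(\<lambda>n. C * (op_norm (x n - x' n) + op_norm (y n - y' n))) \<longlonglongrightarrow> C * (0 + 0)"
    using x y unfolding uhf_rel_def by (intro tendsto_intros) blast+
  then have lim: "(\<lambda>n. C * (op_norm (x n - x' n) + op_norm (y n - y' n))) \<longlonglongrightarrow> 0" by simp
  show "(\<lambda>n. op_norm (z n - z' n)) \<longlonglongrightarrow> 0"
    by (rule tendsto_0_le[OF lim, where K = 1]) (auto intro!: always_eventually order.trans[OF le])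
qed

lemma uhf_rel_refl: "uhf_cauchy x \<Longrightarrow> uhf_rel x x"
  by (simp add: uhf_rel_def)

lemma uhf_rel_refl_iff: "uhf_rel x x \<longleftrightarrow> uhf_cauchy x"
  by (auto simp: uhf_rel_def)

lemma uhf_rel_eqI: "uhf_cauchy x \<Longrightarrow> (\<And>n. x n = y n) \<Longrightarrow> uhf_rel x y"
  by (metis ext uhf_rel_refl)

lemma part_equivp_uhf_rel: "part_equivp uhf_rel"
proof (rule part_equivpI)
  have "uhf_cauchy (\<lambda>n. 0\<^sub>m (3 ^ n) (3 ^ n))"
    by (auto simp: uhf_cauchy_def power_add)
  then show "\<exists>x. uhf_rel x x" by (auto simp: uhf_rel_refl_iff)
  show "symp uhf_rel"
  proof (rule sympI)
    fix x y assume xy: "uhf_rel x y"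
    then have "op_norm (x n - y n) = op_norm (y n - x n)" for n
      unfolding uhf_rel_def by (intro op_norm_minus_commute[where n = "3 ^ n" and m = "3 ^ n"] uhf_cauchy_M3) auto
    then show "uhf_rel y x" using xy by (simp add: uhf_rel_def)
  qed
  show "transp uhf_rel"
  proof (rule transpI)
    fix x y z assume xy: "uhf_rel x y" and yz: "uhf_rel y z"
    then show "uhf_rel x z"
    proof (rule uhf_rel_dominated[where C = 1])
      show "op_norm (x n - z n) \<le> 1 * (op_norm (x n - y n) + op_norm (y n - z n))" for n
        using xy yz unfolding uhf_rel_def
        by (simp, intro op_norm_triangle_minus[where n = "3 ^ n" and m = "3 ^ n"] uhf_cauchy_M3) auto
    qed (use xy yz in \<open>auto simp: uhf_rel_def\<close>)
  qed
qed

lemma uhf_cauchy_convergent: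
  assumes x: "uhf_cauchy x"
  shows "convergent (\<lambda>n. op_norm (x n))"
proof -
  have "Cauchy (\<lambda>n. op_norm (x n))"
  proof (rule metric_CauchyI)
    fix e :: real assume "0 < e"
    then obtain N where N: "\<And>n k. n \<ge> N \<Longrightarrow> op_norm (x (n + k) - amp k (x n)) < e / 2"
      using uhf_cauchyD[OF x, of "e / 2"] by auto
    have *: "\<bar>op_norm (x n) - op_norm (x N)\<bar> < e / 2" if "n \<ge> N" for n
    proof -
      define k where "k = n - N"
      have n: "n = N + k" using \<open>n \<ge> N\<close> by (simp add: k_def)
      have "\<bar>op_norm (x (N + k)) - op_norm (amp k (x N))\<bar> \<le> op_norm (x (N + k) - amp k (x N))"
        using x by (intro op_norm_diff_le[where n = "3 ^ (N + k)" and m = "3 ^ (N + k)"] amp_M3 uhf_cauchy_M3)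
      then show ?thesis using N[of N k] n by simp
    qed
    show "\<exists>M. \<forall>m\<ge>M. \<forall>n\<ge>M. dist (op_norm (x m)) (op_norm (x n)) < e"
    proof (intro exI allI impI)
      fix m n assume "N \<le> m" "N \<le> n"
      then show "dist (op_norm (x m)) (op_norm (x n)) < e"
        using *[of m] *[of n] unfolding dist_real_def by linarith
    qed
  qed
  then show ?thesis by (rule Cauchy_convergent)
qed

lemma uhf_cauchy_bounded:
  assumes x: "uhf_cauchy x"
  obtains C where "0 \<le> C" "\<And>n. op_norm (x n) \<le> C"
proof -
  obtain K where "0 < K" "\<And>n. norm (op_norm (x n)) \<le> K"
    using convergent_imp_Bseq[OF uhf_cauchy_convergent[OF x]] unfolding Bseq_def by blast
  then show thesis by (intro that[of K]) auto
qed

lemma op_norm_add_diff: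
  assumes "A \<in> carrier_mat n n" "B \<in> carrier_mat n n" "C \<in> carrier_mat n n" "D \<in> carrier_mat n n"
  shows "op_norm (A + B - (C + D)) \<le> op_norm (A - C) + op_norm (B - D)"
proof -
  have "A + B - (C + D) = (A - C) + (B - D)" using assms by (intro eq_matI) auto
  then show ?thesis using assms op_norm_triangle[of "A - C" n n "B - D"] by (simp add: minus_carrier_mat)
qed

lemma op_norm_smult_diff:
  assumes "A \<in> carrier_mat n n" "C \<in> carrier_mat n n"
  shows "op_norm (a \<cdot>\<^sub>m A - a \<cdot>\<^sub>m C) = cmod a * op_norm (A - C)"
proof -
  have "a \<cdot>\<^sub>m A - a \<cdot>\<^sub>m C = a \<cdot>\<^sub>m (A - C)" using assms by (intro eq_matI) (auto simp: algebra_simps)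
  then show ?thesis using assms op_norm_smult[of "A - C" n n a] by (simp add: minus_carrier_mat)
qed

lemma op_norm_adjoint_diff:
  assumes "A \<in> carrier_mat n n" "C \<in> carrier_mat n n"
  shows "op_norm (mat_adjoint A - mat_adjoint C) = op_norm (A - C)"
  using assms by (simp flip: mat_adjoint_minus)

lemma uhf_cauchy_const:
  assumes "A \<in> M3 0"
  shows "uhf_cauchy (\<lambda>n. amp n A)"
  unfolding uhf_cauchy_def using amp_M3[OF assms] by (auto simp: amp_amp)

lemma uhf_cauchy_zero: "uhf_cauchy (\<lambda>n. 0\<^sub>m (3 ^ n) (3 ^ n))"
  by (auto simp: uhf_cauchy_def power_add)

lemma uhf_cauchy_one: "uhf_cauchy (\<lambda>n. 1\<^sub>m (3 ^ n))"
  by (auto simp: uhf_cauchy_def power_add)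

lemma uhf_cauchy_add:
  assumes x: "uhf_cauchy x" and y: "uhf_cauchy y"
  shows "uhf_cauchy (\<lambda>n. x n + y n)"
proof (rule uhf_cauchy_dominated[OF x y, where C = 1])
  fix n k
  have m: "x n \<in> M3 n" "y n \<in> M3 n" "x (n + k) \<in> M3 (n + k)" "y (n + k) \<in> M3 (n + k)"
    using x y by (auto intro: uhf_cauchy_M3)
  show "x n + y n \<in> M3 n" using m by simp
  show "op_norm (x (n + k) + y (n + k) - amp k (x n + y n)) \<le>
      1 * (op_norm (x (n + k) - amp k (x n)) + op_norm (y (n + k) - amp k (y n)))"
    using op_norm_add_diff[OF m(3,4) amp_M3[OF m(1)] amp_M3[OF m(2)]]
    by (simp add: kron_add_left[OF m(1,2)])
qed simp

lemma uhf_cauchy_smult: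
  assumes x: "uhf_cauchy x"
  shows "uhf_cauchy (\<lambda>n. a \<cdot>\<^sub>m x n)"
proof (rule uhf_cauchy_dominated[OF x x, where C = "cmod a"])
  fix n k
  have m: "x n \<in> M3 n" "x (n + k) \<in> M3 (n + k)"
    using x by (auto intro: uhf_cauchy_M3)
  show "a \<cdot>\<^sub>m x n \<in> M3 n" using m by simp
  show "op_norm (a \<cdot>\<^sub>m x (n + k) - amp k (a \<cdot>\<^sub>m x n)) \<le>
      cmod a * (op_norm (x (n + k) - amp k (x n)) + op_norm (x (n + k) - amp k (x n)))"
    using op_norm_smult_diff[OF m(2) amp_M3[OF m(1)], of a] by (simp add: kron_smult_left distrib_left)
qed simp

lemma uhf_cauchy_adjoint:
  assumes x: "uhf_cauchy x"
  shows "uhf_cauchy (\<lambda>n. mat_adjoint (x n))"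
proof (rule uhf_cauchy_dominated[OF x x, where C = 1])
  fix n k
  have m: "x n \<in> M3 n" "x (n + k) \<in> M3 (n + k)"
    using x by (auto intro: uhf_cauchy_M3)
  show "mat_adjoint (x n) \<in> M3 n" using m by auto
  show "op_norm (mat_adjoint (x (n + k)) - amp k (mat_adjoint (x n))) \<le>
      1 * (op_norm (x (n + k) - amp k (x n)) + op_norm (x (n + k) - amp k (x n)))"
    using op_norm_adjoint_diff[OF m(2) amp_M3[OF m(1)]] by (simp add: kron_adjoint)
qed simp

lemma uhf_cauchy_mult:
  assumes x: "uhf_cauchy x" and y: "uhf_cauchy y"
  shows "uhf_cauchy (\<lambda>n. x n * y n)"
proof -
  obtain C where C: "0 \<le> C" "\<And>n. op_norm (x n) \<le> C" using uhf_cauchy_bounded[OF x] by blast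
  obtain D where D: "0 \<le> D" "\<And>n. op_norm (y n) \<le> D" using uhf_cauchy_bounded[OF y] by blast
  show ?thesis
  proof (rule uhf_cauchy_dominated[OF x y, where C = "C + D"])
    fix n k
    have m: "x n \<in> M3 n" "y n \<in> M3 n" "x (n + k) \<in> M3 (n + k)" "y (n + k) \<in> M3 (n + k)"
      using x y by (auto intro: uhf_cauchy_M3)
    show "x n * y n \<in> M3 n" using m by simp
    let ?dx = "op_norm (x (n + k) - amp k (x n))" and ?dy = "op_norm (y (n + k) - amp k (y n))"
    have "op_norm (x (n + k) * y (n + k) - amp k (x n * y n)) \<le> ?dx * op_norm (y (n + k)) + op_norm (x n) * ?dy"
      using op_norm_mult_diff[OF m(3,4) amp_M3[OF m(1)] amp_M3[OF m(2)]]
      by (simp add: amp_mult[OF m(1,2)])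
    also have "\<dots> \<le> ?dx * D + C * ?dy"
      using C D by (intro add_mono mult_mono) auto
    also have "\<dots> \<le> (C + D) * (?dx + ?dy)"
      using C D by (simp add: algebra_simps)
    finally show "op_norm (x (n + k) * y (n + k) - amp k (x n * y n)) \<le> (C + D) * (?dx + ?dy)" .
  qed (use C D in simp)
qed

lemma uhf_rel_mult:
  assumes x: "uhf_rel x x'" and y: "uhf_rel y y'"
  shows "uhf_rel (\<lambda>n. x n * y n) (\<lambda>n. x' n * y' n)"
proof -
  have c: "uhf_cauchy x" "uhf_cauchy x'" "uhf_cauchy y" "uhf_cauchy y'"
    using x y by (auto simp: uhf_rel_def)
  obtain C where C: "0 \<le> C" "\<And>n. op_norm (x' n) \<le> C" using uhf_cauchy_bounded[OF c(2)] by blast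
  obtain D where D: "0 \<le> D" "\<And>n. op_norm (y n) \<le> D" using uhf_cauchy_bounded[OF c(3)] by blast
  show ?thesis
  proof (rule uhf_rel_dominated[OF x y, where C = "C + D"])
    fix n
    have m: "x n \<in> M3 n" "x' n \<in> M3 n" "y n \<in> M3 n" "y' n \<in> M3 n"
      using c by (auto intro: uhf_cauchy_M3)
    let ?dx = "op_norm (x n - x' n)" and ?dy = "op_norm (y n - y' n)"
    have "op_norm (x n * y n - x' n * y' n) \<le> ?dx * op_norm (y n) + op_norm (x' n) * ?dy"
      by (rule op_norm_mult_diff[OF m(1,3,2,4)])
    also have "\<dots> \<le> ?dx * D + C * ?dy"
      using C D by (intro add_mono mult_mono) auto
    also have "\<dots> \<le> (C + D) * (?dx + ?dy)"
      using C D by (simp add: algebra_simps)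
    finally show "op_norm (x n * y n - x' n * y' n) \<le> (C + D) * (?dx + ?dy)" .
  qed (use c in \<open>auto intro: uhf_cauchy_mult\<close>)
qed

quotient_type uhf = "nat \<Rightarrow> complex mat" / partial: uhf_rel
  by (rule part_equivp_uhf_rel)

lemma uhf_cases:
  obtains x where "uhf_cauchy x" "X = abs_uhf x"
  by (metis Quotient_abs_rep Quotient_rep_reflp Quotient_uhf uhf_rel_refl_iff)

lemma abs_uhf_eq_iff:
  "uhf_cauchy x \<Longrightarrow> uhf_cauchy y \<Longrightarrow> abs_uhf x = abs_uhf y \<longleftrightarrow> (\<lambda>n. op_norm (x n - y n)) \<longlonglongrightarrow> 0"
  using Quotient_rel[OF Quotient_uhf, of x y] by (simp add: uhf_rel_refl) (simp add: uhf_rel_def)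

lemma uhf_rel_smult:
  assumes x: "uhf_rel x x'"
  shows "uhf_rel (\<lambda>n. a \<cdot>\<^sub>m x n) (\<lambda>n. a \<cdot>\<^sub>m x' n)"
proof -
  have "op_norm (a \<cdot>\<^sub>m x n - a \<cdot>\<^sub>m x' n) = cmod a * op_norm (x n - x' n)" for n
    using x by (intro op_norm_smult_diff[where n = "3 ^ n"] uhf_cauchy_M3) (auto simp: uhf_rel_def)
  then show ?thesis
    by (intro uhf_rel_dominated[OF x x, where C = "cmod a"])
      (use x in \<open>auto simp: uhf_rel_def distrib_left intro!: uhf_cauchy_smult\<close>)
qed

lemma uminus_mat_smult: "- A = (- 1) \<cdot>\<^sub>m (A :: complex mat)"
  by (intro eq_matI) auto

instantiation uhf :: real_normed_algebra_1
begin

lift_definition zero_uhf :: uhf is "\<lambda>n. 0\<^sub>m (3 ^ n) (3 ^ n)"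
  by (rule uhf_rel_refl[OF uhf_cauchy_zero])

lift_definition one_uhf :: uhf is "\<lambda>n. 1\<^sub>m (3 ^ n)"
  by (rule uhf_rel_refl[OF uhf_cauchy_one])

lift_definition plus_uhf :: "uhf \<Rightarrow> uhf \<Rightarrow> uhf" is "\<lambda>x y n. x n + y n"
proof -
  fix x x' y y' assume x: "uhf_rel x x'" and y: "uhf_rel y y'"
  then show "uhf_rel (\<lambda>n. x n + y n) (\<lambda>n. x' n + y' n)"
    by (rule uhf_rel_dominated[where C = 1])
      (use x y in \<open>auto simp: uhf_rel_def intro!: uhf_cauchy_add op_norm_add_diff uhf_cauchy_M3\<close>)
qed

lift_definition times_uhf :: "uhf \<Rightarrow> uhf \<Rightarrow> uhf" is "\<lambda>x y n. x n * y n"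
  by (rule uhf_rel_mult)

lift_definition uminus_uhf :: "uhf \<Rightarrow> uhf" is "\<lambda>x n. - x n"
  unfolding uminus_mat_smult by (rule uhf_rel_smult)

lift_definition scaleR_uhf :: "real \<Rightarrow> uhf \<Rightarrow> uhf" is "\<lambda>r x n. complex_of_real r \<cdot>\<^sub>m x n"
  by (rule uhf_rel_smult)

lift_definition norm_uhf :: "uhf \<Rightarrow> real" is "\<lambda>x. lim (\<lambda>n. op_norm (x n))"
proof -
  fix x x' assume x: "uhf_rel x x'"
  then have c: "uhf_cauchy x" "uhf_cauchy x'" by (auto simp: uhf_rel_def)
  have "(\<lambda>n. op_norm (x n) - op_norm (x' n)) \<longlonglongrightarrow> 0"
  proof (rule tendsto_0_le[where K = 1])
    show "\<forall>\<^sub>F n in sequentially. norm (op_norm (x n) - op_norm (x' n)) \<le> norm (op_norm (x n - x' n)) * 1"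
      using op_norm_diff_le[OF uhf_cauchy_M3[OF c(1)] uhf_cauchy_M3[OF c(2)]] by simp
    show "(\<lambda>n. op_norm (x n - x' n)) \<longlonglongrightarrow> 0" using x by (simp add: uhf_rel_def)
  qed
  moreover have "(\<lambda>n. op_norm (x n)) \<longlonglongrightarrow> lim (\<lambda>n. op_norm (x n))"
    using uhf_cauchy_convergent[OF c(1)] by (simp add: convergent_LIMSEQ_iff)
  ultimately have "(\<lambda>n. op_norm (x n) - (op_norm (x n) - op_norm (x' n))) \<longlonglongrightarrow> lim (\<lambda>n. op_norm (x n)) - 0"
    by (intro tendsto_diff)
  then have "(\<lambda>n. op_norm (x' n)) \<longlonglongrightarrow> lim (\<lambda>n. op_norm (x n))" by simp
  then show "lim (\<lambda>n. op_norm (x n)) = lim (\<lambda>n. op_norm (x' n))" by (rule limI[symmetric])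
qed

definition "X - Y = X + - (Y :: uhf)"
definition "sgn X = inverse (norm X) *\<^sub>R (X :: uhf)"
definition "dist X Y = norm (X - Y :: uhf)"
definition uniformity_uhf :: "(uhf \<times> uhf) filter" where
  "uniformity_uhf = (INF e\<in>{0<..}. principal {(X, Y). dist X Y < e})"
definition open_uhf :: "uhf set \<Rightarrow> bool" where
  "open_uhf U \<longleftrightarrow> (\<forall>X\<in>U. \<forall>\<^sub>F (X', Y) in uniformity. X' = X \<longrightarrow> Y \<in> U)"

lemma abs_uhf_add: "uhf_cauchy x \<Longrightarrow> uhf_cauchy y \<Longrightarrow> abs_uhf x + abs_uhf y = abs_uhf (\<lambda>n. x n + y n)"
  by (simp add: plus_uhf.abs_eq uhf_rel_refl)

lemma abs_uhf_mult: "uhf_cauchy x \<Longrightarrow> uhf_cauchy y \<Longrightarrow> abs_uhf x * abs_uhf y = abs_uhf (\<lambda>n. x n * y n)"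
  by (simp add: times_uhf.abs_eq uhf_rel_refl)

lemma abs_uhf_uminus: "uhf_cauchy x \<Longrightarrow> - abs_uhf x = abs_uhf (\<lambda>n. - x n)"
  by (simp add: uminus_uhf.abs_eq uhf_rel_refl)

lemma abs_uhf_scaleR: "uhf_cauchy x \<Longrightarrow> r *\<^sub>R abs_uhf x = abs_uhf (\<lambda>n. complex_of_real r \<cdot>\<^sub>m x n)"
  by (simp add: scaleR_uhf.abs_eq uhf_rel_refl)

lemma norm_abs_uhf: "uhf_cauchy x \<Longrightarrow> (\<lambda>n. op_norm (x n)) \<longlonglongrightarrow> norm (abs_uhf x)"
  using uhf_cauchy_convergent[of x] by (simp add: norm_uhf.abs_eq uhf_rel_refl convergent_LIMSEQ_iff)

lemma uhf_cauchy_uminus: "uhf_cauchy x \<Longrightarrow> uhf_cauchy (\<lambda>n. - x n)"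
  unfolding uminus_mat_smult by (rule uhf_cauchy_smult)

lemma uhf_cauchy_minus:
  assumes "uhf_cauchy x" "uhf_cauchy y"
  shows "uhf_cauchy (\<lambda>n. x n - y n)"
proof -
  have "x n - y n = x n + - y n" for n
    using assms[THEN uhf_cauchy_M3, of n] by (intro eq_matI) auto
  then show ?thesis using uhf_cauchy_add[OF assms(1) uhf_cauchy_uminus[OF assms(2)]] by simp
qed

lemma abs_uhf_minus:
  assumes "uhf_cauchy x" "uhf_cauchy y"
  shows "abs_uhf x - abs_uhf y = abs_uhf (\<lambda>n. x n - y n)"
proof -
  have "x n - y n = x n + - y n" for n
    using assms[THEN uhf_cauchy_M3, of n] by (intro eq_matI) auto
  then show ?thesis using assms by (simp add: minus_uhf_def abs_uhf_uminus abs_uhf_add uhf_cauchy_uminus)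
qed

lemmas uhf_cauchy_intros =
  uhf_cauchy_zero uhf_cauchy_one uhf_cauchy_add uhf_cauchy_mult uhf_cauchy_uminus uhf_cauchy_minus
  uhf_cauchy_smult uhf_cauchy_adjoint

lemmas abs_uhf_simps =
  abs_uhf_add abs_uhf_mult abs_uhf_uminus abs_uhf_scaleR abs_uhf_minus zero_uhf.abs_eq one_uhf.abs_eq
  uhf_cauchy_intros

instance
proof
  fix X Y Z :: uhf and r s :: real
  obtain x where x: "uhf_cauchy x" "X = abs_uhf x" by (rule uhf_cases)
  obtain y where y: "uhf_cauchy y" "Y = abs_uhf y" by (rule uhf_cases)
  obtain z where z: "uhf_cauchy z" "Z = abs_uhf z" by (rule uhf_cases)
  note m [simp] = uhf_cauchy_M3[OF x(1)] uhf_cauchy_M3[OF y(1)] uhf_cauchy_M3[OF z(1)]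
  note d [simp] = m[THEN carrier_matD(1)] m[THEN carrier_matD(2)]
  note eqs = x(1) y(1) z(1) x(2) y(2) z(2) abs_uhf_simps
  show "X + Y + Z = X + (Y + Z)"
    by (simp add: eqs assoc_add_mat[OF m])
  show "X + Y = Y + X"
    by (simp add: eqs comm_add_mat[OF m(1,2)])
  show "0 + X = X"
    by (simp add: eqs)
  show "- X + X = 0"
    by (simp add: eqs) (intro arg_cong[where f = abs_uhf] ext eq_matI, auto)
  show "X - Y = X + - Y"
    by (fact minus_uhf_def)
  show "r *\<^sub>R (X + Y) = r *\<^sub>R X + r *\<^sub>R Y"
    by (simp add: eqs) (intro arg_cong[where f = abs_uhf] ext eq_matI, auto simp: algebra_simps)
  show "(r + s) *\<^sub>R X = r *\<^sub>R X + s *\<^sub>R X"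
    by (simp add: eqs) (intro arg_cong[where f = abs_uhf] ext eq_matI, auto simp: algebra_simps)
  show "r *\<^sub>R s *\<^sub>R X = (r * s) *\<^sub>R X"
    by (simp add: eqs) (intro arg_cong[where f = abs_uhf] ext eq_matI, auto simp: algebra_simps)
  show "1 *\<^sub>R X = X"
    by (simp add: eqs) (intro arg_cong[where f = abs_uhf] ext eq_matI, auto)
  show "X * Y * Z = X * (Y * Z)"
    by (simp add: eqs assoc_mult_mat[OF m])
  show "(X + Y) * Z = X * Z + Y * Z"
    by (simp add: eqs add_mult_distrib_mat[OF m])
  show "X * (Y + Z) = X * Y + X * Z"
    by (simp add: eqs mult_add_distrib_mat[OF m])
  show "r *\<^sub>R X * Y = r *\<^sub>R (X * Y)"
    by (simp add: eqs mult_smult_assoc_mat[OF m(1,2)])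
  show "X * r *\<^sub>R Y = r *\<^sub>R (X * Y)"
    by (simp add: eqs mult_smult_distrib[OF m(1,2)])
  show "1 * X = X" "X * 1 = X"
    by (simp_all add: eqs left_mult_one_mat[OF m(1)] right_mult_one_mat[OF m(1)])
  have norm_one: "norm (1 :: uhf) = 1"
    using norm_abs_uhf[OF uhf_cauchy_one] by (simp add: one_uhf.abs_eq LIMSEQ_const_iff)
  then show "norm (1 :: uhf) = 1" .
  show "(0 :: uhf) \<noteq> 1"
  proof
    assume "(0 :: uhf) = 1"
    then have "norm (0 :: uhf) = 1" using norm_one by simp
    then show False using norm_abs_uhf[OF uhf_cauchy_zero] by (simp add: zero_uhf.abs_eq LIMSEQ_const_iff)
  qed
  show "dist X Y = norm (X - Y)" by (fact dist_uhf_def)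
  show "sgn X = inverse (norm X) *\<^sub>R X" by (fact sgn_uhf_def)
  show "uniformity = (INF e\<in>{0<..}. principal {(X, Y :: uhf). dist X Y < e})"
    by (fact uniformity_uhf_def)
  show "open U \<longleftrightarrow> (\<forall>X\<in>U. \<forall>\<^sub>F (X', Y) in uniformity. X' = X \<longrightarrow> Y \<in> U)" for U :: "uhf set"
    by (fact open_uhf_def)
  have "x n - 0\<^sub>m (3 ^ n) (3 ^ n) = x n" for n
    by (intro eq_matI) auto
  then have "X = 0 \<longleftrightarrow> (\<lambda>n. op_norm (x n)) \<longlonglongrightarrow> 0"
    by (simp add: x zero_uhf.abs_eq abs_uhf_eq_iff uhf_cauchy_zero)
  then show "norm X = 0 \<longleftrightarrow> X = 0"
    using norm_abs_uhf[OF x(1)] x(2) by (auto dest: LIMSEQ_unique)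
  show "norm (X + Y) \<le> norm X + norm Y"
    unfolding x(2) y(2) abs_uhf_add[OF x(1) y(1)]
    by (rule LIMSEQ_le[OF norm_abs_uhf[OF uhf_cauchy_add[OF x(1) y(1)]] tendsto_add[OF norm_abs_uhf[OF x(1)] norm_abs_uhf[OF y(1)]]])
      (use op_norm_triangle[OF m(1,2)] in blast)
  show "norm (X * Y) \<le> norm X * norm Y"
    unfolding x(2) y(2) abs_uhf_mult[OF x(1) y(1)]
    by (rule LIMSEQ_le[OF norm_abs_uhf[OF uhf_cauchy_mult[OF x(1) y(1)]] tendsto_mult[OF norm_abs_uhf[OF x(1)] norm_abs_uhf[OF y(1)]]])
      (use op_norm_mult[OF m(1,2)] in blast)
  have "(\<lambda>n. \<bar>r\<bar> * op_norm (x n)) \<longlonglongrightarrow> norm (r *\<^sub>R X)"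
    using norm_abs_uhf[OF uhf_cauchy_smult[OF x(1), of "complex_of_real r"]]
    by (simp add: x abs_uhf_scaleR op_norm_smult[OF m(1)])
  moreover have "(\<lambda>n. \<bar>r\<bar> * op_norm (x n)) \<longlonglongrightarrow> \<bar>r\<bar> * norm X"
    unfolding x(2) by (intro tendsto_intros norm_abs_uhf x)
  ultimately show "norm (r *\<^sub>R X) = \<bar>r\<bar> * norm X"
    by (rule LIMSEQ_unique)
qed

end

text \<open>The canonical embedding of \<open>M3 n\<close>. It is meaningful only for arguments in \<open>M3 n\<close>, where it is an
  isometric unital *-homomorphism compatible with the connecting maps; the union of the images
  is dense (\<open>uhf_emb_approx\<close>).\<close>

definition uhf_emb :: "nat \<Rightarrow> complex mat \<Rightarrow> uhf" where
  "uhf_emb n A = abs_uhf (\<lambda>k. if k < n then 0\<^sub>m (3 ^ k) (3 ^ k) else amp (k - n) A)"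

lemma uhf_cauchy_emb:
  assumes A: "A \<in> M3 n"
  shows "uhf_cauchy (\<lambda>k. if k < n then 0\<^sub>m (3 ^ k) (3 ^ k) else amp (k - n) A)"
    (is "uhf_cauchy ?x")
  unfolding uhf_cauchy_def
proof (intro conjI allI impI)
  fix k
  show "?x k \<in> M3 k" using amp_M3[OF A, of "k - n"] by auto
next
  fix e :: real assume "0 < e"
  have "?x (k + l) = amp l (?x k)" if "k \<ge> n" for k l
    using that by (simp add: amp_amp)
  then show "\<exists>N. \<forall>k\<ge>N. \<forall>l. op_norm (?x (k + l) - amp l (?x k)) < e"
    using \<open>0 < e\<close> by (intro exI[of _ n]) simp
qed

lemma norm_eq_of_eventually:
  assumes x: "uhf_cauchy x" and le: "\<And>k. k \<ge> n \<Longrightarrow> op_norm (x k) \<le> C"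
  shows "norm (abs_uhf x) \<le> C"
  by (rule LIMSEQ_le_const2[OF norm_abs_uhf[OF x]]) (use le in blast)

lemma norm_uhf_emb [simp]:
  assumes A: "A \<in> M3 n"
  shows "norm (uhf_emb n A) = op_norm A"
proof -
  have "(\<lambda>k. op_norm (if k + n < n then 0\<^sub>m (3 ^ (k + n)) (3 ^ (k + n)) else amp (k + n - n) A))
    \<longlonglongrightarrow> norm (uhf_emb n A)"
    unfolding uhf_emb_def by (rule LIMSEQ_ignore_initial_segment[OF norm_abs_uhf[OF uhf_cauchy_emb[OF A]]])
  then show ?thesis by (simp add: LIMSEQ_const_iff)
qed

lemma abs_uhf_eventually_eq:
  assumes "uhf_cauchy x" "uhf_cauchy y" "\<And>k. k \<ge> N \<Longrightarrow> x k = y k"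
  shows "abs_uhf x = abs_uhf y"
  unfolding abs_uhf_eq_iff[OF assms(1,2)]
  by (rule tendsto_eventually) (use assms(3) in \<open>auto simp: eventually_sequentially intro!: exI[of _ N]\<close>)

lemma uhf_emb_amp: "A \<in> M3 n \<Longrightarrow> uhf_emb (n + k) (amp k A) = uhf_emb n A"
  unfolding uhf_emb_def
  by (rule abs_uhf_eventually_eq[where N = "n + k"])
    (auto simp: amp_amp intro!: uhf_cauchy_emb)

lemma uhf_emb_add: "A \<in> M3 n \<Longrightarrow> B \<in> M3 n \<Longrightarrow> uhf_emb n (A + B) = uhf_emb n A + uhf_emb n B"
  unfolding uhf_emb_def
  by (subst abs_uhf_add[OF uhf_cauchy_emb uhf_cauchy_emb], assumption+)
    (rule abs_uhf_eventually_eq[where N = n],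
      auto simp: kron_add_left intro!: uhf_cauchy_emb uhf_cauchy_add)

lemma uhf_emb_minus: "A \<in> M3 n \<Longrightarrow> B \<in> M3 n \<Longrightarrow> uhf_emb n (A - B) = uhf_emb n A - uhf_emb n B"
  unfolding uhf_emb_def
  by (subst abs_uhf_minus[OF uhf_cauchy_emb uhf_cauchy_emb], assumption+)
    (rule abs_uhf_eventually_eq[where N = n],
      auto simp: kron_minus_left intro!: uhf_cauchy_emb uhf_cauchy_minus)

lemma uhf_emb_mult: "A \<in> M3 n \<Longrightarrow> B \<in> M3 n \<Longrightarrow> uhf_emb n (A * B) = uhf_emb n A * uhf_emb n B"
  unfolding uhf_emb_def
  by (subst abs_uhf_mult[OF uhf_cauchy_emb uhf_cauchy_emb], assumption+)
    (rule abs_uhf_eventually_eq[where N = n],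
      auto simp: amp_mult intro!: uhf_cauchy_emb uhf_cauchy_mult)

lemma uhf_emb_one: "uhf_emb n (1\<^sub>m (3 ^ n)) = 1"
  unfolding uhf_emb_def one_uhf.abs_eq
  by (rule abs_uhf_eventually_eq[where N = n])
    (auto intro!: uhf_cauchy_emb uhf_cauchy_one simp flip: power_add)

lemma uhf_emb_tendsto_abs:
  assumes x: "uhf_cauchy x"
  shows "(\<lambda>n. uhf_emb n (x n)) \<longlonglongrightarrow> abs_uhf x"
proof (rule metric_LIMSEQ_I)
  fix e :: real assume e: "0 < e"
  then obtain N where N: "\<And>n k. n \<ge> N \<Longrightarrow> op_norm (x (n + k) - amp k (x n)) < e / 2"
    using uhf_cauchyD[OF x, of "e / 2"] by auto
  have "dist (uhf_emb n (x n)) (abs_uhf x) < e" if "n \<ge> N" for n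
  proof -
    let ?y = "\<lambda>k. if k < n then 0\<^sub>m (3 ^ k) (3 ^ k) else amp (k - n) (x n)"
    have y: "uhf_cauchy ?y" by (rule uhf_cauchy_emb[OF uhf_cauchy_M3[OF x]])
    have "norm (abs_uhf (\<lambda>k. x k - ?y k)) \<le> e / 2"
    proof (rule norm_eq_of_eventually[OF uhf_cauchy_minus[OF x y]])
      fix k assume "k \<ge> n"
      then show "op_norm (x k - ?y k) \<le> e / 2" using N[OF that, of "k - n"] by simp
    qed
    then show ?thesis
      using e by (simp add: uhf_emb_def dist_norm norm_minus_commute abs_uhf_minus[OF x y])
  qed
  then show "\<exists>N. \<forall>n\<ge>N. dist (uhf_emb n (x n)) (abs_uhf x) < e" by blast
qed

lemma uhf_emb_approx:
  fixes X :: uhf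
  assumes e: "0 < e"
  shows "\<exists>N. \<forall>n\<ge>N. \<exists>A\<in>M3 n. dist X (uhf_emb n A) < e"
proof -
  obtain x where x: "uhf_cauchy x" "X = abs_uhf x" by (rule uhf_cases)
  show ?thesis
    using metric_LIMSEQ_D[OF uhf_emb_tendsto_abs[OF x(1)] e] uhf_cauchy_M3[OF x(1)]
    unfolding x(2) by (metis dist_commute)
qed

lemma uhf_cauchy_if_Cauchy:
  assumes z: "\<And>n. z n \<in> M3 n" and C: "Cauchy (\<lambda>n. uhf_emb n (z n))"
  shows "uhf_cauchy z"
  unfolding uhf_cauchy_def
proof (intro conjI allI impI z)
  fix e :: real assume "0 < e"
  then obtain N where N: "\<And>m n. m \<ge> N \<Longrightarrow> n \<ge> N \<Longrightarrow> dist (uhf_emb m (z m)) (uhf_emb n (z n)) < e"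
    using metric_CauchyD[OF C] by blast
  have "op_norm (z (n + k) - amp k (z n)) < e" if "n \<ge> N" for n k
  proof -
    have "op_norm (z (n + k) - amp k (z n)) = norm (uhf_emb (n + k) (z (n + k) - amp k (z n)))"
      using z by (intro norm_uhf_emb[symmetric] M3_minus amp_M3)
    also have "\<dots> = dist (uhf_emb (n + k) (z (n + k))) (uhf_emb n (z n))"
      using z by (simp add: uhf_emb_minus amp_M3 uhf_emb_amp dist_norm)
    also have "\<dots> < e" using N[of "n + k" n] that by simp
    finally show ?thesis .
  qed
  then show "\<exists>N. \<forall>n\<ge>N. \<forall>k. op_norm (z (n + k) - amp k (z n)) < e" by blast
qed

instance uhf :: banach
proof
  fix X :: "nat \<Rightarrow> uhf" assume X: "Cauchy X"
  define D where "D n Y = (INF A\<in>M3 n. dist Y (uhf_emb n A))" for n and Y :: uhf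
  have ne: "M3 n \<noteq> {}" for n using zero_carrier_mat by blast
  have bdd: "bdd_below ((\<lambda>A. dist Y (uhf_emb n A)) ` M3 n)" for n and Y :: uhf
    by (rule bdd_belowI2[where m = 0]) simp
  have D_lt: "\<exists>A\<in>M3 n. dist Y (uhf_emb n A) < c" if "D n Y < c" for n Y c
    using that unfolding D_def by (subst (asm) cINF_less_iff[OF ne bdd])
  have D_le: "D n Y \<le> dist Y (uhf_emb n A)" if "A \<in> M3 n" for n Y A
    unfolding D_def using that by (rule cINF_lower[OF bdd])
  have "\<exists>z. z \<in> M3 n \<and> dist (X n) (uhf_emb n z) < D n (X n) + inverse (Suc n)" for n
    using D_lt[of n "X n" "D n (X n) + inverse (Suc n)"] by auto
  then obtain z where z: "\<And>n. z n \<in> M3 n"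
    and zX: "\<And>n. dist (X n) (uhf_emb n (z n)) < D n (X n) + inverse (Suc n)"
    by metis
  have lim: "(\<lambda>n. dist (X n) (uhf_emb n (z n))) \<longlonglongrightarrow> 0"
  proof (rule metric_LIMSEQ_I)
    fix e :: real assume e: "0 < e"
    then obtain N1 where N1: "\<And>m n. m \<ge> N1 \<Longrightarrow> n \<ge> N1 \<Longrightarrow> dist (X m) (X n) < e / 3"
      using metric_CauchyD[OF X, of "e / 3"] by auto
    obtain N2 where N2: "\<And>n. n \<ge> N2 \<Longrightarrow> \<exists>A\<in>M3 n. dist (X N1) (uhf_emb n A) < e / 3"
      using uhf_emb_approx[of "e / 3" "X N1"] e by auto
    obtain N3 where N3: "inverse (real (Suc N3)) < e / 3"
      using reals_Archimedean[of "e / 3"] e by auto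
    have "dist (X n) (uhf_emb n (z n)) < e" if n: "n \<ge> max N1 (max N2 N3)" for n
    proof -
      obtain A where A: "A \<in> M3 n" "dist (X N1) (uhf_emb n A) < e / 3" using N2[of n] n by auto
      have "D n (X n) \<le> dist (X n) (uhf_emb n A)" by (rule D_le[OF A(1)])
      also have "\<dots> \<le> dist (X n) (X N1) + dist (X N1) (uhf_emb n A)" by (rule dist_triangle)
      also have "\<dots> < e / 3 + e / 3" using A(2) N1[of n N1] n by simp
      finally have "D n (X n) < e / 3 + e / 3" .
      moreover have "inverse (real (Suc n)) \<le> inverse (real (Suc N3))"
        using n by (intro le_imp_inverse_le) auto
      ultimately show ?thesis using zX[of n] N3 by linarith
    qed
    then show "\<exists>N. \<forall>n\<ge>N. dist (dist (X n) (uhf_emb n (z n))) 0 < e"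
      by (auto intro!: exI[of _ "max N1 (max N2 N3)"])
  qed
  have "Cauchy (\<lambda>n. uhf_emb n (z n))"
  proof (rule metric_CauchyI)
    fix e :: real assume e: "0 < e"
    then obtain N1 where N1: "\<And>m n. m \<ge> N1 \<Longrightarrow> n \<ge> N1 \<Longrightarrow> dist (X m) (X n) < e / 3"
      using metric_CauchyD[OF X, of "e / 3"] by auto
    obtain N2 where N2: "\<And>n. n \<ge> N2 \<Longrightarrow> dist (X n) (uhf_emb n (z n)) < e / 3"
      using metric_LIMSEQ_D[OF lim, of "e / 3"] e by auto
    have "dist (uhf_emb m (z m)) (uhf_emb n (z n)) < e" if "m \<ge> max N1 N2" "n \<ge> max N1 N2" for m n
    proof -
      have "dist (uhf_emb m (z m)) (uhf_emb n (z n)) \<le>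
          dist (X m) (uhf_emb m (z m)) + dist (X m) (uhf_emb n (z n))"
        by (metis dist_triangle dist_commute)
      also have "dist (X m) (uhf_emb n (z n)) \<le> dist (X m) (X n) + dist (X n) (uhf_emb n (z n))"
        by (rule dist_triangle)
      finally show ?thesis using N1[of m n] N2[of m] N2[of n] that by simp
    qed
    then show "\<exists>M. \<forall>m\<ge>M. \<forall>n\<ge>M. dist (uhf_emb m (z m)) (uhf_emb n (z n)) < e" by blast
  qed
  with z have cz: "uhf_cauchy z" by (rule uhf_cauchy_if_Cauchy)
  have "(\<lambda>n. dist (X n) (abs_uhf z)) \<longlonglongrightarrow> 0"
  proof (rule tendsto_0_le[where K = 1])
    show "(\<lambda>n. dist (X n) (uhf_emb n (z n)) + dist (uhf_emb n (z n)) (abs_uhf z)) \<longlonglongrightarrow> 0"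
      using tendsto_add[OF lim tendsto_dist_iff[THEN iffD1, OF uhf_emb_tendsto_abs[OF cz]]] by simp
    show "\<forall>\<^sub>F n in sequentially. norm (dist (X n) (abs_uhf z)) \<le>
        norm (dist (X n) (uhf_emb n (z n)) + dist (uhf_emb n (z n)) (abs_uhf z)) * 1"
      by (intro always_eventually allI) (simp add: dist_triangle)
  qed
  then have "X \<longlonglongrightarrow> abs_uhf z" by (subst tendsto_dist_iff)
  then show "convergent X" by (rule convergentI)
qed

instantiation uhf :: cstar_algebra_1
begin

lift_definition scaleC_uhf :: "complex \<Rightarrow> uhf \<Rightarrow> uhf" is "\<lambda>a x n. a \<cdot>\<^sub>m x n"
  by (rule uhf_rel_smult)

lift_definition star_uhf :: "uhf \<Rightarrow> uhf" is "\<lambda>x n. mat_adjoint (x n)"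
proof -
  fix x x' assume x: "uhf_rel x x'"
  have "op_norm (mat_adjoint (x n) - mat_adjoint (x' n)) = op_norm (x n - x' n)" for n
    using x by (intro op_norm_adjoint_diff[where n = "3 ^ n"] uhf_cauchy_M3) (auto simp: uhf_rel_def)
  then show "uhf_rel (\<lambda>n. mat_adjoint (x n)) (\<lambda>n. mat_adjoint (x' n))"
    by (intro uhf_rel_dominated[OF x x, where C = 1])
      (use x in \<open>auto simp: uhf_rel_def intro!: uhf_cauchy_adjoint\<close>)
qed

lemma abs_uhf_scaleC: "uhf_cauchy x \<Longrightarrow> a *\<^sub>C abs_uhf x = abs_uhf (\<lambda>n. a \<cdot>\<^sub>m x n)"
  by (simp add: scaleC_uhf.abs_eq uhf_rel_refl)

lemma abs_uhf_star: "uhf_cauchy x \<Longrightarrow> star (abs_uhf x) = abs_uhf (\<lambda>n. mat_adjoint (x n))"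
  by (simp add: star_uhf.abs_eq uhf_rel_refl)

instance
proof
  fix X Y :: uhf and a b :: complex and r :: real
  obtain x where x: "uhf_cauchy x" "X = abs_uhf x" by (rule uhf_cases)
  obtain y where y: "uhf_cauchy y" "Y = abs_uhf y" by (rule uhf_cases)
  note m [simp] = uhf_cauchy_M3[OF x(1)] uhf_cauchy_M3[OF y(1)]
  note d [simp] = m[THEN carrier_matD(1)] m[THEN carrier_matD(2)]
  note eqs = x(1) y(1) x(2) y(2) abs_uhf_simps abs_uhf_scaleC abs_uhf_star
  show "a *\<^sub>C (X + Y) = a *\<^sub>C X + a *\<^sub>C Y"
    by (simp add: eqs) (intro arg_cong[where f = abs_uhf] ext eq_matI, auto simp: algebra_simps)
  show "(a + b) *\<^sub>C X = a *\<^sub>C X + b *\<^sub>C X"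
    by (simp add: eqs) (intro arg_cong[where f = abs_uhf] ext eq_matI, auto simp: algebra_simps)
  show "a *\<^sub>C b *\<^sub>C X = (a * b) *\<^sub>C X"
    by (simp add: eqs) (intro arg_cong[where f = abs_uhf] ext eq_matI, auto simp: algebra_simps)
  show "r *\<^sub>R X = complex_of_real r *\<^sub>C X"
    by (simp add: eqs)
  show "a *\<^sub>C X * Y = a *\<^sub>C (X * Y)"
    by (simp add: eqs mult_smult_assoc_mat[OF m(1,2)])
  show "X * a *\<^sub>C Y = a *\<^sub>C (X * Y)"
    by (simp add: eqs mult_smult_distrib[OF m(1,2)])
  have "(\<lambda>n. cmod a * op_norm (x n)) \<longlonglongrightarrow> norm (a *\<^sub>C X)"
    using norm_abs_uhf[OF uhf_cauchy_smult[OF x(1), of a]]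
    by (simp add: x abs_uhf_scaleC op_norm_smult[OF m(1)])
  moreover have "(\<lambda>n. cmod a * op_norm (x n)) \<longlonglongrightarrow> cmod a * norm X"
    unfolding x(2) by (intro tendsto_intros norm_abs_uhf x)
  ultimately show "norm (a *\<^sub>C X) = cmod a * norm X"
    by (rule LIMSEQ_unique)
  show "star (star X) = X"
    by (simp add: eqs)
  show "star (X + Y) = star X + star Y"
    by (simp add: eqs mat_adjoint_add[OF m(1,2)])
  show "star (a *\<^sub>C X) = cnj a *\<^sub>C star X"
    by (simp add: eqs mat_adjoint_smult)
  show "star (X * Y) = star Y * star X"
    by (simp add: eqs mat_adjoint_mult[OF m(1,2)])
  have "(\<lambda>n. (op_norm (x n))\<^sup>2) \<longlonglongrightarrow> norm (star X * X)"
    using norm_abs_uhf[OF uhf_cauchy_mult[OF uhf_cauchy_adjoint[OF x(1)] x(1)]]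
    by (simp add: eqs op_norm_cstar)
  moreover have "(\<lambda>n. (op_norm (x n))\<^sup>2) \<longlonglongrightarrow> (norm X)\<^sup>2"
    unfolding x(2) by (intro tendsto_intros norm_abs_uhf x)
  ultimately show "norm (star X * X) = (norm X)\<^sup>2"
    by (rule LIMSEQ_unique)
qed

end

lemma uhf_emb_scaleC: "A \<in> M3 n \<Longrightarrow> uhf_emb n (a \<cdot>\<^sub>m A) = a *\<^sub>C uhf_emb n A"
  unfolding uhf_emb_def
  by (subst abs_uhf_scaleC[OF uhf_cauchy_emb], assumption)
    (rule abs_uhf_eventually_eq[where N = n],
      auto simp: kron_smult_left intro!: uhf_cauchy_emb uhf_cauchy_smult)

lemma uhf_emb_star: "A \<in> M3 n \<Longrightarrow> uhf_emb n (mat_adjoint A) = star (uhf_emb n A)"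
  unfolding uhf_emb_def
  by (subst abs_uhf_star[OF uhf_cauchy_emb], assumption)
    (rule abs_uhf_eventually_eq[where N = n],
      auto simp: kron_adjoint intro!: uhf_cauchy_emb uhf_cauchy_adjoint)

subsection \<open>The slice maps\<close>

lemma slices_amp_diff:
  assumes x: "uhf_cauchy x"
  shows "op_norm (slices (k + l) (x (n + (k + l))) - slices k (x (n + k)))
    \<le> op_norm (x (n + k + l) - amp l (x (n + k)))"
proof -
  have m: "x (n + k) \<in> M3 (n + k)" "x (n + k + l) \<in> M3 (n + k + l)" "amp l (x (n + k)) \<in> M3 (n + k + l)"
    using x by (auto intro: uhf_cauchy_M3 amp_M3)
  have c: "slices (k + l) A = slices k (slices l A)" for A
    by (simp add: funpow_add)
  have "slices (k + l) (x (n + k + l)) - slices k (x (n + k)) =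
      slices (k + l) (x (n + k + l)) - slices (k + l) (amp l (x (n + k)))"
    by (simp only: c slices_kron_one)
  also have "\<dots> = slices (k + l) (x (n + k + l) - amp l (x (n + k)))"
    using m by (intro slices_minus[where n = n, symmetric]) (auto simp: add.assoc)
  also have "op_norm \<dots> \<le> op_norm (x (n + k + l) - amp l (x (n + k)))"
    using m by (intro op_norm_slices[where n = n]) (auto simp: add.assoc)
  finally show ?thesis by (simp add: add.assoc)
qed

lemma slices_M3:
  assumes "uhf_cauchy x"
  shows "slices k (x (n + k)) \<in> M3 n"
  using uhf_cauchy_M3[OF assms, of "n + k"] by (rule slices_carrier)

lemma slices_entry_convergent:
  assumes x: "uhf_cauchy x" and ij: "i < 3 ^ n" "j < 3 ^ n"
  shows "convergent (\<lambda>k. slices k (x (n + k)) $$ (i, j))"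
proof -
  have "Cauchy (\<lambda>k. slices k (x (n + k)) $$ (i, j))"
  proof (rule metric_CauchyI)
    fix e :: real assume "0 < e"
    then obtain N where N: "\<And>p k. p \<ge> N \<Longrightarrow> op_norm (x (p + k) - amp k (x p)) < e / 2"
      using uhf_cauchyD[OF x, of "e / 2"] by auto
    have *: "dist (slices k (x (n + k)) $$ (i, j)) (slices N (x (n + N)) $$ (i, j)) < e / 2"
      if "k \<ge> N" for k
    proof -
      define l where "l = k - N"
      have k: "k = N + l" using that by (simp add: l_def)
      have m: "slices k (x (n + k)) \<in> M3 n" "slices N (x (n + N)) \<in> M3 n"
        using slices_M3[OF x] by auto
      have "dist (slices k (x (n + k)) $$ (i, j)) (slices N (x (n + N)) $$ (i, j)) =
          cmod ((slices k (x (n + k)) - slices N (x (n + N))) $$ (i, j))"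
        using m ij by (simp add: dist_norm)
      also have "\<dots> \<le> op_norm (slices k (x (n + k)) - slices N (x (n + N)))"
        using m ij by (intro index_le_op_norm[where n = "3 ^ n" and m = "3 ^ n"] M3_minus)
      also have "\<dots> \<le> op_norm (x (n + N + l) - amp l (x (n + N)))"
        unfolding k by (rule slices_amp_diff[OF x])
      also have "\<dots> < e / 2" by (rule N) simp
      finally show ?thesis .
    qed
    show "\<exists>M. \<forall>k\<ge>M. \<forall>l\<ge>M. dist (slices k (x (n + k)) $$ (i, j)) (slices l (x (n + l)) $$ (i, j)) < e"
      using * by (intro exI[of _ N]) (blast intro: dist_triangle_half_r dist_triangle_half_l)
  qed
  then show ?thesis by (rule Cauchy_convergent)
qed

text \<open>\<open>rho m\<close> is the continuous extension of the maps applying \<open>e22_state\<close> to all tensor factors after the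
  first m + 1 (\<open>rho_uhf_emb\<close>, \<open>op_norm_rho_le\<close>). The limit exists and is taken entrywise in the
  finite-dimensional space \<open>M3 (m + 1)\<close>.\<close>

lift_definition rho :: "nat \<Rightarrow> uhf \<Rightarrow> complex mat" is
  "\<lambda>m x. mat (3 ^ (m + 1)) (3 ^ (m + 1)) (\<lambda>(i, j). lim (\<lambda>k. slices k (x (m + 1 + k)) $$ (i, j)))"
proof -
  fix m x y assume xy: "uhf_rel x y"
  then have c: "uhf_cauchy x" "uhf_cauchy y" by (auto simp: uhf_rel_def)
  let ?s = "\<lambda>x k. slices k (x (m + 1 + k))"
  have "lim (\<lambda>k. ?s x k $$ (i, j)) = lim (\<lambda>k. ?s y k $$ (i, j))"
    if ij: "i < 3 ^ (m + 1)" "j < 3 ^ (m + 1)" for i j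
  proof -
    have "(\<lambda>k. ?s x k $$ (i, j) - ?s y k $$ (i, j)) \<longlonglongrightarrow> 0"
    proof (rule tendsto_0_le[where K = 1])
      have "(\<lambda>n. op_norm (x n - y n)) \<longlonglongrightarrow> 0" using xy by (simp add: uhf_rel_def)
      then show "(\<lambda>k. op_norm (x (m + 1 + k) - y (m + 1 + k))) \<longlonglongrightarrow> 0"
        using LIMSEQ_ignore_initial_segment[of "\<lambda>n. op_norm (x n - y n)" 0 "m + 1"]
        by (simp add: add.commute)
      show "\<forall>\<^sub>F k in sequentially. norm (?s x k $$ (i, j) - ?s y k $$ (i, j))
          \<le> norm (op_norm (x (m + 1 + k) - y (m + 1 + k))) * 1"
      proof (intro always_eventually allI)
        fix k
        have m: "x (m + 1 + k) \<in> M3 (m + 1 + k)" "y (m + 1 + k) \<in> M3 (m + 1 + k)"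
          using c[THEN uhf_cauchy_M3] by blast+
        have s: "?s x k \<in> M3 (m + 1)" "?s y k \<in> M3 (m + 1)"
          using slices_carrier m by blast+
        have "norm (?s x k $$ (i, j) - ?s y k $$ (i, j)) = cmod ((?s x k - ?s y k) $$ (i, j))"
          using s ij by simp
        also have "\<dots> \<le> op_norm (?s x k - ?s y k)"
          using s ij by (intro index_le_op_norm[where n = "3 ^ (m + 1)" and m = "3 ^ (m + 1)"] M3_minus)
        also have "?s x k - ?s y k = slices k (x (m + 1 + k) - y (m + 1 + k))"
          using m by (intro slices_minus[symmetric])
        also have "op_norm \<dots> \<le> op_norm (x (m + 1 + k) - y (m + 1 + k))"
          using m by (intro op_norm_slices[where n = "m + 1"] M3_minus)
        finally show "norm (?s x k $$ (i, j) - ?s y k $$ (i, j))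
          \<le> norm (op_norm (x (m + 1 + k) - y (m + 1 + k))) * 1" by simp
      qed
    qed
    moreover have "(\<lambda>k. ?s x k $$ (i, j)) \<longlonglongrightarrow> lim (\<lambda>k. ?s x k $$ (i, j))"
      using slices_entry_convergent[OF c(1) ij] by (simp add: convergent_LIMSEQ_iff)
    ultimately have "(\<lambda>k. ?s x k $$ (i, j) - (?s x k $$ (i, j) - ?s y k $$ (i, j)))
        \<longlonglongrightarrow> lim (\<lambda>k. ?s x k $$ (i, j)) - 0"
      by (intro tendsto_diff)
    then have "(\<lambda>k. ?s y k $$ (i, j)) \<longlonglongrightarrow> lim (\<lambda>k. ?s x k $$ (i, j))" by simp
    then show ?thesis by (rule limI[symmetric])
  qed
  then show "mat (3 ^ (m + 1)) (3 ^ (m + 1)) (\<lambda>(i, j). lim (\<lambda>k. ?s x k $$ (i, j))) =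
      mat (3 ^ (m + 1)) (3 ^ (m + 1)) (\<lambda>(i, j). lim (\<lambda>k. ?s y k $$ (i, j)))"
    by (intro eq_matI) auto
qed

lemma rho_abs_uhf: "uhf_cauchy x \<Longrightarrow> rho m (abs_uhf x) =
    mat (3 ^ (m + 1)) (3 ^ (m + 1)) (\<lambda>(i, j). lim (\<lambda>k. slices k (x (m + 1 + k)) $$ (i, j)))"
  by (rule rho.abs_eq[OF uhf_rel_refl])

lemma rho_M3 [intro]: "rho m X \<in> M3 (m + 1)"
  by (cases X rule: uhf_cases) (simp add: rho_abs_uhf)

lemma rho_tendsto:
  assumes x: "uhf_cauchy x" and ij: "i < 3 ^ (m + 1)" "j < 3 ^ (m + 1)"
  shows "(\<lambda>k. slices k (x (m + 1 + k)) $$ (i, j)) \<longlonglongrightarrow> rho m (abs_uhf x) $$ (i, j)"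
  using slices_entry_convergent[OF x ij] ij by (simp add: rho_abs_uhf[OF x] convergent_LIMSEQ_iff)

lemma rho_uhf_emb:
  assumes A: "A \<in> M3 (m + 1 + k)"
  shows "rho m (uhf_emb (m + 1 + k) A) = slices k A"
proof -
  let ?n = "m + 1 + k"
  let ?x = "\<lambda>q. if q < ?n then 0\<^sub>m (3 ^ q) (3 ^ q) else amp (q - ?n) A"
  have x: "uhf_cauchy ?x" by (rule uhf_cauchy_emb[OF A])
  have s: "slices k A \<in> M3 (m + 1)" by (rule slices_carrier[OF A])
  have "rho m (abs_uhf ?x) = slices k A"
  proof (rule eq_matI)
    fix i j assume "i < dim_row (slices k A)" "j < dim_col (slices k A)"
    then have ij: "i < 3 ^ (m + 1)" "j < 3 ^ (m + 1)" using s by auto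
    have "slices q (?x (m + 1 + q)) = slices k A" if "q \<ge> k" for q
    proof -
      define l where "l = q - k"
      have q: "q = k + l" using that by (simp add: l_def)
      have "slices (k + l) (amp l A) = slices k (slices l (amp l A))"
        by (simp add: funpow_add)
      then show ?thesis by (simp add: q slices_kron_one)
    qed
    then have "(\<lambda>q. slices q (?x (m + 1 + q)) $$ (i, j)) \<longlonglongrightarrow> slices k A $$ (i, j)"
      by (intro tendsto_eventually) (auto simp: eventually_sequentially intro!: exI[of _ k])
    with rho_tendsto[OF x ij] show "rho m (abs_uhf ?x) $$ (i, j) = slices k A $$ (i, j)"
      by (rule LIMSEQ_unique)
  qed (use s rho_M3[of m "abs_uhf ?x"] in auto)
  then show ?thesis unfolding uhf_emb_def .
qed

lemma op_norm_le_sum: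
  assumes A: "A \<in> carrier_mat n m"
  shows "op_norm A \<le> (\<Sum>i<n. \<Sum>j<m. cmod (A $$ (i, j)))"
  by (rule op_norm_leI[OF A]) (auto intro!: sum_nonneg vec_norm_mult_mat_bounded[OF A])

lemma op_norm_rho_le: "op_norm (rho m X) \<le> norm X"
proof -
  obtain x where x: "uhf_cauchy x" "X = abs_uhf x" by (rule uhf_cases)
  let ?n = "3 ^ (m + 1) :: nat"
  let ?s = "\<lambda>k. slices k (x (m + 1 + k))"
  have s: "?s k \<in> M3 (m + 1)" for k by (rule slices_M3[OF x(1)])
  have r: "rho m X \<in> M3 (m + 1)" by (rule rho_M3)
  have "(\<lambda>k. \<Sum>i<?n. \<Sum>j<?n. cmod (rho m X $$ (i, j) - ?s k $$ (i, j)))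
      \<longlonglongrightarrow> (\<Sum>i<?n. \<Sum>j<?n. cmod (rho m X $$ (i, j) - rho m X $$ (i, j)))"
    unfolding x(2) by (intro tendsto_intros rho_tendsto[OF x(1)]) auto
  moreover have "(\<lambda>k. op_norm (x (m + 1 + k))) \<longlonglongrightarrow> norm X"
    using LIMSEQ_ignore_initial_segment[OF norm_abs_uhf[OF x(1)], of "m + 1"] x(2)
    by (simp add: add.commute)
  ultimately have "(\<lambda>k. (\<Sum>i<?n. \<Sum>j<?n. cmod (rho m X $$ (i, j) - ?s k $$ (i, j))) + op_norm (x (m + 1 + k)))
      \<longlonglongrightarrow> (\<Sum>i<?n. \<Sum>j<?n. cmod (rho m X $$ (i, j) - rho m X $$ (i, j))) + norm X"
    by (rule tendsto_add)
  then have lim: "(\<lambda>k. (\<Sum>i<?n. \<Sum>j<?n. cmod (rho m X $$ (i, j) - ?s k $$ (i, j))) + op_norm (x (m + 1 + k)))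
      \<longlonglongrightarrow> norm X" by simp
  have "op_norm (rho m X) \<le> (\<Sum>i<?n. \<Sum>j<?n. cmod (rho m X $$ (i, j) - ?s k $$ (i, j))) + op_norm (x (m + 1 + k))"
    for k
  proof -
    have "rho m X = (rho m X - ?s k) + ?s k" using r s[of k] by (intro eq_matI) auto
    then have "op_norm (rho m X) \<le> op_norm (rho m X - ?s k) + op_norm (?s k)"
      using op_norm_triangle[OF M3_minus[OF r s[of k]] s[of k]] by simp
    also have "op_norm (rho m X - ?s k) \<le> (\<Sum>i<?n. \<Sum>j<?n. cmod ((rho m X - ?s k) $$ (i, j)))"
      by (rule op_norm_le_sum[OF M3_minus[OF r s[of k]]])
    also have "\<dots> = (\<Sum>i<?n. \<Sum>j<?n. cmod (rho m X $$ (i, j) - ?s k $$ (i, j)))"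
      using carrier_matD[OF s[of k]] by (intro sum.cong refl) simp
    also have "op_norm (?s k) \<le> op_norm (x (m + 1 + k))"
      by (rule op_norm_slices[OF uhf_cauchy_M3[OF x(1)]])
    finally show ?thesis by simp
  qed
  then show ?thesis by (intro LIMSEQ_le_const[OF lim]) blast
qed

lemma rho_add: "rho m (X + Y) = rho m X + rho m Y"
proof -
  obtain x where x: "uhf_cauchy x" "X = abs_uhf x" by (rule uhf_cases)
  obtain y where y: "uhf_cauchy y" "Y = abs_uhf y" by (rule uhf_cases)
  note xy = uhf_cauchy_add[OF x(1) y(1)]
  show ?thesis
    unfolding x(2) y(2) abs_uhf_add[OF x(1) y(1)]
  proof (rule eq_matI)
    fix i j assume "i < dim_row (rho m (abs_uhf x) + rho m (abs_uhf y))" "j < dim_col (rho m (abs_uhf x) + rho m (abs_uhf y))"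
    then have ij: "i < 3 ^ (m + 1)" "j < 3 ^ (m + 1)" using rho_M3[of m "abs_uhf y"] by auto
    have "slices k (x (m + 1 + k) + y (m + 1 + k)) $$ (i, j) =
        slices k (x (m + 1 + k)) $$ (i, j) + slices k (y (m + 1 + k)) $$ (i, j)" for k
      using slices_add[OF uhf_cauchy_M3[OF x(1)] uhf_cauchy_M3[OF y(1)], of k "m + 1"]
        carrier_matD[OF slices_M3[OF y(1), of k "m + 1"]] ij by simp
    then have "(\<lambda>k. slices k (x (m + 1 + k) + y (m + 1 + k)) $$ (i, j)) \<longlonglongrightarrow>
        rho m (abs_uhf x) $$ (i, j) + rho m (abs_uhf y) $$ (i, j)"
      using tendsto_add[OF rho_tendsto[OF x(1) ij] rho_tendsto[OF y(1) ij]] by simp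
    with rho_tendsto[OF xy ij] have "rho m (abs_uhf (\<lambda>n. x n + y n)) $$ (i, j) =
        rho m (abs_uhf x) $$ (i, j) + rho m (abs_uhf y) $$ (i, j)"
      by (rule LIMSEQ_unique)
    then show "rho m (abs_uhf (\<lambda>n. x n + y n)) $$ (i, j) = (rho m (abs_uhf x) + rho m (abs_uhf y)) $$ (i, j)"
      using carrier_matD[OF rho_M3[of m "abs_uhf y"]] ij by simp
  qed (use rho_M3[of m "abs_uhf (\<lambda>n. x n + y n)"] rho_M3[of m "abs_uhf y"] in auto)
qed

lemma rho_scaleC: "rho m (a *\<^sub>C X) = a \<cdot>\<^sub>m rho m X"
proof -
  obtain x where x: "uhf_cauchy x" "X = abs_uhf x" by (rule uhf_cases)
  note ax = uhf_cauchy_smult[OF x(1), of a]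
  show ?thesis
    unfolding x(2) abs_uhf_scaleC[OF x(1)]
  proof (rule eq_matI)
    fix i j assume "i < dim_row (a \<cdot>\<^sub>m rho m (abs_uhf x))" "j < dim_col (a \<cdot>\<^sub>m rho m (abs_uhf x))"
    then have ij: "i < 3 ^ (m + 1)" "j < 3 ^ (m + 1)" using rho_M3[of m "abs_uhf x"] by auto
    have "slices k (a \<cdot>\<^sub>m x (m + 1 + k)) $$ (i, j) = a * slices k (x (m + 1 + k)) $$ (i, j)" for k
      using slices_smult[OF uhf_cauchy_M3[OF x(1)], of k a "m + 1"]
        carrier_matD[OF slices_M3[OF x(1), of k "m + 1"]] ij by simp
    then have "(\<lambda>k. slices k (a \<cdot>\<^sub>m x (m + 1 + k)) $$ (i, j)) \<longlonglongrightarrow> a * rho m (abs_uhf x) $$ (i, j)"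
      using tendsto_mult_left[OF rho_tendsto[OF x(1) ij], of a] by simp
    with rho_tendsto[OF ax ij] have "rho m (abs_uhf (\<lambda>n. a \<cdot>\<^sub>m x n)) $$ (i, j) = a * rho m (abs_uhf x) $$ (i, j)"
      by (rule LIMSEQ_unique)
    then show "rho m (abs_uhf (\<lambda>n. a \<cdot>\<^sub>m x n)) $$ (i, j) = (a \<cdot>\<^sub>m rho m (abs_uhf x)) $$ (i, j)"
      using carrier_matD[OF rho_M3[of m "abs_uhf x"]] ij by simp
  qed (use rho_M3[of m "abs_uhf (\<lambda>n. a \<cdot>\<^sub>m x n)"] rho_M3[of m "abs_uhf x"] in auto)
qed

subsection \<open>The algebras \<open>A_fin n\<close> and \<open>A_inf\<close>\<close>

text \<open>Matrix units for indices 1, 2, 3 read modulo 3; index i sits at the 0-based position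
  (i + 2) mod 3 = (i - 1) mod 3.\<close>

definition mat_e :: "nat \<Rightarrow> nat \<Rightarrow> complex mat" where
  "mat_e i j = mat 3 3 (\<lambda>(p, q). if p = (i + 2) mod 3 \<and> q = (j + 2) mod 3 then 1 else 0)"

lemma mat_e_carrier [simp]: "mat_e i j \<in> carrier_mat 3 3"
  by (simp add: mat_e_def)

fun kron_pow :: "complex mat \<Rightarrow> nat \<Rightarrow> complex mat" where
  "kron_pow A 0 = 1\<^sub>m 1"
| "kron_pow A (Suc n) = kron_pow A n \<otimes>\<^sub>k A"

definition alpha :: "nat \<Rightarrow> nat \<Rightarrow> complex mat" where
  "alpha n j = mat_e j j \<otimes>\<^sub>k kron_pow (mat_e 2 2) n"

definition beta :: "nat \<Rightarrow> nat \<Rightarrow> complex mat" where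
  "beta k j = (mat_e j j \<otimes>\<^sub>k mat_e 1 1 + mat_e (j + 2) (j + 2) \<otimes>\<^sub>k mat_e 3 3) \<otimes>\<^sub>k kron_pow (mat_e 2 2) (k - 1)"

definition A_gens :: "nat \<Rightarrow> complex mat set" where
  "A_gens n = {alpha n j | j. j \<in> {1, 2, 3}} \<union>
     {x \<otimes>\<^sub>k beta k j | x k j. j \<in> {1, 2, 3} \<and> k \<in> {1..n} \<and> x \<in> M3 (n - k)}"

text \<open>The complex linear span, inside the vector space of all matrices of size 3 to the n + 1.\<close>

definition A_fin :: "nat \<Rightarrow> complex mat set" where
  "A_fin n = LinearCombinations.module.span class_ring
     (module_mat TYPE(complex) (3 ^ (n + 1)) (3 ^ (n + 1))) (A_gens n)"

definition A_inf :: "uhf set" where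
  "A_inf = {a. \<exists>x. (\<forall>n. x n \<in> A_fin n) \<and> (\<lambda>n. uhf_emb (n + 1) (x n)) \<longlonglongrightarrow> a}"

lemma kron_pow_carrier: "A \<in> carrier_mat 3 3 \<Longrightarrow> kron_pow A n \<in> M3 n"
proof (induction n)
  case (Suc n)
  then have "kron_pow A n \<otimes>\<^sub>k A \<in> carrier_mat (3 ^ n * 3) (3 ^ n * 3)" by blast
  then show ?case by (simp add: mult.commute)
qed simp

lemma alpha_M3: "alpha n j \<in> M3 (n + 1)"
  using kron_carrier[OF mat_e_carrier[of j j] kron_pow_carrier[OF mat_e_carrier[of 2 2], of n]]
  by (simp add: alpha_def)

lemma beta_M3:
  assumes "1 \<le> k"
  shows "beta k j \<in> M3 (k + 1)"
proof -
  have "mat_e i i \<otimes>\<^sub>k mat_e l l \<in> carrier_mat (3 * 3) (3 * 3)" for i l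
    by (rule kron_carrier[OF mat_e_carrier mat_e_carrier])
  then have "beta k j \<in> carrier_mat (3 * 3 * 3 ^ (k - 1)) (3 * 3 * 3 ^ (k - 1))"
    unfolding beta_def by (intro kron_carrier[OF _ kron_pow_carrier[OF mat_e_carrier]] add_carrier_mat)
  moreover have "3 * 3 * 3 ^ (k - 1) = (3 :: nat) ^ (k + 1)"
    using assms by (cases k) auto
  ultimately show ?thesis by (simp only:)
qed

lemma A_gens_M3: "A_gens n \<subseteq> M3 (n + 1)"
proof -
  have "x \<otimes>\<^sub>k beta k j \<in> M3 (n + 1)" if "k \<in> {1..n}" "x \<in> M3 (n - k)" for x k j
  proof -
    have "x \<otimes>\<^sub>k beta k j \<in> carrier_mat (3 ^ (n - k) * 3 ^ (k + 1)) (3 ^ (n - k) * 3 ^ (k + 1))"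
      using that by (intro kron_carrier beta_M3) auto
    moreover have "3 ^ (n - k) * 3 ^ (k + 1) = (3 :: nat) ^ (n + 1)"
      using that by (subst power_add[symmetric]) simp
    ultimately show ?thesis by (simp only:)
  qed
  then show ?thesis by (auto simp: A_gens_def alpha_M3[simplified])
qed

lemma A_fin_M3: "A_fin n \<subseteq> M3 (n + 1)"
proof -
  interpret matrix_vs "3 ^ (n + 1)" "3 ^ (n + 1)" "TYPE(complex)" .
  show ?thesis unfolding A_fin_def by (rule span_is_subset2) (rule A_gens_M3)
qed

end

theory Submission
  imports Defs
begin

text \<open>Elements of \<open>A_fin n\<close> are block diagonal in the last tensor factor, and those of
  \<open>A_fin (n + 1)\<close> are exactly the sums of \<open>A \<otimes> e\<^sub>2\<^sub>2\<close> with \<open>A\<close> in \<open>A_fin n\<close> and of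
  \<open>t\<^sub>j \<otimes> \<beta>\<^sup>1\<^sub>j\<close> with arbitrary \<open>t\<^sub>j\<close>; slicing off the last factor returns \<open>A\<close>. Hence the slices of an
  approximating sequence of an element of \<open>A_inf\<close> lie in the closed set \<open>A_fin m\<close>. Conversely, regard
  \<open>A_fin n\<close> as a noncommutative version of the functions on the vertices of the n-th Sierpinski graph and
  extend \<open>A\<close> to the new vertices by averaging its diagonal blocks at the two neighbours. This halves
  the maximal distance between the diagonal blocks, which also bounds the distance of the extension
  from \<open>A \<otimes> 1\<close>. Iterated extensions therefore converge in norm, and the limit is a preimage of \<open>A\<close>.\<close>

subsection \<open>The recursive structure of \<open>A_fin n\<close>\<close>

text \<open>Transfers the submodule laws of the span from the record \<open>module_mat\<close> to
  the plain matrix operations.\<close>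

lemma A_fin_closed:
  shows A_fin_zero: "0\<^sub>m (3 ^ (n + 1)) (3 ^ (n + 1)) \<in> A_fin n"
    and A_fin_add: "A \<in> A_fin n \<Longrightarrow> B \<in> A_fin n \<Longrightarrow> A + B \<in> A_fin n"
    and A_fin_smult: "A \<in> A_fin n \<Longrightarrow> c \<cdot>\<^sub>m A \<in> A_fin n"
    and A_gens_subset_A_fin: "A_gens n \<subseteq> A_fin n"
proof -
  interpret matrix_vs "3 ^ (n + 1)" "3 ^ (n + 1)" "TYPE(complex)" .
  interpret S: submodule class_ring "A_fin n" "module_mat TYPE(complex) (3 ^ (n + 1)) (3 ^ (n + 1))"
    unfolding A_fin_def by (rule span_is_submodule) (use A_gens_M3 in \<open>simp add: module_mat_simps\<close>)
  show "0\<^sub>m (3 ^ (n + 1)) (3 ^ (n + 1)) \<in> A_fin n"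
    using S.zero_closed by (simp add: module_mat_simps)
  show "A \<in> A_fin n \<Longrightarrow> B \<in> A_fin n \<Longrightarrow> A + B \<in> A_fin n"
    using S.m_closed[of A B] by (simp add: module_mat_simps)
  show "A \<in> A_fin n \<Longrightarrow> c \<cdot>\<^sub>m A \<in> A_fin n"
    using S.smult_closed[of c A] by (simp add: module_mat_simps class_ring_simps)
  show "A_gens n \<subseteq> A_fin n"
    unfolding A_fin_def by (rule in_own_span) (use A_gens_M3 in \<open>simp add: module_mat_simps\<close>)
qed

text \<open>Minimality of the span. It replaces explicit linear combinations: a property of all of
  \<open>A_fin n\<close> is checked on the generators and under the vector space operations.\<close>

lemma A_fin_subset:
  assumes gens: "A_gens n \<subseteq> N" and N: "N \<subseteq> M3 (n + 1)"
    and zero: "0\<^sub>m (3 ^ (n + 1)) (3 ^ (n + 1)) \<in> N"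
    and add: "\<And>A B. A \<in> N \<Longrightarrow> B \<in> N \<Longrightarrow> A + B \<in> N"
    and smult: "\<And>c A. A \<in> N \<Longrightarrow> c \<cdot>\<^sub>m A \<in> N"
  shows "A_fin n \<subseteq> N"
proof -
  interpret matrix_vs "3 ^ (n + 1)" "3 ^ (n + 1)" "TYPE(complex)" .
  have "submodule class_ring N (module_mat TYPE(complex) (3 ^ (n + 1)) (3 ^ (n + 1)))"
    by unfold_locales (use N zero add smult in \<open>auto simp: module_mat_simps class_ring_simps\<close>)
  then show ?thesis unfolding A_fin_def by (intro span_is_subset[OF gens])
qed

section \<open>Block-diagonal matrices\<close>

text \<open>The last tensor factor is the least significant digit, so block p collects the entries
  whose row and column indices are both p mod 3. Being a \<open>slice_last\<close>, it is for p = 1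
  the slice by \<open>e22_state\<close>.\<close>

definition diag_block :: "nat \<Rightarrow> complex mat \<Rightarrow> complex mat" where
  "diag_block p = slice_last (\<lambda>M. M $$ (p, p))"

text \<open>The sum over p of \<open>c p\<close> tensored with the diagonal matrix unit at 0-based
  position p; the three blocks are interleaved, not contiguous.\<close>

definition block_diag :: "nat \<Rightarrow> (nat \<Rightarrow> complex mat) \<Rightarrow> complex mat" where
  "block_diag n c = mat (3 ^ (n + 1)) (3 ^ (n + 1)) (\<lambda>(i, j).
     if i mod 3 = j mod 3 then c (i mod 3) $$ (i div 3, j div 3) else 0)"

text \<open>This is \<open>A \<otimes> e\<^sub>2\<^sub>2 + (\<Sum>j. t\<^sub>j \<otimes> \<beta>\<^sup>1\<^sub>j)\<close>, with blocks and \<open>t\<close> indexed by the 0-based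
  position \<open>j - 1\<close>. The shift in the last block comes from the summand \<open>e\<^bsub>j+2,j+2\<^esub> \<otimes> e\<^sub>3\<^sub>3\<close> of \<open>\<beta>\<^sup>1\<^sub>j\<close>.\<close>

definition glue :: "nat \<Rightarrow> complex mat \<Rightarrow> (nat \<Rightarrow> complex mat) \<Rightarrow> complex mat" where
  "glue n A t = block_diag (n + 1) (\<lambda>p. if p = 0 then block_diag n t else if p = 1 then A
     else block_diag n (\<lambda>q. t ((q + 1) mod 3)))"

lemma diag_block_M3 [intro]: "A \<in> M3 (n + 1) \<Longrightarrow> diag_block p A \<in> M3 n"
  unfolding diag_block_def by (rule slice_last_carrier) simp

lemma slice_last_e22_eq_diag_block: "slice_last e22_state = diag_block 1"
  by (simp add: diag_block_def e22_state_def[abs_def])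

lemma index_diag_block:
  assumes "A \<in> M3 (n + 1)" "p < 3" "i < 3 ^ n" "j < 3 ^ n"
  shows "diag_block p A $$ (i, j) = A $$ (3 * i + p, 3 * j + p)"
  using assms by (auto simp: diag_block_def slice_last_def)

lemma block_diag_M3: "block_diag n c \<in> M3 (n + 1)"
  by (simp add: block_diag_def)

lemma block_diag_carrier_iff [simp]:
  "block_diag n c \<in> carrier_mat a b \<longleftrightarrow> a = 3 ^ (n + 1) \<and> b = 3 ^ (n + 1)"
  by (auto simp: block_diag_def)

lemma glue_M3 [simp]: "glue n A t \<in> M3 (n + 2)"
  using block_diag_M3[of "n + 1"] by (simp add: glue_def)

lemma dim_block_diag [simp]:
  "dim_row (block_diag n c) = 3 ^ (n + 1)" "dim_col (block_diag n c) = 3 ^ (n + 1)"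
  by (simp_all add: block_diag_def)

lemma index_block_diag:
  "i < 3 ^ (n + 1) \<Longrightarrow> j < 3 ^ (n + 1) \<Longrightarrow> block_diag n c $$ (i, j) =
    (if i mod 3 = j mod 3 then c (i mod 3) $$ (i div 3, j div 3) else 0)"
  by (simp add: block_diag_def)

lemma block_diag_cong:
  assumes "n = n'" "\<And>p. p < 3 \<Longrightarrow> c p = c' p"
  shows "block_diag n c = block_diag n' c'"
  using assms by (intro eq_matI) (auto simp: index_block_diag simp del: power_Suc)

lemma diag_block_block_diag:
  assumes "p < 3" "c p \<in> M3 n"
  shows "diag_block p (block_diag n c) = c p"
proof (rule eq_matI)
  fix i j assume "i < dim_row (c p)" "j < dim_col (c p)"
  with assms have ij: "i < 3 ^ n" "j < 3 ^ n" by auto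
  then have "3 * i + p < 3 ^ (n + 1)" "3 * j + p < 3 ^ (n + 1)" using assms by auto
  with ij assms show "diag_block p (block_diag n c) $$ (i, j) = c p $$ (i, j)"
    using index_diag_block[OF block_diag_M3 assms(1) ij]
    by (simp add: index_block_diag del: power_Suc)
qed (use assms diag_block_M3[OF block_diag_M3[of n c], of p] in auto)

lemma block_diag_add:
  assumes "\<And>p. p < 3 \<Longrightarrow> c p \<in> M3 n" "\<And>p. p < 3 \<Longrightarrow> d p \<in> M3 n"
  shows "block_diag n c + block_diag n d = block_diag n (\<lambda>p. c p + d p)"
proof (rule eq_matI)
  fix i j assume "i < dim_row (block_diag n (\<lambda>p. c p + d p))" "j < dim_col (block_diag n (\<lambda>p. c p + d p))"
  then have ij: "i < 3 ^ (n + 1)" "j < 3 ^ (n + 1)" by simp_all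
  then have "i div 3 < 3 ^ n" "j div 3 < 3 ^ n" by auto
  then show "(block_diag n c + block_diag n d) $$ (i, j) = block_diag n (\<lambda>p. c p + d p) $$ (i, j)"
    using ij assms[of "i mod 3"] by (auto simp: index_block_diag simp del: power_Suc)
qed auto

lemma block_diag_smult:
  assumes "\<And>p. p < 3 \<Longrightarrow> c p \<in> M3 n"
  shows "a \<cdot>\<^sub>m block_diag n c = block_diag n (\<lambda>p. a \<cdot>\<^sub>m c p)"
proof (rule eq_matI)
  fix i j assume "i < dim_row (block_diag n (\<lambda>p. a \<cdot>\<^sub>m c p))" "j < dim_col (block_diag n (\<lambda>p. a \<cdot>\<^sub>m c p))"
  then have ij: "i < 3 ^ (n + 1)" "j < 3 ^ (n + 1)" by simp_all
  then have "i div 3 < 3 ^ n" "j div 3 < 3 ^ n" by auto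
  then show "(a \<cdot>\<^sub>m block_diag n c) $$ (i, j) = block_diag n (\<lambda>p. a \<cdot>\<^sub>m c p) $$ (i, j)"
    using ij assms[of "i mod 3"] by (auto simp: index_block_diag simp del: power_Suc)
qed auto

lemma block_diag_minus:
  assumes "\<And>p. p < 3 \<Longrightarrow> c p \<in> M3 n" "\<And>p. p < 3 \<Longrightarrow> d p \<in> M3 n"
  shows "block_diag n c - block_diag n d = block_diag n (\<lambda>p. c p - d p)"
proof (rule eq_matI)
  fix i j assume "i < dim_row (block_diag n (\<lambda>p. c p - d p))" "j < dim_col (block_diag n (\<lambda>p. c p - d p))"
  then have ij: "i < 3 ^ (n + 1)" "j < 3 ^ (n + 1)" by simp_all
  then have "i div 3 < 3 ^ n" "j div 3 < 3 ^ n" by auto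
  then show "(block_diag n c - block_diag n d) $$ (i, j) = block_diag n (\<lambda>p. c p - d p) $$ (i, j)"
    using ij assms[of "i mod 3"] by (auto simp: index_block_diag simp del: power_Suc)
qed auto

lemma amp_1_eq_block_diag:
  assumes "A \<in> M3 n"
  shows "amp 1 A = block_diag n (\<lambda>_. A)"
proof (rule eq_matI)
  fix i j assume "i < dim_row (block_diag n (\<lambda>_. A))" "j < dim_col (block_diag n (\<lambda>_. A))"
  then have ij: "i < 3 ^ (n + 1)" "j < 3 ^ (n + 1)" by simp_all
  then show "amp 1 A $$ (i, j) = block_diag n (\<lambda>_. A) $$ (i, j)"
    using assms by (subst index_kron) (auto simp: index_block_diag simp del: power_Suc)
qed (use assms in auto)

text \<open>Vectors supported on one residue class mod 3 form three orthogonal subspaces; the matrix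
  preserves each and acts on the q-th one as \<open>c q\<close>. Pythagoras then gives the
  bound.\<close>

lemma op_norm_block_diag_le:
  assumes c: "\<And>p. p < 3 \<Longrightarrow> c p \<in> M3 n" and M: "\<And>p. p < 3 \<Longrightarrow> op_norm (c p) \<le> M"
  shows "op_norm (block_diag n c) \<le> M"
proof (rule op_norm_leI[OF block_diag_M3])
  let ?N = "3 ^ n :: nat" and ?A = "block_diag n c"
  show M0: "0 \<le> M" using M[of 0] op_norm_nonneg[of "c 0"] by linarith
  fix v :: "complex vec" assume v: "v \<in> carrier_vec (3 ^ (n + 1))"
  define w where "w q = vec ?N (\<lambda>i. v $ (i * 3 + q))" for q
  have w: "w q \<in> carrier_vec ?N" for q by (simp add: w_def)
  have comp: "(?A *\<^sub>v v) $ (i * 3 + q) = (c q *\<^sub>v w q) $ i" if iq: "i < ?N" "q < 3" for i q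
  proof -
    have lt: "i * 3 + q < 3 ^ (n + 1)" using iq by simp
    then have "(?A *\<^sub>v v) $ (i * 3 + q) = (\<Sum>k<?N * 3. ?A $$ (i * 3 + q, k) * v $ k)"
      using v by (auto simp: scalar_prod_def atLeast0LessThan mult.commute)
    \<comment> \<open>Written through quotient and remainder so that \<open>sum_div_mod\<close>
      applies; only the remainder p = q survives.\<close>
    also have "\<dots> = (\<Sum>k<?N * 3. (\<lambda>j p. if p = q then c q $$ (i, j) * v $ (j * 3 + q) else 0) (k div 3) (k mod 3))"
    proof (rule sum.cong[OF refl])
      fix k assume "k \<in> {..<?N * 3}"
      then have "k < 3 ^ (n + 1)" by simp
      then show "?A $$ (i * 3 + q, k) * v $ k =
          (\<lambda>j p. if p = q then c q $$ (i, j) * v $ (j * 3 + q) else 0) (k div 3) (k mod 3)"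
        using lt iq div_mult_mod_eq[of k 3] by (auto simp: index_block_diag simp del: power_Suc)
    qed
    also have "\<dots> = (\<Sum>j<?N. \<Sum>p<3. if p = q then c q $$ (i, j) * v $ (j * 3 + q) else 0)"
      by (rule sum_div_mod)
    also have "\<dots> = (\<Sum>j<?N. c q $$ (i, j) * v $ (j * 3 + q))" using iq by simp
    also have "\<dots> = (c q *\<^sub>v w q) $ i"
      using c[OF iq(2)] iq by (auto simp: scalar_prod_def atLeast0LessThan w_def)
    finally show ?thesis .
  qed
  have split: "(vec_norm u)\<^sup>2 = (\<Sum>q<3. \<Sum>i<?N. (cmod (u $ (i * 3 + q)))\<^sup>2)"
    if "u \<in> carrier_vec (3 ^ (n + 1))" for u
  proof -
    have "(vec_norm u)\<^sup>2 = (\<Sum>l<?N * 3. (\<lambda>i q. (cmod (u $ (i * 3 + q)))\<^sup>2) (l div 3) (l mod 3))"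
      unfolding vec_norm_power2 using that by (auto intro!: sum.cong simp: mult.commute)
    also have "\<dots> = (\<Sum>i<?N. \<Sum>q<3. (cmod (u $ (i * 3 + q)))\<^sup>2)" by (rule sum_div_mod)
    also have "\<dots> = (\<Sum>q<3. \<Sum>i<?N. (cmod (u $ (i * 3 + q)))\<^sup>2)" by (rule sum.swap)
    finally show ?thesis .
  qed
  have "(vec_norm (?A *\<^sub>v v))\<^sup>2 = (\<Sum>q<3. \<Sum>i<?N. (cmod ((?A *\<^sub>v v) $ (i * 3 + q)))\<^sup>2)"
    by (intro split carrier_vecI) simp
  also have "\<dots> = (\<Sum>q<3. (vec_norm (c q *\<^sub>v w q))\<^sup>2)"
  proof (rule sum.cong[OF refl])
    fix q :: nat assume "q \<in> {..<3}"
    then have q: "q < 3" by simp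
    show "(\<Sum>i<?N. (cmod ((?A *\<^sub>v v) $ (i * 3 + q)))\<^sup>2) = (vec_norm (c q *\<^sub>v w q))\<^sup>2"
      using c[OF q] comp[OF _ q] by (simp add: vec_norm_power2 del: index_mult_mat_vec)
  qed
  also have "\<dots> \<le> (\<Sum>q<3. (M * vec_norm (w q))\<^sup>2)"
  proof (intro sum_mono power_mono)
    fix q :: nat assume "q \<in> {..<3}"
    then have q: "q < 3" by simp
    have "vec_norm (c q *\<^sub>v w q) \<le> op_norm (c q) * vec_norm (w q)"
      by (rule vec_norm_le_op_norm[OF c[OF q] w])
    also have "\<dots> \<le> M * vec_norm (w q)" using M[OF q] by (intro mult_right_mono) auto
    finally show "vec_norm (c q *\<^sub>v w q) \<le> M * vec_norm (w q)" .
  qed simp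
  also have "\<dots> = M\<^sup>2 * (\<Sum>q<3. (vec_norm (w q))\<^sup>2)"
    by (simp add: power_mult_distrib sum_distrib_left)
  also have "(\<Sum>q<3. (vec_norm (w q))\<^sup>2) = (vec_norm v)\<^sup>2"
    unfolding split[OF v] by (auto simp: vec_norm_power2 w_def intro!: sum.cong)
  finally have "(vec_norm (?A *\<^sub>v v))\<^sup>2 \<le> (M * vec_norm v)\<^sup>2"
    by (simp add: power_mult_distrib)
  then show "vec_norm (?A *\<^sub>v v) \<le> M * vec_norm v"
    by (rule power2_le_imp_le) (use M0 in simp)
qed

lemma block_diag_zero [simp]:
  "block_diag n (\<lambda>_. 0\<^sub>m (3 ^ n) (3 ^ n)) = 0\<^sub>m (3 ^ (n + 1)) (3 ^ (n + 1))"
proof (rule eq_matI)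
  fix i j :: nat
  assume "i < dim_row (0\<^sub>m (3 ^ (n + 1)) (3 ^ (n + 1)) :: complex mat)"
    "j < dim_col (0\<^sub>m (3 ^ (n + 1)) (3 ^ (n + 1)) :: complex mat)"
  then have "i < 3 ^ (n + 1)" "j < 3 ^ (n + 1)" by simp_all
  moreover from this have "i div 3 < 3 ^ n" "j div 3 < 3 ^ n" by auto
  ultimately show "block_diag n (\<lambda>_. 0\<^sub>m (3 ^ n) (3 ^ n)) $$ (i, j) =
      0\<^sub>m (3 ^ (n + 1)) (3 ^ (n + 1)) $$ (i, j)"
    by (simp add: index_block_diag del: power_Suc)
qed simp_all

section \<open>Gluing and tensor products with matrix units\<close>

lemma kron_mat_e_eq_block_diag:
  assumes "A \<in> M3 n"
  shows "A \<otimes>\<^sub>k mat_e j j = block_diag n (\<lambda>p. if p = (j + 2) mod 3 then A else 0\<^sub>m (3 ^ n) (3 ^ n))"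
    (is "_ = ?B")
proof (rule eq_matI)
  fix i k assume "i < dim_row ?B" "k < dim_col ?B"
  then have ik: "i < 3 ^ (n + 1)" "k < 3 ^ (n + 1)" by simp_all
  then have "i div 3 < 3 ^ n" "k div 3 < 3 ^ n" by auto
  with ik show "(A \<otimes>\<^sub>k mat_e j j) $$ (i, k) = ?B $$ (i, k)"
    using assms by (subst index_kron) (auto simp: index_block_diag mat_e_def simp del: power_Suc)
qed (use assms in \<open>auto simp: mat_e_def\<close>)

lemma kron_add_right:
  assumes "B \<in> carrier_mat a b" "B' \<in> carrier_mat a b"
  shows "A \<otimes>\<^sub>k (B + B') = A \<otimes>\<^sub>k B + A \<otimes>\<^sub>k B'"
  using assms by (intro eq_matI) (auto simp: div_mod_less_mult algebra_simps)

lemma glue_cong: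
  assumes "\<And>q. q < 3 \<Longrightarrow> t q = t' q"
  shows "glue n A t = glue n A t'"
proof -
  have "block_diag n t = block_diag n t'" by (rule block_diag_cong) (auto intro: assms)
  moreover have "block_diag n (\<lambda>q. t ((q + 1) mod 3)) = block_diag n (\<lambda>q. t' ((q + 1) mod 3))"
    by (rule block_diag_cong) (auto intro: assms)
  ultimately show ?thesis by (simp only: glue_def)
qed

lemma glue_add:
  assumes "A \<in> M3 (n + 1)" "B \<in> M3 (n + 1)" "\<And>q. q < 3 \<Longrightarrow> t q \<in> M3 n" "\<And>q. q < 3 \<Longrightarrow> s q \<in> M3 n"
  shows "glue n A t + glue n B s = glue n (A + B) (\<lambda>q. t q + s q)"
  unfolding glue_def
  by (subst block_diag_add) (use assms in \<open>auto intro!: block_diag_cong simp: block_diag_add simp del: power_Suc\<close>)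

lemma glue_smult:
  assumes "A \<in> M3 (n + 1)" "\<And>q. q < 3 \<Longrightarrow> t q \<in> M3 n"
  shows "c \<cdot>\<^sub>m glue n A t = glue n (c \<cdot>\<^sub>m A) (\<lambda>q. c \<cdot>\<^sub>m t q)"
  unfolding glue_def
  by (subst block_diag_smult) (use assms in \<open>auto intro!: block_diag_cong simp: block_diag_smult simp del: power_Suc\<close>)

lemma glue_zero:
  "glue n (0\<^sub>m (3 ^ (n + 1)) (3 ^ (n + 1))) (\<lambda>_. 0\<^sub>m (3 ^ n) (3 ^ n)) = 0\<^sub>m (3 ^ (n + 2)) (3 ^ (n + 2))"
  using block_diag_zero[of "n + 1"] by (simp only: glue_def block_diag_zero if_cancel) (simp del: power_Suc)

lemma diag_block_glue:
  assumes "A \<in> M3 (n + 1)"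
  shows "diag_block 0 (glue n A t) = block_diag n t"
    and "diag_block 1 (glue n A t) = A"
    and "diag_block 2 (glue n A t) = block_diag n (\<lambda>q. t ((q + 1) mod 3))"
  using block_diag_M3[of n t] block_diag_M3[of n "\<lambda>q. t ((q + 1) mod 3)"] assms
  by (auto simp: glue_def diag_block_block_diag)

lemma kron_e22_eq_glue:
  assumes "A \<in> M3 (n + 1)"
  shows "A \<otimes>\<^sub>k mat_e 2 2 = glue n A (\<lambda>_. 0\<^sub>m (3 ^ n) (3 ^ n))"
  unfolding kron_mat_e_eq_block_diag[OF assms] glue_def
  by (rule block_diag_cong) (auto simp del: power_Suc)

lemma kron_beta_1_eq_glue:
  assumes x: "x \<in> M3 n" and j: "j \<in> {1, 2, 3}"
  shows "x \<otimes>\<^sub>k beta 1 j = glue n (0\<^sub>m (3 ^ (n + 1)) (3 ^ (n + 1)))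
    (\<lambda>q. if q = (j + 2) mod 3 then x else 0\<^sub>m (3 ^ n) (3 ^ n))"
proof -
  let ?d = "\<lambda>j p. if p = (j + 2) mod 3 then x else 0\<^sub>m (3 ^ n) (3 ^ n)"
  let ?Z = "0\<^sub>m (3 ^ (n + 1)) (3 ^ (n + 1)) :: complex mat"
  have m: "mat_e i i \<otimes>\<^sub>k mat_e l l \<in> carrier_mat (3 * 3) (3 * 3)" for i l
    by (rule kron_carrier[OF mat_e_carrier mat_e_carrier])
  have "x \<otimes>\<^sub>k beta 1 j =
      x \<otimes>\<^sub>k (mat_e j j \<otimes>\<^sub>k mat_e 1 1) + x \<otimes>\<^sub>k (mat_e (j + 2) (j + 2) \<otimes>\<^sub>k mat_e 3 3)"
    using kron_add_right[OF m[of j 1] m[of "j + 2" 3]] by (simp add: beta_def)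
  also have "\<dots> = block_diag n (?d j) \<otimes>\<^sub>k mat_e 1 1 + block_diag n (?d (j + 2)) \<otimes>\<^sub>k mat_e 3 3"
    by (simp only: kron_assoc[symmetric] kron_mat_e_eq_block_diag[OF x])
  also have "\<dots> = block_diag (n + 1) (\<lambda>p. (if p = (1 + 2) mod 3 then block_diag n (?d j) else ?Z)
      + (if p = (3 + 2) mod 3 then block_diag n (?d (j + 2)) else ?Z))"
    unfolding kron_mat_e_eq_block_diag[OF block_diag_M3]
    by (rule block_diag_add) (simp_all del: power_Suc)
  also have "\<dots> = glue n ?Z (?d j)"
    unfolding glue_def
  proof (rule block_diag_cong[OF refl])
    fix p :: nat assume "p < 3"
    then have "p = 0 \<or> p = 1 \<or> p = 2" by auto
    \<comment> \<open>Index j + 2 sits cyclically one position before index j, so q is the position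
      of j + 2 exactly when q + 1 is that of j. This is the shift built into
      \<open>glue\<close>.\<close>
    moreover have "block_diag n (?d (j + 2)) = block_diag n (\<lambda>q. ?d j ((q + 1) mod 3))"
    proof (rule block_diag_cong[OF refl])
      fix q :: nat assume "q < 3"
      then have "q = 0 \<or> q = 1 \<or> q = 2" by auto
      moreover have "j = 1 \<or> j = 2 \<or> j = 3" using j by simp
      ultimately have "q = (j + 2 + 2) mod 3 \<longleftrightarrow> (q + 1) mod 3 = (j + 2) mod 3"
        by (elim disjE) simp_all
      then show "?d (j + 2) q = ?d j ((q + 1) mod 3)" by (simp only:)
    qed
    moreover have "block_diag n c + ?Z = block_diag n c" "?Z + block_diag n c = block_diag n c" for c
      by (simp_all del: power_Suc)
    ultimately show "(if p = (1 + 2) mod 3 then block_diag n (?d j) else ?Z)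
      + (if p = (3 + 2) mod 3 then block_diag n (?d (j + 2)) else ?Z) =
      (if p = 0 then block_diag n (?d j) else if p = 1 then ?Z else block_diag n (\<lambda>q. ?d j ((q + 1) mod 3)))"
      by (auto simp del: power_Suc)
  qed
  finally show ?thesis .
qed

section \<open>Passing from level n to level n + 1\<close>

lemma alpha_Suc: "alpha (Suc n) j = alpha n j \<otimes>\<^sub>k mat_e 2 2"
  by (simp add: alpha_def kron_assoc)

text \<open>The recursion starts at k = 1: truncated subtraction makes \<open>beta 0 j\<close> equal
  to \<open>beta 1 j\<close>.\<close>

lemma beta_Suc: "1 \<le> k \<Longrightarrow> beta (Suc k) j = beta k j \<otimes>\<^sub>k mat_e 2 2"
  by (cases k) (simp_all add: beta_def kron_assoc)

text \<open>Tensoring with \<open>mat_e 2 2\<close> raises n in \<open>alpha\<close> and k in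
  \<open>beta\<close> by one and leaves n - k, hence the range of x, unchanged. So generators go to
  generators, and minimality of the span, applied to the preimage of \<open>A_fin (n + 1)\<close>,
  does the rest.\<close>

lemma kron_e22_A_fin:
  assumes "A \<in> A_fin n"
  shows "A \<otimes>\<^sub>k mat_e 2 2 \<in> A_fin (n + 1)"
proof -
  have "A_fin n \<subseteq> {A \<in> M3 (n + 1). A \<otimes>\<^sub>k mat_e 2 2 \<in> A_fin (n + 1)}"
  proof (rule A_fin_subset)
    have "A \<otimes>\<^sub>k mat_e 2 2 \<in> A_gens (n + 1)" if "A \<in> A_gens n" for A
      using that unfolding A_gens_def
    proof
      assume "A \<in> {alpha n j |j. j \<in> {1, 2, 3}}"
      then show "A \<otimes>\<^sub>k mat_e 2 2 \<in> {alpha (n + 1) j |j. j \<in> {1, 2, 3}} \<union>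
        {x \<otimes>\<^sub>k beta k j |x k j. j \<in> {1, 2, 3} \<and> k \<in> {1..n + 1} \<and> x \<in> M3 (n + 1 - k)}"
        unfolding Suc_eq_plus1[symmetric] by (force simp: alpha_Suc)
    next
      assume "A \<in> {x \<otimes>\<^sub>k beta k j |x k j. j \<in> {1, 2, 3} \<and> k \<in> {1..n} \<and> x \<in> M3 (n - k)}"
      then obtain x k j where A: "A = x \<otimes>\<^sub>k beta k j" "j \<in> {1, 2, 3}" "k \<in> {1..n}" "x \<in> M3 (n - k)"
        by blast
      then have "A \<otimes>\<^sub>k mat_e 2 2 = x \<otimes>\<^sub>k beta (Suc k) j" by (simp add: beta_Suc kron_assoc)
      moreover have "Suc k \<in> {1..n + 1}" "x \<in> M3 (n + 1 - Suc k)" using A by auto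
      ultimately show "A \<otimes>\<^sub>k mat_e 2 2 \<in> {alpha (n + 1) j |j. j \<in> {1, 2, 3}} \<union>
        {x \<otimes>\<^sub>k beta k j |x k j. j \<in> {1, 2, 3} \<and> k \<in> {1..n + 1} \<and> x \<in> M3 (n + 1 - k)}"
        using A(2) by blast
    qed
    then show "A_gens n \<subseteq> {A \<in> M3 (n + 1). A \<otimes>\<^sub>k mat_e 2 2 \<in> A_fin (n + 1)}"
      using A_gens_subset_A_fin[of "n + 1"] A_gens_M3[of n] by blast
    have "0\<^sub>m (3 ^ (n + 1)) (3 ^ (n + 1)) \<otimes>\<^sub>k mat_e 2 2 = 0\<^sub>m (3 ^ (n + 1 + 1)) (3 ^ (n + 1 + 1))"
      by (simp add: mat_e_def mult.commute)
    then show "0\<^sub>m (3 ^ (n + 1)) (3 ^ (n + 1)) \<in> {A \<in> M3 (n + 1). A \<otimes>\<^sub>k mat_e 2 2 \<in> A_fin (n + 1)}"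
      using A_fin_zero[of "n + 1"] by (simp del: kron_zero_left power_Suc)
  next
    fix A B
    assume "A \<in> {A \<in> M3 (n + 1). A \<otimes>\<^sub>k mat_e 2 2 \<in> A_fin (n + 1)}"
      "B \<in> {A \<in> M3 (n + 1). A \<otimes>\<^sub>k mat_e 2 2 \<in> A_fin (n + 1)}"
    then have AB: "A \<in> M3 (n + 1)" "B \<in> M3 (n + 1)"
      and "A \<otimes>\<^sub>k mat_e 2 2 + B \<otimes>\<^sub>k mat_e 2 2 \<in> A_fin (n + 1)"
      by (blast intro: A_fin_add)+
    then show "A + B \<in> {A \<in> M3 (n + 1). A \<otimes>\<^sub>k mat_e 2 2 \<in> A_fin (n + 1)}"
      by (simp only: kron_add_left[OF AB] mem_Collect_eq add_carrier_mat simp_thms)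
  next
    fix c A
    assume "A \<in> {A \<in> M3 (n + 1). A \<otimes>\<^sub>k mat_e 2 2 \<in> A_fin (n + 1)}"
    then show "c \<cdot>\<^sub>m A \<in> {A \<in> M3 (n + 1). A \<otimes>\<^sub>k mat_e 2 2 \<in> A_fin (n + 1)}"
      by (simp only: kron_smult_left mem_Collect_eq smult_carrier_mat A_fin_smult simp_thms)
  qed auto
  then show ?thesis using assms by blast
qed

text \<open>The generators \<open>alpha\<close> and those with k > 1 end in
  \<open>mat_e 2 2\<close>, and removing this factor gives generators of level n; they account for
  A. The generators with k = 1 account for t. Later arguments step between levels through this
  description.\<close>

lemma A_fin_Suc: "A_fin (Suc n) = {glue n A t | A t. A \<in> A_fin n \<and> (\<forall>q. t q \<in> M3 n)}" (is "_ = ?G")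
proof
  show "A_fin (Suc n) \<subseteq> ?G"
  proof (rule A_fin_subset)
    show "A_gens (Suc n) \<subseteq> ?G"
    proof
      fix X assume "X \<in> A_gens (Suc n)"
      then consider (alpha) j where "X = alpha (Suc n) j" "j \<in> {1, 2, 3}"
        | (beta) x k j where "X = x \<otimes>\<^sub>k beta k j" "j \<in> {1, 2, 3}" "k \<in> {1..Suc n}" "x \<in> M3 (Suc n - k)"
        unfolding A_gens_def by blast
      then show "X \<in> ?G"
      proof cases
        case alpha
        have a: "alpha n j \<in> A_fin n"
          using A_gens_subset_A_fin[of n] alpha(2) unfolding A_gens_def by blast
        then have "alpha n j \<in> M3 (n + 1)" using A_fin_M3 by blast
        with alpha have "X = glue n (alpha n j) (\<lambda>_. 0\<^sub>m (3 ^ n) (3 ^ n))"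
          by (simp only: alpha_Suc kron_e22_eq_glue)
        with a show ?thesis by (auto intro!: exI[of _ "alpha n j"])
      next
        case beta
        show ?thesis
        \<comment> \<open>For k = 1 the matrix x goes into t. For k > 1 a trailing
          \<open>mat_e 2 2\<close> is split off; n and k drop together, so x stays in the same
          matrix algebra.\<close>
        proof (cases "k = 1")
          case True
          then have "x \<in> M3 n" using beta by simp
          then have "X = glue n (0\<^sub>m (3 ^ (n + 1)) (3 ^ (n + 1)))
              (\<lambda>q. if q = (j + 2) mod 3 then x else 0\<^sub>m (3 ^ n) (3 ^ n))"
            using True beta by (simp only: kron_beta_1_eq_glue)
          with \<open>x \<in> M3 n\<close> show ?thesis
            using A_fin_zero[of n] by (intro CollectI exI conjI) (assumption, assumption, simp)
        next
          case False
          then obtain l where l: "k = Suc l" "l \<in> {1..n}" using beta(3) by (cases k) auto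
          have a: "x \<otimes>\<^sub>k beta l j \<in> A_fin n"
          proof (rule subsetD[OF A_gens_subset_A_fin])
            have "x \<in> M3 (n - l)" using beta(4) l(1) by simp
            then show "x \<otimes>\<^sub>k beta l j \<in> A_gens n" unfolding A_gens_def using beta(2) l(2) by blast
          qed
          then have "x \<otimes>\<^sub>k beta l j \<in> M3 (n + 1)" using A_fin_M3 by blast
          moreover have "X = (x \<otimes>\<^sub>k beta l j) \<otimes>\<^sub>k mat_e 2 2"
            using beta(1) l by (simp add: beta_Suc kron_assoc)
          ultimately have "X = glue n (x \<otimes>\<^sub>k beta l j) (\<lambda>_. 0\<^sub>m (3 ^ n) (3 ^ n))"
            by (simp only: kron_e22_eq_glue)
          with a show ?thesis by (auto intro!: exI[of _ "x \<otimes>\<^sub>k beta l j"])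
        qed
      qed
    qed
    show "?G \<subseteq> M3 (Suc n + 1)" using glue_M3[of n] by auto
    show "0\<^sub>m (3 ^ (Suc n + 1)) (3 ^ (Suc n + 1)) \<in> ?G"
    proof (intro CollectI exI conjI)
      show "0\<^sub>m (3 ^ (Suc n + 1)) (3 ^ (Suc n + 1)) =
          glue n (0\<^sub>m (3 ^ (n + 1)) (3 ^ (n + 1))) (\<lambda>_. 0\<^sub>m (3 ^ n) (3 ^ n))"
        unfolding glue_zero by simp
    qed (simp_all only: A_fin_zero zero_carrier_mat simp_thms)
  next
    fix X Y assume "X \<in> ?G" "Y \<in> ?G"
    then obtain A t B s where "X = glue n A t" "A \<in> A_fin n" "\<forall>q. t q \<in> M3 n"
      "Y = glue n B s" "B \<in> A_fin n" "\<forall>q. s q \<in> M3 n" by blast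
    moreover from this have "X + Y = glue n (A + B) (\<lambda>q. t q + s q)"
      using A_fin_M3[of n] by (simp only:) (blast intro: glue_add)
    ultimately show "X + Y \<in> ?G" by (blast intro: A_fin_add add_carrier_mat)
  next
    fix c X assume "X \<in> ?G"
    then obtain A t where "X = glue n A t" "A \<in> A_fin n" "\<forall>q. t q \<in> M3 n" by blast
    moreover from this have "c \<cdot>\<^sub>m X = glue n (c \<cdot>\<^sub>m A) (\<lambda>q. c \<cdot>\<^sub>m t q)"
      using A_fin_M3[of n] by (simp only:) (blast intro: glue_smult)
    ultimately show "c \<cdot>\<^sub>m X \<in> ?G" by (blast intro: A_fin_smult smult_carrier_mat)
  qed
  show "?G \<subseteq> A_fin (Suc n)"
  proof
    fix X assume "X \<in> ?G"
    then obtain A t where X: "X = glue n A t" and A: "A \<in> A_fin n" and t: "\<And>q. t q \<in> M3 n" by blast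
    let ?O = "0\<^sub>m (3 ^ n) (3 ^ n) :: complex mat" and ?Z = "0\<^sub>m (3 ^ (n + 1)) (3 ^ (n + 1)) :: complex mat"
    \<comment> \<open>\<open>?d j\<close> keeps t at the position of index j only, so the three
      functions add up to t on the positions 0, 1, 2.\<close>
    let ?d = "\<lambda>j q. if q = (j + 2) mod 3 then t ((j + 2) mod 3) else ?O"
    have A': "A \<in> M3 (n + 1)" using A A_fin_M3 by blast
    have d: "glue n ?Z (?d j) \<in> A_fin (Suc n)" if j: "j \<in> {1, 2, 3}" for j
    proof -
      have "t ((j + 2) mod 3) \<otimes>\<^sub>k beta 1 j \<in> A_gens (Suc n)"
        unfolding A_gens_def using j t[of "(j + 2) mod 3"]
        by (intro UnI2 CollectI exI[of _ "t ((j + 2) mod 3)"] exI[of _ 1] exI[of _ j]) auto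
      then show ?thesis
        using A_gens_subset_A_fin unfolding kron_beta_1_eq_glue[OF t j] by blast
    qed
    \<comment> \<open>The zero summands give both arguments the shape that \<open>glue_add\<close>
      produces from four glued matrices.\<close>
    have "X = glue n (A + (?Z + (?Z + ?Z))) (\<lambda>q. ?O + (?d 1 q + (?d 2 q + ?d 3 q)))"
    proof -
      have "A + (?Z + (?Z + ?Z)) = A" using A' by (simp del: power_Suc)
      moreover have "?O + (?d 1 q + (?d 2 q + ?d 3 q)) = t q" if "q < 3" for q
      proof -
        have "q = 0 \<or> q = 1 \<or> q = 2" using that by auto
        then show ?thesis using t by auto
      qed
      ultimately show ?thesis unfolding X by (auto intro!: glue_cong simp del: power_Suc)
    qed
    also have "\<dots> = glue n A (\<lambda>_. ?O) + (glue n ?Z (?d 1) + (glue n ?Z (?d 2) + glue n ?Z (?d 3)))"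
      using A' t by (simp add: glue_add del: power_Suc One_nat_def)
    finally have "X = A \<otimes>\<^sub>k mat_e 2 2 + (glue n ?Z (?d 1) + (glue n ?Z (?d 2) + glue n ?Z (?d 3)))"
      by (simp only: kron_e22_eq_glue[OF A'])
    also have "\<dots> \<in> A_fin (Suc n)"
      using kron_e22_A_fin[OF A] by (intro A_fin_add d) auto
    finally show "X \<in> A_fin (Suc n)" .
  qed
qed

text \<open>For n = 0 the range of k is empty and only the diagonal matrix units remain. The blocks
  in \<open>M3 0\<close> are 1 by 1, so the right-hand side is the algebra of diagonal
  matrices.\<close>

lemma A_fin_0: "A_fin 0 = {block_diag 0 c | c. \<forall>p. c p \<in> M3 0}" (is "_ = ?G")
proof
  have alpha: "alpha 0 j = block_diag 0 (\<lambda>p. if p = (j + 2) mod 3 then 1\<^sub>m (3 ^ 0) else 0\<^sub>m (3 ^ 0) (3 ^ 0))" for j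
  proof -
    have "1\<^sub>m (3 ^ 0) \<otimes>\<^sub>k mat_e j j = mat_e j j" by (intro eq_matI) auto
    then show ?thesis
      using kron_mat_e_eq_block_diag[of "1\<^sub>m (3 ^ 0)" 0 j] by (simp add: alpha_def)
  qed
  show "A_fin 0 \<subseteq> ?G"
  proof (rule A_fin_subset)
    show "A_gens 0 \<subseteq> ?G"
    proof
      fix X assume "X \<in> A_gens 0"
      then obtain j where "X = alpha 0 j" unfolding A_gens_def by auto
      then show "X \<in> ?G" unfolding alpha
        by (intro CollectI exI[of _ "\<lambda>p. if p = (j + 2) mod 3 then 1\<^sub>m (3 ^ 0) else 0\<^sub>m (3 ^ 0) (3 ^ 0)"]) auto
    qed
    show "?G \<subseteq> M3 (0 + 1)" using block_diag_M3[of 0] by auto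
    show "0\<^sub>m (3 ^ (0 + 1)) (3 ^ (0 + 1)) \<in> ?G"
      unfolding block_diag_zero[symmetric] by (intro CollectI exI[of _ "\<lambda>_. 0\<^sub>m (3 ^ 0) (3 ^ 0)"]) auto
  next
    fix X Y assume "X \<in> ?G" "Y \<in> ?G"
    then obtain c d where "X = block_diag 0 c" "\<forall>p. c p \<in> M3 0" "Y = block_diag 0 d" "\<forall>p. d p \<in> M3 0"
      by blast
    then show "X + Y \<in> ?G" by (intro CollectI exI[of _ "\<lambda>p. c p + d p"]) (auto intro!: block_diag_add)
  next
    fix a X assume "X \<in> ?G"
    then obtain c where "X = block_diag 0 c" "\<forall>p. c p \<in> M3 0" by blast
    then show "a \<cdot>\<^sub>m X \<in> ?G" by (intro CollectI exI[of _ "\<lambda>p. a \<cdot>\<^sub>m c p"]) (auto intro!: block_diag_smult)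
  qed
  show "?G \<subseteq> A_fin 0"
  proof
    fix X assume "X \<in> ?G"
    then obtain c where X: "X = block_diag 0 c" and c: "\<And>p. c p \<in> M3 0" by blast
    let ?d = "\<lambda>j p. if p = (j + 2) mod 3 then 1\<^sub>m (3 ^ 0) else 0\<^sub>m (3 ^ 0) (3 ^ 0) :: complex mat"
    \<comment> \<open>The single entry of the block at the position of index j is the coefficient of
      \<open>alpha 0 j\<close>.\<close>
    let ?c = "\<lambda>j. c ((j + 2) mod 3) $$ (0, 0)"
    have "X = block_diag 0 (\<lambda>p. ?c 1 \<cdot>\<^sub>m ?d 1 p + (?c 2 \<cdot>\<^sub>m ?d 2 p + ?c 3 \<cdot>\<^sub>m ?d 3 p))"
      unfolding X
    proof (rule block_diag_cong[OF refl])
      fix p :: nat assume "p < 3"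
      then have "p = 0 \<or> p = 1 \<or> p = 2" by auto
      then show "c p = ?c 1 \<cdot>\<^sub>m ?d 1 p + (?c 2 \<cdot>\<^sub>m ?d 2 p + ?c 3 \<cdot>\<^sub>m ?d 3 p)"
        using c[of p] by (intro eq_matI) auto
    qed
    also have "\<dots> = ?c 1 \<cdot>\<^sub>m alpha 0 1 + (?c 2 \<cdot>\<^sub>m alpha 0 2 + ?c 3 \<cdot>\<^sub>m alpha 0 3)"
    proof -
      have d: "?d j p \<in> M3 0" for j p by simp
      have "?c j \<cdot>\<^sub>m alpha 0 j = block_diag 0 (\<lambda>p. ?c j \<cdot>\<^sub>m ?d j p)" for j
        unfolding alpha by (rule block_diag_smult) simp
      then show ?thesis
        by (simp only: block_diag_add smult_carrier_mat add_carrier_mat d)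
    qed
    also have "\<dots> \<in> A_fin 0"
      using A_gens_subset_A_fin[of 0] unfolding A_gens_def by (intro A_fin_add A_fin_smult) blast+
    finally show "X \<in> A_fin 0" .
  qed
qed

text \<open>Both the base case and \<open>glue\<close> produce only block-diagonal matrices. Hence
  norms and limits can be treated blockwise.\<close>

lemma A_fin_eq_block_diag:
  assumes "X \<in> A_fin n"
  shows "X = block_diag n (\<lambda>p. diag_block p X)"
proof -
  obtain c where X: "X = block_diag n c" and c: "\<And>p. c p \<in> M3 n"
  proof (cases n)
    case 0
    then show thesis using assms that by (auto simp: A_fin_0)
  next
    case (Suc l)
    then obtain A t where X: "X = glue l A t" and "A \<in> A_fin l" "\<forall>q. t q \<in> M3 l"
      using assms by (auto simp only: A_fin_Suc)
    then have "A \<in> M3 (l + 1)" using A_fin_M3 by blast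
    then show thesis
      by (intro that[of "\<lambda>p. if p = 0 then block_diag l t else if p = 1 then A
        else block_diag l (\<lambda>q. t ((q + 1) mod 3))"]) (simp_all add: X Suc glue_def)
  qed
  show ?thesis
    unfolding X by (rule block_diag_cong[OF refl]) (simp add: diag_block_block_diag c)
qed

lemma diag_block_1_A_fin:
  assumes "X \<in> A_fin (Suc n)"
  shows "diag_block 1 X \<in> A_fin n"
proof -
  obtain A t where X: "X = glue n A t" and A: "A \<in> A_fin n"
    using assms by (auto simp only: A_fin_Suc)
  then have "A \<in> M3 (n + 1)" using A_fin_M3 by blast
  then show ?thesis using A by (simp only: X diag_block_glue)
qed

text \<open>Each slice takes block 1, which is the component A of a glued matrix and so lies one
  level below. By \<open>rho_uhf_emb\<close> this settles \<open>rho m\<close> on the finite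
  levels.\<close>

lemma slices_A_fin: "X \<in> A_fin (m + k) \<Longrightarrow> slices k X \<in> A_fin m"
proof (induction k arbitrary: X)
  case (Suc k)
  then have "slice_last e22_state X \<in> A_fin (m + k)"
    unfolding slice_last_e22_eq_diag_block by (intro diag_block_1_A_fin) simp
  then show ?case by (simp only: funpow_Suc_right o_def) (rule Suc.IH)
qed simp

subsection \<open>Closedness of \<open>A_fin n\<close>\<close>

lemma diag_block_tendsto:
  assumes X: "\<And>k. X k \<in> M3 (n + 1)" and Y: "Y \<in> M3 (n + 1)"
    and lim: "\<And>i j. i < 3 ^ (n + 1) \<Longrightarrow> j < 3 ^ (n + 1) \<Longrightarrow> (\<lambda>k. X k $$ (i, j)) \<longlonglongrightarrow> Y $$ (i, j)"
    and p: "p < 3" and ij: "i < 3 ^ n" "j < 3 ^ n"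
  shows "(\<lambda>k. diag_block p (X k) $$ (i, j)) \<longlonglongrightarrow> diag_block p Y $$ (i, j)"
proof -
  have "3 * i + p < 3 ^ (n + 1)" "3 * j + p < 3 ^ (n + 1)" using p ij by auto
  then show ?thesis
    unfolding index_diag_block[OF X p ij] index_diag_block[OF Y p ij] by (rule lim)
qed

text \<open>Block-diagonality means that the entries with i mod 3 \<noteq> j mod 3 vanish, and this
  survives entrywise limits.\<close>

lemma block_diag_limit:
  assumes X: "\<And>k. X k = block_diag n (\<lambda>p. diag_block p (X k))" and Y: "Y \<in> M3 (n + 1)"
    and lim: "\<And>i j. i < 3 ^ (n + 1) \<Longrightarrow> j < 3 ^ (n + 1) \<Longrightarrow> (\<lambda>k. X k $$ (i, j)) \<longlonglongrightarrow> Y $$ (i, j)"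
  shows "Y = block_diag n (\<lambda>p. diag_block p Y)"
proof (rule eq_matI)
  fix i j assume "i < dim_row (block_diag n (\<lambda>p. diag_block p Y))" "j < dim_col (block_diag n (\<lambda>p. diag_block p Y))"
  then have ij: "i < 3 ^ (n + 1)" "j < 3 ^ (n + 1)" by simp_all
  then have ij3: "i div 3 < 3 ^ n" "j div 3 < 3 ^ n" by auto
  show "Y $$ (i, j) = block_diag n (\<lambda>p. diag_block p Y) $$ (i, j)"
  proof (cases "i mod 3 = j mod 3")
    case True
    have "diag_block (i mod 3) Y $$ (i div 3, j div 3) = Y $$ (3 * (i div 3) + i mod 3, 3 * (j div 3) + i mod 3)"
      by (rule index_diag_block[OF Y _ ij3]) simp
    also have "\<dots> = Y $$ (i, j)" by (simp only: mult_div_mod_eq) (simp only: True mult_div_mod_eq)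
    finally show ?thesis using True by (simp add: index_block_diag[OF ij])
  next
    case False
    then have "X k $$ (i, j) = 0" for k by (subst X) (simp add: index_block_diag[OF ij])
    then have "Y $$ (i, j) = 0" using lim[OF ij] by (simp add: LIMSEQ_const_iff)
    then show ?thesis using False by (simp add: index_block_diag[OF ij])
  qed
qed (use Y in auto)

text \<open>Membership one level up consists of equations between entries, which pass to the limit,
  and of membership of block 1 one level below, which is the induction hypothesis. Convergence is
  entrywise because this is what \<open>rho_index_tendsto\<close> supplies.\<close>

lemma A_fin_limit:
  assumes "\<And>k. X k \<in> A_fin n" "Y \<in> M3 (n + 1)"
    and "\<And>i j. i < 3 ^ (n + 1) \<Longrightarrow> j < 3 ^ (n + 1) \<Longrightarrow> (\<lambda>k. X k $$ (i, j)) \<longlonglongrightarrow> Y $$ (i, j)"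
  shows "Y \<in> A_fin n"
  using assms
proof (induction n arbitrary: X Y)
  case 0
  have "Y = block_diag 0 (\<lambda>p. diag_block p Y)"
    by (rule block_diag_limit[OF A_fin_eq_block_diag[OF 0(1)] 0(2,3)])
  moreover have "diag_block p Y \<in> M3 0" for p using 0(2) by (rule diag_block_M3)
  ultimately show ?case unfolding A_fin_0 by blast
next
  case (Suc n)
  have X: "X k \<in> M3 (n + 1 + 1)" for k using Suc.prems(1)[of k] A_fin_M3[of "Suc n"] by auto
  have Y: "Y \<in> M3 (n + 1 + 1)" using Suc.prems(2) by simp
  note lim = Suc.prems(3)[unfolded Suc_eq_plus1]
  have XB: "diag_block p (X k) \<in> M3 (n + 1)" for p k by (rule diag_block_M3[OF X])
  have YB: "diag_block p Y \<in> M3 (n + 1)" for p by (rule diag_block_M3[OF Y])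
  note limB = diag_block_tendsto[OF X Y lim]
  \<comment> \<open>The cyclic shift in \<open>glue\<close> compares blocks of blocks, so
    convergence is needed two levels deep.\<close>
  note limBB = diag_block_tendsto[OF XB YB limB]
  have XG: "\<exists>A t. X k = glue n A t \<and> A \<in> M3 (n + 1) \<and> (\<forall>q. t q \<in> M3 n)" for k
    using Suc.prems(1)[of k] A_fin_M3[of n] unfolding A_fin_Suc by blast
  \<comment> \<open>The equations that characterise glued matrices, expressed by
    \<open>diag_block\<close> alone, so that no choice of t depending on k has to converge.\<close>
  have X0: "diag_block 0 (X k) = block_diag n (\<lambda>q. diag_block q (diag_block 0 (X k)))"
    and X2: "diag_block 2 (X k) = block_diag n (\<lambda>q. diag_block q (diag_block 2 (X k)))"
    and X02: "q < 3 \<Longrightarrow> diag_block q (diag_block 2 (X k)) = diag_block ((q + 1) mod 3) (diag_block 0 (X k))"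
    for k q
  proof -
    obtain A t where G: "X k = glue n A t" "A \<in> M3 (n + 1)" and t: "\<And>q. t q \<in> M3 n" using XG by blast
    note G' = diag_block_glue[OF G(2), of t, folded G(1)]
    show "diag_block 0 (X k) = block_diag n (\<lambda>q. diag_block q (diag_block 0 (X k)))"
      unfolding G' by (rule block_diag_cong[OF refl]) (simp add: diag_block_block_diag t)
    show "diag_block 2 (X k) = block_diag n (\<lambda>q. diag_block q (diag_block 2 (X k)))"
      unfolding G' by (rule block_diag_cong[OF refl]) (simp add: diag_block_block_diag t)
    show "q < 3 \<Longrightarrow> diag_block q (diag_block 2 (X k)) = diag_block ((q + 1) mod 3) (diag_block 0 (X k))"
      unfolding G' by (simp add: diag_block_block_diag t)
  qed
  \<comment> \<open>The t of the limit is read off block 0, where \<open>glue\<close> stores it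
    unshifted.\<close>
  let ?t = "\<lambda>q. diag_block q (diag_block 0 Y)"
  have Y0: "diag_block 0 Y = block_diag n ?t"
    by (rule block_diag_limit[OF X0 YB limB]) simp_all
  have "diag_block 2 Y = block_diag n (\<lambda>q. diag_block q (diag_block 2 Y))"
    by (rule block_diag_limit[OF X2 YB limB]) simp_all
  also have "\<dots> = block_diag n (\<lambda>q. ?t ((q + 1) mod 3))"
  proof (rule block_diag_cong[OF refl])
    fix q :: nat assume q: "q < 3"
    have M: "diag_block q (diag_block 2 Y) \<in> M3 n" "?t ((q + 1) mod 3) \<in> M3 n"
      by (rule diag_block_M3[OF YB])+
    show "diag_block q (diag_block 2 Y) = ?t ((q + 1) mod 3)"
    proof (rule eq_matI)
      fix i j assume "i < dim_row (?t ((q + 1) mod 3))" "j < dim_col (?t ((q + 1) mod 3))"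
      then have ij: "i < 3 ^ n" "j < 3 ^ n" using M by auto
      have "(\<lambda>k. diag_block q (diag_block 2 (X k)) $$ (i, j)) \<longlonglongrightarrow> diag_block q (diag_block 2 Y) $$ (i, j)"
        by (rule limBB) (use q ij in simp_all)
      moreover have "(\<lambda>k. diag_block ((q + 1) mod 3) (diag_block 0 (X k)) $$ (i, j)) \<longlonglongrightarrow> ?t ((q + 1) mod 3) $$ (i, j)"
        by (rule limBB) (use q ij in simp_all)
      ultimately show "diag_block q (diag_block 2 Y) $$ (i, j) = ?t ((q + 1) mod 3) $$ (i, j)"
        unfolding X02[OF q] by (rule LIMSEQ_unique)
    qed (use M in auto)
  qed
  finally have Y2: "diag_block 2 Y = block_diag n (\<lambda>q. ?t ((q + 1) mod 3))" .
  have "Y = block_diag (n + 1) (\<lambda>p. diag_block p Y)"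
  proof (rule block_diag_limit[OF _ Y lim])
    show "X k = block_diag (n + 1) (\<lambda>p. diag_block p (X k))" for k
      using A_fin_eq_block_diag[OF Suc.prems(1)] by simp
  qed
  also have "\<dots> = glue n (diag_block 1 Y) ?t"
    unfolding glue_def
  proof (rule block_diag_cong[OF refl])
    fix p :: nat assume "p < 3"
    then have "p = 0 \<or> p = 1 \<or> p = 2" by auto
    then show "diag_block p Y = (if p = 0 then block_diag n ?t else if p = 1 then diag_block 1 Y
        else block_diag n (\<lambda>q. ?t ((q + 1) mod 3)))"
      using Y0 Y2 by (elim disjE) simp_all
  qed
  finally have "Y = glue n (diag_block 1 Y) ?t" .
  moreover have "diag_block 1 Y \<in> A_fin n"
    by (rule Suc.IH[OF diag_block_1_A_fin[OF Suc.prems(1)] YB limB]) simp_all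
  moreover have "?t q \<in> M3 n" for q by (rule diag_block_M3[OF YB])
  ultimately show ?case unfolding A_fin_Suc by blast
qed

subsection \<open>Midpoint interpolation\<close>

text \<open>\<open>glue\<close> uses \<open>t q\<close> twice: at position q of block 0 and at
  position (q + 2) mod 3 of block 2. Averaging the blocks of A at these two positions keeps both
  copies close to A.\<close>

definition midpoints :: "complex mat \<Rightarrow> nat \<Rightarrow> complex mat" where
  "midpoints A q = (1 / 2) \<cdot>\<^sub>m (diag_block q A + diag_block ((q + 2) mod 3) A)"

definition refine :: "nat \<Rightarrow> complex mat \<Rightarrow> complex mat" where
  "refine n A = glue n A (midpoints A)"

text \<open>A predicate on bounds instead of the maximum itself, so that halving is an implication
  between bounds. The instances p = q force r \<ge> 0.\<close>

definition oscillation_le :: "real \<Rightarrow> complex mat \<Rightarrow> bool" where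
  "oscillation_le r A \<longleftrightarrow> (\<forall>p<3. \<forall>q<3. op_norm (diag_block p A - diag_block q A) \<le> r)"

lemma oscillation_leD:
  "oscillation_le r A \<Longrightarrow> p < 3 \<Longrightarrow> q < 3 \<Longrightarrow> op_norm (diag_block p A - diag_block q A) \<le> r"
  by (simp add: oscillation_le_def)

lemma oscillation_le_exists: "\<exists>r. oscillation_le r A"
proof -
  have "oscillation_le (\<Sum>p<3. \<Sum>q<3. op_norm (diag_block p A - diag_block q A)) A"
    unfolding oscillation_le_def
  proof (intro allI impI)
    fix p q :: nat assume "p < 3" "q < 3"
    then have "op_norm (diag_block p A - diag_block q A) \<le> (\<Sum>q<3. op_norm (diag_block p A - diag_block q A))"
      by (intro member_le_sum) auto
    also have "\<dots> \<le> (\<Sum>p<3. \<Sum>q<3. op_norm (diag_block p A - diag_block q A))"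
      using \<open>p < 3\<close> by (intro member_le_sum[where f = "\<lambda>p. \<Sum>q<3. op_norm (diag_block p A - diag_block q A)"])
        (auto intro: sum_nonneg)
    finally show "op_norm (diag_block p A - diag_block q A) \<le> (\<Sum>p<3. \<Sum>q<3. op_norm (diag_block p A - diag_block q A))" .
  qed
  then show ?thesis by blast
qed

lemma midpoints_M3:
  assumes "A \<in> M3 (n + 1)"
  shows "midpoints A q \<in> M3 n"
  unfolding midpoints_def by (intro smult_carrier_mat add_carrier_mat diag_block_M3 assms)

lemma refine_A_fin:
  assumes "A \<in> A_fin n"
  shows "refine n A \<in> A_fin (Suc n)"
proof -
  have "A \<in> M3 (n + 1)" using assms A_fin_M3 by blast
  then show ?thesis using assms midpoints_M3 unfolding A_fin_Suc refine_def by blast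
qed

text \<open>Refinement keeps A as block 1, so it is a section of the slice map.\<close>

lemma slice_last_refine: "A \<in> M3 (n + 1) \<Longrightarrow> slice_last e22_state (refine n A) = A"
  by (simp only: slice_last_e22_eq_diag_block refine_def diag_block_glue)

text \<open>Every difference estimated below is half a difference of two diagonal blocks. The
  equation for X leaves this identification as a separate entrywise goal.\<close>

lemma op_norm_half_le:
  assumes "A \<in> M3 n" "B \<in> M3 n" "op_norm (A - B) \<le> r" "X = (1 / 2) \<cdot>\<^sub>m (A - B)"
  shows "op_norm X \<le> r / 2"
  using assms op_norm_smult[OF minus_carrier_mat[OF assms(2), of A], of "1 / 2"] by (simp add: norm_divide)

text \<open>These are the mutual distances of the three diagonal blocks of
  \<open>refine n A\<close>. A midpoint lies at half the distance from each end, and the midpoints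
  of two sides of a triangle differ by half the third side.\<close>

lemma refine_block_bounds:
  assumes A: "A \<in> A_fin n" and r: "oscillation_le r A"
  shows "op_norm (block_diag n (midpoints A) - A) \<le> r / 2"
    and "op_norm (block_diag n (\<lambda>q. midpoints A ((q + 1) mod 3)) - A) \<le> r / 2"
    and "op_norm (block_diag n (midpoints A) - block_diag n (\<lambda>q. midpoints A ((q + 1) mod 3))) \<le> r / 2"
proof -
  let ?c = "\<lambda>p. diag_block p A"
  have AM: "A \<in> M3 (n + 1)" using A A_fin_M3 by blast
  have c: "?c p \<in> M3 n" for p by (rule diag_block_M3[OF AM])
  note t = midpoints_M3[OF AM]
  have Ac: "A = block_diag n ?c" by (rule A_fin_eq_block_diag[OF A])
  \<comment> \<open>Since (q + 1) + 2 is q mod 3, the shifted midpoint also has \<open>?c q\<close>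
    as one of its ends.\<close>
  have t1: "midpoints A ((q + 1) mod 3) = (1 / 2) \<cdot>\<^sub>m (?c ((q + 1) mod 3) + ?c q)" if "q < 3" for q
  proof -
    have "((q + 1) mod 3 + 2) mod 3 = q"
      using that by (cases "q = 2") auto
    then show ?thesis by (simp only: midpoints_def)
  qed
  \<comment> \<open>Only the subtrahend A is expanded into blocks; the occurrence inside
    \<open>midpoints\<close> stays.\<close>
  have "block_diag n (midpoints A) - A = block_diag n (\<lambda>q. midpoints A q - ?c q)"
    by (subst (2) Ac, rule block_diag_minus) (auto intro: t c)
  also have "op_norm \<dots> \<le> r / 2"
  proof (rule op_norm_block_diag_le)
    fix q :: nat assume "q < 3"
    then show "op_norm (midpoints A q - ?c q) \<le> r / 2"
      using c[of q] c[of "(q + 2) mod 3"]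
      by (intro op_norm_half_le[OF c c oscillation_leD[OF r, of "(q + 2) mod 3" q]] eq_matI)
        (auto simp: midpoints_def field_simps)
  qed (intro M3_minus t c)
  finally show "op_norm (block_diag n (midpoints A) - A) \<le> r / 2" .
  have "block_diag n (\<lambda>q. midpoints A ((q + 1) mod 3)) - A
      = block_diag n (\<lambda>q. midpoints A ((q + 1) mod 3) - ?c q)"
    by (subst (2) Ac, rule block_diag_minus) (auto intro: t c)
  also have "op_norm \<dots> \<le> r / 2"
  proof (rule op_norm_block_diag_le)
    fix q :: nat assume q: "q < 3"
    then show "op_norm (midpoints A ((q + 1) mod 3) - ?c q) \<le> r / 2"
      unfolding t1[OF q] using c[of q] c[of "(q + 1) mod 3"]
      by (intro op_norm_half_le[OF c c oscillation_leD[OF r, of "(q + 1) mod 3" q]] eq_matI)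
        (auto simp: field_simps)
  qed (intro M3_minus t c)
  finally show "op_norm (block_diag n (\<lambda>q. midpoints A ((q + 1) mod 3)) - A) \<le> r / 2" .
  have "block_diag n (midpoints A) - block_diag n (\<lambda>q. midpoints A ((q + 1) mod 3))
      = block_diag n (\<lambda>q. midpoints A q - midpoints A ((q + 1) mod 3))"
    by (rule block_diag_minus) (auto intro: t)
  also have "op_norm \<dots> \<le> r / 2"
  proof (rule op_norm_block_diag_le)
    fix q :: nat assume q: "q < 3"
    then show "op_norm (midpoints A q - midpoints A ((q + 1) mod 3)) \<le> r / 2"
      unfolding t1[OF q] using c[of q] c[of "(q + 1) mod 3"] c[of "(q + 2) mod 3"]
      by (intro op_norm_half_le[OF c c oscillation_leD[OF r, of "(q + 2) mod 3" "(q + 1) mod 3"]] eq_matI)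
        (auto simp: midpoints_def field_simps)
  qed (intro M3_minus t)
  finally show "op_norm (block_diag n (midpoints A) - block_diag n (\<lambda>q. midpoints A ((q + 1) mod 3))) \<le> r / 2" .
qed

text \<open>\<open>amp 1 A\<close> has A in all three blocks, so the difference vanishes in block 1
  and is controlled by the first two block bounds elsewhere.\<close>

lemma refine_minus_amp:
  assumes A: "A \<in> A_fin n" and r: "oscillation_le r A"
  shows "op_norm (refine n A - amp 1 A) \<le> r / 2"
proof -
  have AM: "A \<in> M3 (n + 1)" using A A_fin_M3 by blast
  let ?B = "\<lambda>p. if p = 0 then block_diag n (midpoints A) else if p = 1 then A
     else block_diag n (\<lambda>q. midpoints A ((q + 1) mod 3))"
  have r0: "0 \<le> r" using oscillation_leD[OF r, of 0 0] by simp
  have B: "?B p \<in> M3 (n + 1)" for p using AM by simp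
  have "refine n A - amp 1 A = block_diag (n + 1) (\<lambda>p. ?B p - A)"
    unfolding refine_def glue_def amp_1_eq_block_diag[OF AM] by (rule block_diag_minus[OF B AM])
  also have "op_norm \<dots> \<le> r / 2"
  proof (rule op_norm_block_diag_le)
    fix p :: nat assume "p < 3"
    show "?B p - A \<in> M3 (n + 1)" by (rule M3_minus[OF B AM])
    show "op_norm (?B p - A) \<le> r / 2" using refine_block_bounds[OF A r] r0 by simp
  qed
  finally show ?thesis .
qed

text \<open>Together with \<open>refine_minus_amp\<close> this gives geometric decay of the steps
  when refinement is iterated.\<close>

lemma oscillation_le_refine:
  assumes A: "A \<in> A_fin n" and r: "oscillation_le r A"
  shows "oscillation_le (r / 2) (refine n A)"
  unfolding oscillation_le_def
proof (intro allI impI)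
  have AM: "A \<in> M3 (n + 1)" using A A_fin_M3 by blast
  have r0: "0 \<le> r" using oscillation_leD[OF r, of 0 0] by simp
  let ?B0 = "block_diag n (midpoints A)" and ?B2 = "block_diag n (\<lambda>q. midpoints A ((q + 1) mod 3))"
  note b = refine_block_bounds[OF A r]
  \<comment> \<open>The block bounds with the two matrices exchanged, for the pairs p, q in the
    opposite order.\<close>
  note b' = order.trans[OF eq_refl[OF op_norm_minus_commute[OF AM block_diag_M3]] b(1)]
    order.trans[OF eq_refl[OF op_norm_minus_commute[OF AM block_diag_M3]] b(2)]
    order.trans[OF eq_refl[OF op_norm_minus_commute[OF block_diag_M3 block_diag_M3]] b(3)]
  fix p q :: nat assume "p < 3" "q < 3"
  then have "p = 0 \<or> p = 1 \<or> p = 2" "q = 0 \<or> q = 1 \<or> q = 2" by auto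
  then show "op_norm (diag_block p (refine n A) - diag_block q (refine n A)) \<le> r / 2"
    unfolding refine_def
    by (elim disjE; simp only: diag_block_glue[OF AM] op_norm_minus_self b b') (use r0 in simp_all)
qed

section \<open>Iterated refinement and its norm limit\<close>

primrec refine_iter :: "nat \<Rightarrow> complex mat \<Rightarrow> nat \<Rightarrow> complex mat" where
  "refine_iter m A 0 = A"
| "refine_iter m A (Suc k) = refine (m + k) (refine_iter m A k)"

lemma refine_iter_A_fin: "A \<in> A_fin m \<Longrightarrow> refine_iter m A k \<in> A_fin (m + k)"
  by (induction k) (simp_all add: refine_A_fin)

lemma refine_iter_M3:
  assumes "A \<in> A_fin m"
  shows "refine_iter m A k \<in> M3 (m + 1 + k)"
  using refine_iter_A_fin[OF assms, of k] A_fin_M3[of "m + k"] by auto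

lemma oscillation_le_refine_iter:
  assumes "A \<in> A_fin m" "oscillation_le r A"
  shows "oscillation_le (r / 2 ^ k) (refine_iter m A k)"
proof (induction k)
  case (Suc k)
  then show ?case
    using oscillation_le_refine[OF refine_iter_A_fin[OF assms(1)]] by (fastforce simp: field_simps)
qed (simp add: assms)

lemma slices_refine_iter:
  assumes "A \<in> A_fin m"
  shows "slices k (refine_iter m A k) = A"
proof (induction k)
  case (Suc k)
  have "slice_last e22_state (refine_iter m A (Suc k)) = refine_iter m A k"
    using refine_iter_M3[OF assms, of k] by (simp add: slice_last_refine)
  then show ?case using Suc.IH by (simp only: funpow_Suc_right o_def)
qed simp

text \<open>Consecutive terms differ by at most \<open>r / 2 ^ (k + 1)\<close>, so the telescoping
  series converges absolutely in the Banach space \<open>uhf\<close>.\<close>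

lemma convergent_refine_iter:
  assumes A: "A \<in> A_fin m"
  shows "convergent (\<lambda>k. uhf_emb (m + 1 + k) (refine_iter m A k))"
proof -
  let ?y = "refine_iter m A"
  let ?u = "\<lambda>k. uhf_emb (m + 1 + k) (?y k)"
  obtain r where r: "oscillation_le r A" using oscillation_le_exists by blast
  have y: "?y k \<in> M3 (m + 1 + k)" for k by (rule refine_iter_M3[OF A])
  have "norm (?u (Suc k) - ?u k) \<le> r / 2 * (1 / 2) ^ k" for k
  proof -
    have a: "amp 1 (?y k) \<in> M3 (m + 1 + Suc k)" using amp_M3[OF y[of k], of 1] by simp
    \<comment> \<open>Both terms are brought to the same level, where the embedding is additive and
      isometric.\<close>
    have "?u k = uhf_emb (m + 1 + Suc k) (amp 1 (?y k))"
      using uhf_emb_amp[OF y[of k], of 1] by simp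
    then have "?u (Suc k) - ?u k = uhf_emb (m + 1 + Suc k) (?y (Suc k) - amp 1 (?y k))"
      by (simp only: uhf_emb_minus[OF y a])
    then have "norm (?u (Suc k) - ?u k) = op_norm (refine (m + k) (?y k) - amp 1 (?y k))"
      using norm_uhf_emb[OF M3_minus[OF y a]] by simp
    also have "\<dots> \<le> (r / 2 ^ k) / 2"
      by (rule refine_minus_amp[OF refine_iter_A_fin[OF A] oscillation_le_refine_iter[OF A r]])
    finally show ?thesis by (simp add: power_divide mult.commute)
  qed
  moreover have "summable (\<lambda>k. r / 2 * (1 / 2) ^ k)"
    by (rule summable_mult[OF summable_geometric]) simp
  ultimately have "summable (\<lambda>k. ?u (Suc k) - ?u k)"
    by (rule summable_comparison_test'[where N = 0, rotated])
  then have "(\<lambda>n. \<Sum>k<n. ?u (Suc k) - ?u k) \<longlonglongrightarrow> (\<Sum>k. ?u (Suc k) - ?u k)"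
    by (rule summable_LIMSEQ)
  then have "(\<lambda>n. ?u n - ?u 0 + ?u 0) \<longlonglongrightarrow> (\<Sum>k. ?u (Suc k) - ?u k) + ?u 0"
    unfolding sum_lessThan_telescope[of ?u] by (intro tendsto_add tendsto_const)
  then show ?thesis by (auto simp: convergent_def)
qed

section \<open>Continuity of the slice maps and the two inclusions\<close>

text \<open>\<open>rho m\<close> is additive and contractive, and an entry is bounded by the
  operator norm.\<close>

lemma rho_index_tendsto:
  assumes u: "u \<longlonglongrightarrow> a" and ij: "i < 3 ^ (m + 1)" "j < 3 ^ (m + 1)"
  shows "(\<lambda>k. rho m (u k) $$ (i, j)) \<longlonglongrightarrow> rho m a $$ (i, j)"
proof (rule Lim_transform2[OF tendsto_const])
  show "(\<lambda>k. rho m a $$ (i, j) - rho m (u k) $$ (i, j)) \<longlonglongrightarrow> 0"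
  proof (rule tendsto_0_le[where K = 1])
    show "(\<lambda>k. norm (a - u k)) \<longlonglongrightarrow> 0"
      using tendsto_norm[OF tendsto_diff[OF tendsto_const[of a] u]] by simp
    have "norm (rho m a $$ (i, j) - rho m (u k) $$ (i, j)) \<le> norm (a - u k)" for k
    proof -
      have "rho m a = rho m (u k) + rho m (a - u k)" by (simp add: rho_add[symmetric])
      then have "rho m a $$ (i, j) = rho m (u k) $$ (i, j) + rho m (a - u k) $$ (i, j)"
        using ij carrier_matD[OF rho_M3[of m "a - u k"]] by simp
      then have "norm (rho m a $$ (i, j) - rho m (u k) $$ (i, j)) = cmod (rho m (a - u k) $$ (i, j))"
        by simp
      also have "\<dots> \<le> op_norm (rho m (a - u k))" by (rule index_le_op_norm[OF rho_M3 ij])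
      also have "\<dots> \<le> norm (a - u k)" by (rule op_norm_rho_le)
      finally show ?thesis .
    qed
    then show "\<forall>\<^sub>F k in sequentially. norm (rho m a $$ (i, j) - rho m (u k) $$ (i, j)) \<le> norm (norm (a - u k)) * 1"
      by simp
  qed
qed

text \<open>On the approximating sequence \<open>rho m\<close> is a finite slice with values in
  \<open>A_fin m\<close>, and this space is closed under entrywise limits.\<close>

lemma rho_A_inf:
  assumes "a \<in> A_inf"
  shows "rho m a \<in> A_fin m"
proof -
  obtain x where x: "\<And>n. x n \<in> A_fin n" and lim: "(\<lambda>n. uhf_emb (n + 1) (x n)) \<longlonglongrightarrow> a"
    using assms by (auto simp: A_inf_def)
  \<comment> \<open>Dropping the first m terms leaves the levels from m + 1 on, where
    \<open>rho_uhf_emb\<close> applies.\<close>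
  let ?u = "\<lambda>k. uhf_emb (m + 1 + k) (x (m + k))"
  have u: "?u \<longlonglongrightarrow> a"
    using LIMSEQ_ignore_initial_segment[OF lim, of m] by (simp add: ac_simps)
  have "rho m (?u k) \<in> A_fin m" for k
  proof -
    have "x (m + k) \<in> M3 (m + 1 + k)" using x[of "m + k"] A_fin_M3[of "m + k"] by auto
    then show ?thesis using x[of "m + k"] by (simp only: rho_uhf_emb slices_A_fin)
  qed
  then show ?thesis by (rule A_fin_limit[OF _ rho_M3 rho_index_tendsto[OF u]])
qed

lemma A_fin_lift:
  assumes A: "A \<in> A_fin m"
  obtains a where "a \<in> A_inf" "rho m a = A"
proof -
  let ?u = "\<lambda>k. uhf_emb (m + 1 + k) (refine_iter m A k)"
  obtain a where u: "?u \<longlonglongrightarrow> a" using convergent_refine_iter[OF A] by (auto simp: convergent_def)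
  \<comment> \<open>\<open>A_inf\<close> asks for a term at every n. The terms with n < m are filled
    with zero and do not affect the limit.\<close>
  define x where "x n = (if n < m then 0\<^sub>m (3 ^ (n + 1)) (3 ^ (n + 1)) else refine_iter m A (n - m))" for n
  have "x n \<in> A_fin n" for n
    using refine_iter_A_fin[OF A, of "n - m"] A_fin_zero[of n]
    by (cases "n < m") (simp_all add: x_def del: power_Suc)
  moreover have "(\<lambda>n. uhf_emb (n + 1) (x n)) \<longlonglongrightarrow> a"
    by (rule LIMSEQ_offset[where k = m]) (use u in \<open>simp add: x_def ac_simps\<close>)
  ultimately have "a \<in> A_inf" by (auto simp: A_inf_def)
  moreover have "rho m a = A"
  proof (rule eq_matI)
    have AM: "A \<in> M3 (m + 1)" using A A_fin_M3 by blast
    then show "dim_row (rho m a) = dim_row A" "dim_col (rho m a) = dim_col A"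
      using carrier_matD[OF rho_M3[of m a]] by simp_all
    fix i j assume "i < dim_row A" "j < dim_col A"
    then have ij: "i < 3 ^ (m + 1)" "j < 3 ^ (m + 1)" using AM by auto
    \<comment> \<open>Slicing undoes all k refinements, so \<open>rho m\<close> is constant along
      the sequence and takes the same value at the limit.\<close>
    have "rho m (?u k) = A" for k
      by (simp only: rho_uhf_emb[OF refine_iter_M3[OF A]] slices_refine_iter[OF A])
    then show "rho m a $$ (i, j) = A $$ (i, j)"
      using rho_index_tendsto[OF u ij] by (simp add: LIMSEQ_const_iff)
  qed
  ultimately show thesis by (rule that)
qed

theorem corollary2p21:
  fixes m :: nat
  shows "rho m ` A_inf = A_fin m"
proof
  show "rho m ` A_inf \<subseteq> A_fin m" using rho_A_inf by blast
  show "A_fin m \<subseteq> rho m ` A_inf" using A_fin_lift by (metis image_eqI subsetI)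
qed

end
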